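(* Assume (H1), (H2), (H3), (H4). Let $w\in H^{-1}(\Omega)$ and let $u\in H_0^1(\Omega)$ satisfy $\int_\Omega j_\xi(x,u,\nabla u)\cdot\nabla z+\int_\Omega j_s(x,u,\nabla u)z=\langle w,z\rangle$ for all $z\in V_u$, with $j_\xi(x,u,\nabla u)\cdot\nabla u\in L^1(\Omega)$. Let $(\vartheta_h)\subset C_c^1(\mathbb{R})$ satisfy $\sup_h\|\vartheta_h\|_\infty<\infty$, $\sup_h\|\vartheta_h'\|_\infty<\infty$, and $\vartheta_h(s)\to1$, $\vartheta_h'(s)\to0$ for every $s\in\mathbb{R}$. Then for every $1<q<\frac{N}{N-1}$ the sequence $\operatorname{div}[\vartheta_h(u)j_\xi(x,u,\nabla u)]$ converges strongly in $W^{-1,q}(\Omega)$, and $$\lim_{h\to\infty}\big\{-\operatorname{div}[\vartheta_h(u)j_\xi(x,u,\nabla u)]\big\}+j_s(x,u,\nabla u)=w\quad\text{in }W^{-1,q}(\Omega).$$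
   Context: $\Omega\subset\mathbb{R}^N$ bounded open, $N\ge3$. $j$ measurable in $x$, $C^1$ in $(s,\xi)$, partial derivatives $j_s,j_\xi$. (H1) $\xi\mapsto j(x,s,\xi)$ strictly convex; (H2) $\alpha_0|\xi|^2\le j(x,s,\xi)\le\alpha(|s|)|\xi|^2$ ($\alpha_0>0$, $\alpha$ positive increasing continuous); (H3) $|j_s(x,s,\xi)|\le\beta(|s|)|\xi|^2$ ($\beta$ positive increasing continuous); (H4) $j_s(x,s,\xi)s\ge0$ for $|s|\ge R$, some $R>0$. $V_u=\{z\in H_0^1\cap L^\infty: u\in L^\infty(\{z\ne0\})\}$. *)

theory Defs
  imports "HOL-Analysis.Analysis"
begin

definition partial :: "(real^'n \<Rightarrow> real) \<Rightarrow> 'n \<Rightarrow> real^'n \<Rightarrow> real" where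
  "partial f i x = frechet_derivative f (at x) (axis i 1)"

fun iter_partial :: "(real^'n \<Rightarrow> real) \<Rightarrow> 'n list \<Rightarrow> real^'n \<Rightarrow> real" where
  "iter_partial f [] = f"
| "iter_partial f (i # is) = partial (iter_partial f is) i"

definition grad :: "(real^'n \<Rightarrow> real) \<Rightarrow> real^'n \<Rightarrow> real^'n" where
  "grad f x = (\<chi> i. partial f i x)"

definition smooth :: "(real^'n \<Rightarrow> real) \<Rightarrow> bool" where
  "smooth f \<longleftrightarrow> (\<forall>is. (\<forall>x. iter_partial f is differentiable (at x))
                       \<and> continuous_on UNIV (iter_partial f is))"

definition test_fun :: "(real^'n) set \<Rightarrow> (real^'n \<Rightarrow> real) set" where
  "test_fun \<Omega> = {\<phi>. smooth \<phi> \<and> compact (closure {x. \<phi> x \<noteq> 0})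
                       \<and> closure {x. \<phi> x \<noteq> 0} \<subseteq> \<Omega>}"

definition in_Lp :: "(real^'n) set \<Rightarrow> real \<Rightarrow> (real^'n \<Rightarrow> real) \<Rightarrow> bool" where
  "in_Lp \<Omega> p f \<longleftrightarrow> f \<in> borel_measurable (lebesgue_on \<Omega>)
                     \<and> integrable (lebesgue_on \<Omega>) (\<lambda>x. \<bar>f x\<bar> powr p)"

definition Lp_norm :: "(real^'n) set \<Rightarrow> real \<Rightarrow> (real^'n \<Rightarrow> real) \<Rightarrow> real" where
  "Lp_norm \<Omega> p f = (\<integral>x. \<bar>f x\<bar> powr p \<partial>lebesgue_on \<Omega>) powr (1 / p)"

definition loc_int :: "(real^'n) set \<Rightarrow> (real^'n \<Rightarrow> real) \<Rightarrow> bool" where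
  "loc_int \<Omega> f \<longleftrightarrow> (\<forall>K. compact K \<and> K \<subseteq> \<Omega> \<longrightarrow> integrable (lebesgue_on K) f)"

definition weak_grad :: "(real^'n) set \<Rightarrow> (real^'n \<Rightarrow> real) \<Rightarrow> (real^'n \<Rightarrow> real^'n) \<Rightarrow> bool" where
  "weak_grad \<Omega> u g \<longleftrightarrow> loc_int \<Omega> u \<and> (\<forall>i. loc_int \<Omega> (\<lambda>x. g x $ i))
     \<and> (\<forall>\<phi>\<in>test_fun \<Omega>. \<forall>i.
          (\<integral>x. u x * partial \<phi> i x \<partial>lebesgue_on \<Omega>) = - (\<integral>x. g x $ i * \<phi> x \<partial>lebesgue_on \<Omega>))"

definition W1p :: "(real^'n) set \<Rightarrow> real \<Rightarrow> (real^'n \<Rightarrow> real) \<Rightarrow> (real^'n \<Rightarrow> real^'n) \<Rightarrow> bool" where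
  "W1p \<Omega> p u g \<longleftrightarrow> weak_grad \<Omega> u g \<and> in_Lp \<Omega> p u \<and> in_Lp \<Omega> p (\<lambda>x. norm (g x))"

definition W01p :: "(real^'n) set \<Rightarrow> real \<Rightarrow> (real^'n \<Rightarrow> real) \<Rightarrow> (real^'n \<Rightarrow> real^'n) \<Rightarrow> bool" where
  "W01p \<Omega> p u g \<longleftrightarrow> W1p \<Omega> p u g \<and>
     (\<exists>\<phi>. (\<forall>k. \<phi> k \<in> test_fun \<Omega>)
        \<and> (\<lambda>k. Lp_norm \<Omega> p (\<lambda>x. \<phi> k x - u x)) \<longlonglongrightarrow> 0
        \<and> (\<lambda>k. Lp_norm \<Omega> p (\<lambda>x. norm (grad (\<phi> k) x - g x))) \<longlonglongrightarrow> 0)"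

definition W1_norm :: "(real^'n) set \<Rightarrow> real \<Rightarrow> (real^'n \<Rightarrow> real) \<Rightarrow> (real^'n \<Rightarrow> real^'n) \<Rightarrow> real" where
  "W1_norm \<Omega> p u g = Lp_norm \<Omega> p u + Lp_norm \<Omega> p (\<lambda>x. norm (g x))"

definition in_Hm1 :: "(real^'n) set \<Rightarrow> ((real^'n \<Rightarrow> real) \<Rightarrow> real) \<Rightarrow> bool" where
  "in_Hm1 \<Omega> w \<longleftrightarrow>
     (\<forall>z1 g1 z2 g2 a b. W01p \<Omega> 2 z1 g1 \<and> W01p \<Omega> 2 z2 g2 \<longrightarrow>
         w (\<lambda>x. a * z1 x + b * z2 x) = a * w z1 + b * w z2)
   \<and> (\<exists>C. \<forall>z g. W01p \<Omega> 2 z g \<longrightarrow> \<bar>w z\<bar> \<le> C * W1_norm \<Omega> 2 z g)"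

text \<open>Distributions are functionals on test functions. W^{-1,q}(Omega) is the dual of
  W_0^{1,q'}(Omega), q' = q/(q-1); by density of test functions it is identified with
  linear functionals on test functions bounded in the W^{1,q'} norm.\<close>
definition conj_exp :: "real \<Rightarrow> real" where
  "conj_exp q = q / (q - 1)"

definition in_Wm1q :: "(real^'n) set \<Rightarrow> real \<Rightarrow> ((real^'n \<Rightarrow> real) \<Rightarrow> real) \<Rightarrow> bool" where
  "in_Wm1q \<Omega> q T \<longleftrightarrow>
     (\<forall>\<phi>\<in>test_fun \<Omega>. \<forall>\<psi>\<in>test_fun \<Omega>. \<forall>a b.
         T (\<lambda>x. a * \<phi> x + b * \<psi> x) = a * T \<phi> + b * T \<psi>)
   \<and> (\<exists>C. \<forall>\<phi>\<in>test_fun \<Omega>. \<bar>T \<phi>\<bar> \<le> C * W1_norm \<Omega> (conj_exp q) \<phi> (grad \<phi>))"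

definition Wm1q_norm :: "(real^'n) set \<Rightarrow> real \<Rightarrow> ((real^'n \<Rightarrow> real) \<Rightarrow> real) \<Rightarrow> real" where
  "Wm1q_norm \<Omega> q T =
     (SUP \<phi>\<in>{\<phi>\<in>test_fun \<Omega>. W1_norm \<Omega> (conj_exp q) \<phi> (grad \<phi>) \<le> 1}. \<bar>T \<phi>\<bar>)"

definition div_dist :: "(real^'n) set \<Rightarrow> (real^'n \<Rightarrow> real^'n) \<Rightarrow> (real^'n \<Rightarrow> real) \<Rightarrow> real" where
  "div_dist \<Omega> F \<phi> = - (\<integral>x. F x \<bullet> grad \<phi> x \<partial>lebesgue_on \<Omega>)"

definition strictly_convex_fun :: "('a::real_vector \<Rightarrow> real) \<Rightarrow> bool" where
  "strictly_convex_fun f \<longleftrightarrow>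
     (\<forall>x y t. x \<noteq> y \<and> 0 < t \<and> t < 1 \<longrightarrow> f ((1 - t) *\<^sub>R x + t *\<^sub>R y) < (1 - t) * f x + t * f y)"

end

theory Submission
  imports Defs
begin

text \<open>Write \<open>F = j\<^sub>\<xi>(x,u,\<nabla>u)\<close>, \<open>b = j\<^sub>s(x,u,\<nabla>u)\<close> and let \<open>p = q/(q-1) > N\<close>. Testing the equation with
  \<open>\<vartheta>\<^sub>h(u)\<^sup>2 arctan u\<close> and using the sign condition and Fatou's lemma gives \<open>b \<in> L\<^sup>1\<close>. Testing with \<open>\<vartheta>\<^sub>h(u) \<phi>\<close>
  expresses \<open>div[\<vartheta>\<^sub>h(u) F](\<phi>) - (\<integral> b \<phi> - w(\<phi>))\<close> through \<open>\<vartheta>\<^sub>h'(u) F \<bullet> \<nabla>u\<close>, \<open>(1 - \<vartheta>\<^sub>h(u)) b\<close> and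
  \<open>w((1 - \<vartheta>\<^sub>h(u)) \<phi>)\<close>. Since \<open>p > N\<close>, Morrey's inequality bounds \<open>\<phi>\<close> uniformly by its \<open>W\<^sup>1\<^sup>,\<^sup>p\<close> norm, and
  all three terms tend to 0 uniformly on the unit ball by dominated convergence.\<close>

subsection \<open>Smooth functions and test functions\<close>

text \<open>The obstacle is that \<open>\<alpha>\<close> and \<open>\<beta>\<close> may grow without
  bound: for unbounded \<open>u\<close> the hypotheses do not make F integrable, so div F has no
  direct meaning as a distribution. The limit is therefore defined by the equation, as the
  functional sending \<open>\<phi>\<close> to the integral of b \<open>\<phi>\<close> minus
  w(\<open>\<phi>\<close>), which makes sense once b is in L^1. The supports of the cutoffs may grow
  with h. Every estimate that has to survive the limit thus uses only their common bound and the
  integrability of F . Du, b and |Du|^2, never \<open>\<alpha>\<close> or \<open>\<beta>\<close> at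
  the support radii. The arctangent is bounded with bounded derivative, vanishes at 0, has the sign
  of its argument and stays away from 0 beyond R; the cutoff is squared because it may change sign.
  The function obtained from \<open>\<phi>\<close> by the factor 1 - th_h(u) may live where
  \<open>u\<close> is unbounded, so it is in general no admissible test function. Its image under w
  is estimated in the H_0^1 norm instead. There the factor in front of grad \<open>\<phi>\<close> is
  separated by Hoelder's inequality, which asks for p > 2; this follows from p > N >= 3.\<close>

fun diff_order :: "nat \<Rightarrow> (real^'n \<Rightarrow> real) \<Rightarrow> bool" where
  "diff_order 0 f \<longleftrightarrow> continuous_on UNIV f"
| "diff_order (Suc n) f \<longleftrightarrow> (\<forall>x. f differentiable (at x)) \<and> (\<forall>i. diff_order n (partial f i))"

lemma differentiable_imp_continuous_UNIV:
  "(\<And>x. (f :: real^'n \<Rightarrow> real) differentiable (at x)) \<Longrightarrow> continuous_on UNIV f"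
  by (simp add: continuous_at_imp_continuous_on differentiable_imp_continuous_within)

lemma iter_partial_snoc: "iter_partial f (is @ [i]) = iter_partial (partial f i) is"
  by (induction "is") auto

lemma smooth_partial: "smooth f \<Longrightarrow> smooth (partial f i)"
  unfolding smooth_def by (metis iter_partial_snoc)

lemma smooth_differentiable: "smooth f \<Longrightarrow> f differentiable (at x)"
  unfolding smooth_def by (metis iter_partial.simps(1))

lemma smooth_continuous: "smooth f \<Longrightarrow> continuous_on UNIV f"
  unfolding smooth_def by (metis iter_partial.simps(1))

lemma smooth_imp_diff_order: "smooth f \<Longrightarrow> diff_order n f"
  by (induction n arbitrary: f) (auto simp: smooth_continuous smooth_differentiable smooth_partial)

lemma diff_order_iter_partial:
  "diff_order (length is + n) f \<Longrightarrow> diff_order n (iter_partial f is)"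
proof (induction "is" arbitrary: f rule: rev_induct)
  case (snoc i "is")
  then show ?case by (simp add: iter_partial_snoc)
qed simp

text \<open>\<open>iter_partial\<close> applies the head of its list last, so it unfolds from the
  outside; \<open>diff_order\<close> peels off the derivative next to f. In that form the sum and
  product rules close under induction on the order. Continuity of each iterated derivative comes
  from its differentiability.\<close>

lemma smooth_iff_diff_order: "smooth f \<longleftrightarrow> (\<forall>n. diff_order n f)"
proof
  assume *: "\<forall>n. diff_order n f"
  have "diff_order (Suc 0) (iter_partial f is)" for "is"
    using * by (intro diff_order_iter_partial) auto
  then show "smooth f"
    unfolding smooth_def by (auto intro: differentiable_imp_continuous_UNIV)
qed (simp add: smooth_imp_diff_order)

lemma diff_order_Suc_imp: "diff_order (Suc n) f \<Longrightarrow> diff_order n f"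
  by (induction n arbitrary: f) (auto intro: differentiable_imp_continuous_UNIV)

section \<open>Calculus of partial derivatives: sums, products, powers\<close>

lemma partial_eqI: "(f has_derivative f') (at x) \<Longrightarrow> partial f i x = f' (axis i 1)"
  unfolding partial_def by (simp add: frechet_derivative_at[symmetric])

lemma has_derivative_frechet:
  "f differentiable (at x) \<Longrightarrow> (f has_derivative frechet_derivative f (at x)) (at x)"
  using frechet_derivative_works by blast

lemma partial_const: "partial (\<lambda>_. c) i = (\<lambda>_. 0)"
proof
  fix x :: "real^'a" show "partial (\<lambda>_. c) i x = 0"
    by (rule partial_eqI) (rule has_derivative_const)
qed

lemma partial_add:
  "f differentiable (at x) \<Longrightarrow> g differentiable (at x) \<Longrightarrow>
   partial (\<lambda>x. f x + g x) i x = partial f i x + partial g i x"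
  by (subst partial_eqI[OF has_derivative_add[OF has_derivative_frechet has_derivative_frechet]])
     (auto simp: partial_def)

lemma partial_mult:
  "f differentiable (at x) \<Longrightarrow> g differentiable (at x) \<Longrightarrow>
   partial (\<lambda>x. f x * g x) i x = f x * partial g i x + partial f i x * g x"
  by (subst partial_eqI[OF has_derivative_mult[OF has_derivative_frechet has_derivative_frechet]])
     (auto simp: partial_def)

lemma diff_order_const: "diff_order n (\<lambda>_. c)"
  by (induction n arbitrary: c) (auto simp: partial_const)

lemma diff_order_add:
  "diff_order n f \<Longrightarrow> diff_order n g \<Longrightarrow> diff_order n (\<lambda>x. f x + g x)"
proof (induction n arbitrary: f g)
  case (Suc n)
  then have "partial (\<lambda>x. f x + g x) i = (\<lambda>x. partial f i x + partial g i x)" for i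
    by (auto simp: partial_add)
  with Suc show ?case by (auto intro: differentiable_add)
qed (auto intro: continuous_intros)

lemma diff_order_mult:
  "diff_order n f \<Longrightarrow> diff_order n g \<Longrightarrow> diff_order n (\<lambda>x. f x * g x)"
proof (induction n arbitrary: f g)
  case (Suc n)
  then have "partial (\<lambda>x. f x * g x) i = (\<lambda>x. f x * partial g i x + partial f i x * g x)" for i
    by (auto simp: partial_mult)
  moreover have "diff_order n f" "diff_order n g"
    using Suc.prems diff_order_Suc_imp by blast+
  ultimately show ?case using Suc by (auto intro!: differentiable_mult diff_order_add)
qed (auto intro: continuous_intros)

lemma smooth_const: "smooth (\<lambda>_. c)"
  by (simp add: smooth_iff_diff_order diff_order_const)

lemma smooth_add: "smooth f \<Longrightarrow> smooth g \<Longrightarrow> smooth (\<lambda>x. f x + g x)"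
  by (simp add: smooth_iff_diff_order diff_order_add)

lemma smooth_mult: "smooth f \<Longrightarrow> smooth g \<Longrightarrow> smooth (\<lambda>x. f x * g x)"
  by (simp add: smooth_iff_diff_order diff_order_mult)

lemma smooth_power: "smooth f \<Longrightarrow> smooth (\<lambda>x. f x ^ n)"
  by (induction n) (auto intro: smooth_const smooth_mult)

lemma smooth_sum: "(\<And>i. i \<in> I \<Longrightarrow> smooth (f i)) \<Longrightarrow> smooth (\<lambda>x. \<Sum>i\<in>I. f i x)"
  by (induction I rule: infinite_finite_induct) (auto intro: smooth_const smooth_add)

section \<open>The gradient as representative of the derivative\<close>

lemma has_derivative_grad:
  assumes "smooth f" shows "(f has_derivative (\<lambda>v. grad f x \<bullet> v)) (at x)"
proof -
  let ?D = "frechet_derivative f (at x)"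
  have D: "(f has_derivative ?D) (at x)"
    using assms by (intro has_derivative_frechet smooth_differentiable)
  then interpret bounded_linear ?D by (rule has_derivative_bounded_linear)
  have "?D v = grad f x \<bullet> v" for v
  proof -
    have "?D v = ?D (\<Sum>i\<in>UNIV. (v $ i) *\<^sub>R axis i 1)"
      by (simp add: basis_expansion flip: scalar_mult_eq_scaleR)
    also have "\<dots> = grad f x \<bullet> v"
      by (simp add: sum scaleR inner_vec_def grad_def partial_def mult.commute)
    finally show ?thesis .
  qed
  then have "?D = (\<lambda>v. grad f x \<bullet> v)" by auto
  with D show ?thesis by simp
qed

lemma grad_eqI:
  assumes "(f has_derivative (\<lambda>v. g \<bullet> v)) (at x)" shows "grad f x = g"
  by (simp add: grad_def vec_eq_iff partial_eqI[OF assms] inner_axis)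

lemma grad_const [simp]: "grad (\<lambda>_. c) = (\<lambda>_. 0)"
  by (intro ext grad_eqI) simp

lemma grad_lincomb:
  assumes "smooth f" "smooth g"
  shows "grad (\<lambda>x. a * f x + b * g x) x = a *\<^sub>R grad f x + b *\<^sub>R grad g x"
  by (rule grad_eqI) (auto intro!: derivative_eq_intros has_derivative_grad assms
      simp: inner_add_left)

lemma continuous_on_grad: "smooth f \<Longrightarrow> continuous_on UNIV (grad f)"
  unfolding grad_def by (intro continuous_on_vec_lambda smooth_continuous smooth_partial)

lemma grad_outside_support: "x \<notin> closure {x. f x \<noteq> 0} \<Longrightarrow> grad f x = 0"
proof (rule grad_eqI)
  assume x: "x \<notin> closure {x. f x \<noteq> 0}"
  have "((\<lambda>_. 0::real) has_derivative (\<lambda>v. 0)) (at x)" by simp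
  then have "(f has_derivative (\<lambda>v. 0)) (at x)"
    by (rule has_derivative_transform_within_open[where s="- closure {x. f x \<noteq> 0}"])
       (use x closure_subset[of "{x. f x \<noteq> 0}"] in auto)
  then show "(f has_derivative (\<lambda>v. 0 \<bullet> v)) (at x)" by simp
qed

lemma partial_eq_grad_nth: "partial f i x = grad f x $ i"
  by (simp add: grad_def)

section \<open>Test functions: supports and uniform bounds\<close>

lemma test_funD:
  assumes "\<phi> \<in> test_fun \<Omega>"
  shows "smooth \<phi>" "compact (closure {x. \<phi> x \<noteq> 0})" "closure {x. \<phi> x \<noteq> 0} \<subseteq> \<Omega>"
  using assms by (auto simp: test_fun_def)

lemma test_fun_subset_support:
  assumes "smooth \<psi>" "\<phi> \<in> test_fun \<Omega>" "{x. \<psi> x \<noteq> 0} \<subseteq> {x. \<phi> x \<noteq> 0}"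
  shows "\<psi> \<in> test_fun \<Omega>"
  using test_funD[OF assms(2)] closure_mono[OF assms(3)] assms(1) bounded_subset[OF _ assms(3)]
  by (auto simp: test_fun_def)

lemma zero_test_fun: "(\<lambda>_. 0) \<in> test_fun \<Omega>"
  by (simp add: test_fun_def smooth_const)

lemma test_fun_mult_right: "smooth \<psi> \<Longrightarrow> \<phi> \<in> test_fun \<Omega> \<Longrightarrow> (\<lambda>x. \<psi> x * \<phi> x) \<in> test_fun \<Omega>"
  by (rule test_fun_subset_support) (auto intro: smooth_mult test_funD)

lemma continuous_compact_support_bounded:
  fixes f :: "'a::topological_space \<Rightarrow> 'b::real_normed_vector"
  assumes "continuous_on UNIV f" "compact K" "\<And>x. x \<notin> K \<Longrightarrow> f x = 0"
  obtains B where "B > 0" "\<And>x. norm (f x) \<le> B"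
proof -
  have "compact (f ` K)"
    using assms by (meson compact_continuous_image continuous_on_subset subset_UNIV)
  then obtain B where B: "B > 0" "\<forall>y\<in>f ` K. norm y \<le> B"
    using compact_imp_bounded bounded_pos by metis
  have "norm (f x) \<le> B" for x
    using B assms(3)[of x] by (cases "x \<in> K") auto
  with B show ?thesis by (intro that[of B])
qed

lemma test_fun_vanishes: "\<phi> \<in> test_fun \<Omega> \<Longrightarrow> x \<notin> \<Omega> \<Longrightarrow> \<phi> x = 0 \<and> grad \<phi> x = 0"
  using grad_outside_support[of x \<phi>] test_funD(3)[of \<phi> \<Omega>] closure_subset[of "{x. \<phi> x \<noteq> 0}"] by auto

lemma test_fun_bounded:
  assumes "\<phi> \<in> test_fun \<Omega>"
  obtains B where "B > 0" "\<And>x. \<bar>\<phi> x\<bar> \<le> B" "\<And>x. norm (grad \<phi> x) \<le> B"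
proof -
  note D = test_funD[OF assms]
  obtain B1 where B1: "B1 > 0" "\<And>x. norm (\<phi> x) \<le> B1"
    using continuous_compact_support_bounded[OF smooth_continuous[OF D(1)] D(2)]
      closure_subset[of "{x. \<phi> x \<noteq> 0}"] by blast
  obtain B2 where B2: "B2 > 0" "\<And>x. norm (grad \<phi> x) \<le> B2"
    using continuous_compact_support_bounded[OF continuous_on_grad[OF D(1)] D(2)]
      grad_outside_support by blast
  show ?thesis
  proof (rule that[of "max B1 B2"])
    show "\<bar>\<phi> x\<bar> \<le> max B1 B2" for x using B1(2)[of x] by simp
    show "norm (grad \<phi> x) \<le> max B1 B2" for x using B2(2)[of x] by simp
  qed (use B1 in simp)
qed

subsection \<open>Integral inequalities\<close>

text \<open>Young's inequality yields integrability of the product; applied to f / a and g / b,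
  where a and b are the two norms, it yields the bound. If a norm vanishes, the product is zero
  almost everywhere.\<close>

lemma Holder_inequality:
  fixes f g :: "'a \<Rightarrow> real"
  assumes pq: "p > 1" "q > 1" "1/p + 1/q = 1"
    and [measurable]: "f \<in> borel_measurable M" "g \<in> borel_measurable M"
    and f: "integrable M (\<lambda>x. \<bar>f x\<bar> powr p)" and g: "integrable M (\<lambda>x. \<bar>g x\<bar> powr q)"
  shows "integrable M (\<lambda>x. f x * g x)"
    and "(\<integral>x. \<bar>f x * g x\<bar> \<partial>M) \<le> (\<integral>x. \<bar>f x\<bar> powr p \<partial>M) powr (1/p) * (\<integral>x. \<bar>g x\<bar> powr q \<partial>M) powr (1/q)"
proof -
  have young: "\<bar>f x * g x\<bar> \<le> \<bar>f x\<bar> powr p / p + \<bar>g x\<bar> powr q / q" for x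
    using Youngs_inequality[OF pq, of "\<bar>f x\<bar>" "\<bar>g x\<bar>"] by (simp add: abs_mult)
  have "integrable M (\<lambda>x. \<bar>f x\<bar> powr p / p + \<bar>g x\<bar> powr q / q)"
    using f g by simp
  then show fg: "integrable M (\<lambda>x. f x * g x)"
    by (rule Bochner_Integration.integrable_bound) (use young in \<open>auto intro!: AE_I2 order_trans[OF _ abs_ge_self]\<close>)
  define A where "A = (\<integral>x. \<bar>f x\<bar> powr p \<partial>M)"
  define B where "B = (\<integral>x. \<bar>g x\<bar> powr q \<partial>M)"
  have AB: "A \<ge> 0" "B \<ge> 0" by (auto simp: A_def B_def)
  show "(\<integral>x. \<bar>f x * g x\<bar> \<partial>M) \<le> A powr (1/p) * B powr (1/q)"
  proof (cases "A = 0 \<or> B = 0")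
    case True
    then have "AE x in M. f x = 0 \<or> g x = 0"
    proof
      assume "A = 0"
      then have "AE x in M. \<bar>f x\<bar> powr p = 0"
        using integral_nonneg_eq_0_iff_AE[OF f] by (auto simp: A_def)
      then show ?thesis by eventually_elim simp
    next
      assume "B = 0"
      then have "AE x in M. \<bar>g x\<bar> powr q = 0"
        using integral_nonneg_eq_0_iff_AE[OF g] by (auto simp: B_def)
      then show ?thesis by eventually_elim simp
    qed
    then have "AE x in M. \<bar>f x * g x\<bar> = 0" by eventually_elim auto
    then have "(\<integral>x. \<bar>f x * g x\<bar> \<partial>M) = 0" by (rule integral_eq_zero_AE)
    then show ?thesis by simp
  next
    case False
    define a where "a = A powr (1/p)"
    define b where "b = B powr (1/q)"
    have ab: "a > 0" "b > 0" "a powr p = A" "b powr q = B"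
      using False AB pq by (auto simp: a_def b_def powr_powr)
    have "(\<integral>x. \<bar>f x * g x\<bar> / (a * b) \<partial>M) \<le> (\<integral>x. \<bar>f x\<bar> powr p / (A * p) + \<bar>g x\<bar> powr q / (B * q) \<partial>M)"
    proof (rule integral_mono)
      fix x
      show "\<bar>f x * g x\<bar> / (a * b) \<le> \<bar>f x\<bar> powr p / (A * p) + \<bar>g x\<bar> powr q / (B * q)"
        using Youngs_inequality[OF pq, of "\<bar>f x\<bar> / a" "\<bar>g x\<bar> / b"] ab
        by (simp add: abs_mult powr_divide)
    qed (use f g fg in auto)
    also have "\<dots> = 1"
      using f g False pq by (simp flip: A_def B_def)
    finally show ?thesis using ab by (simp add: a_def b_def)
  qed
qed

lemma Cauchy_Schwarz_integral:
  fixes f g :: "'a \<Rightarrow> real"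
  assumes "f \<in> borel_measurable M" "g \<in> borel_measurable M"
    and "integrable M (\<lambda>x. (f x)\<^sup>2)" "integrable M (\<lambda>x. (g x)\<^sup>2)"
  shows "integrable M (\<lambda>x. f x * g x)"
    and "(\<integral>x. \<bar>f x * g x\<bar> \<partial>M) \<le> sqrt (\<integral>x. (f x)\<^sup>2 \<partial>M) * sqrt (\<integral>x. (g x)\<^sup>2 \<partial>M)"
  using Holder_inequality[of 2 2 f M g] assms by (auto simp: powr_half_sqrt)

lemma Lp_norm_2: "Lp_norm \<Omega> 2 f = sqrt (\<integral>x. (f x)\<^sup>2 \<partial>lebesgue_on \<Omega>)"
  by (simp add: Lp_norm_def powr_half_sqrt)

lemma Lp_norm_nonneg: "Lp_norm \<Omega> p f \<ge> 0"
  by (simp add: Lp_norm_def)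

lemma finite_measure_lebesgue_on_bounded:
  assumes "open \<Omega>" "bounded (\<Omega> :: (real^'n) set)"
  shows "finite_measure (lebesgue_on \<Omega>)"
  using assms lmeasurable_open by (intro finite_measure_lebesgue_on) blast

lemma integrable_of_square:
  fixes f :: "'a \<Rightarrow> real"
  assumes "finite_measure M" "f \<in> borel_measurable M" "integrable M (\<lambda>x. (f x)\<^sup>2)"
  shows "integrable M f"
  using Cauchy_Schwarz_integral(1)[of f M "\<lambda>_. 1"] assms
  by (simp add: finite_measure.integrable_const)

lemma integrable_mult_bounded:
  fixes f g :: "'a \<Rightarrow> real"
  assumes "integrable M f" "g \<in> borel_measurable M" "\<And>x. \<bar>g x\<bar> \<le> B"
  shows "integrable M (\<lambda>x. f x * g x)"
proof (rule Bochner_Integration.integrable_bound[where f="\<lambda>x. B * f x"])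
  show "AE x in M. norm (f x * g x) \<le> norm (B * f x)"
  proof (rule AE_I2)
    fix x
    have "\<bar>g x\<bar> \<le> \<bar>B\<bar>" using assms(3)[of x] by linarith
    then show "norm (f x * g x) \<le> norm (B * f x)"
      by (simp add: abs_mult mult.commute[of "\<bar>B\<bar>"] mult_left_mono)
  qed
qed (use assms in auto)

text \<open>Cauchy-Schwarz, since a bounded g is square integrable on a finite measure space. It
  passes to the limit in the identity that defines weak gradients.\<close>

lemma integral_square_tendsto_imp:
  fixes f :: "nat \<Rightarrow> 'a \<Rightarrow> real"
  assumes M: "finite_measure M"
    and f: "\<And>n. f n \<in> borel_measurable M" "\<And>n. integrable M (\<lambda>x. (f n x)\<^sup>2)"
    and lim: "(\<lambda>n. \<integral>x. (f n x)\<^sup>2 \<partial>M) \<longlonglongrightarrow> 0"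
    and g: "g \<in> borel_measurable M" "\<And>x. \<bar>g x\<bar> \<le> B"
  shows "(\<lambda>n. \<integral>x. f n x * g x \<partial>M) \<longlonglongrightarrow> 0"
proof (rule Lim_null_comparison)
  have "\<bar>g x\<bar>\<^sup>2 \<le> B\<^sup>2" for x using g(2)[of x] by (intro power_mono) auto
  then have g2: "integrable M (\<lambda>x. (g x)\<^sup>2)"
    using g by (intro finite_measure.integrable_const_bound[OF M, where B="B\<^sup>2"]) auto
  show "\<forall>\<^sub>F n in sequentially. norm (\<integral>x. f n x * g x \<partial>M)
      \<le> sqrt (\<integral>x. (f n x)\<^sup>2 \<partial>M) * sqrt (\<integral>x. (g x)\<^sup>2 \<partial>M)"
    using Cauchy_Schwarz_integral(2)[OF f(1) g(1) f(2) g2]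
      by (intro always_eventually allI order_trans[OF integral_norm_bound]) simp
  have "(\<lambda>n. sqrt (\<integral>x. (f n x)\<^sup>2 \<partial>M) * sqrt (\<integral>x. (g x)\<^sup>2 \<partial>M)) \<longlonglongrightarrow> sqrt 0 * sqrt (\<integral>x. (g x)\<^sup>2 \<partial>M)"
    by (intro tendsto_intros lim)
  then show "(\<lambda>n. sqrt (\<integral>x. (f n x)\<^sup>2 \<partial>M) * sqrt (\<integral>x. (g x)\<^sup>2 \<partial>M)) \<longlonglongrightarrow> 0" by simp
qed

subsection \<open>Integration by parts for test functions\<close>

lemma continuous_lebesgue_on_measurable:
  fixes f :: "real^'n \<Rightarrow> 'b::{second_countable_topology, real_normed_vector}"
  assumes "open \<Omega>" "continuous_on UNIV f"
  shows "f \<in> borel_measurable (lebesgue_on \<Omega>)"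
  using assms by (intro continuous_imp_measurable_on_sets_lebesgue) (auto intro: continuous_on_subset)

text \<open>Moves integrals of functions that vanish outside \<open>\<Omega>\<close> to the whole
  space, where translations and dilations act.\<close>

lemma integral_lebesgue_on_eq_lborel:
  fixes f :: "real^'n \<Rightarrow> real"
  assumes "open \<Omega>" "continuous_on UNIV f" "\<And>x. x \<notin> \<Omega> \<Longrightarrow> f x = 0"
  shows "integral\<^sup>L (lebesgue_on \<Omega>) f = integral\<^sup>L lborel f"
proof -
  have "(\<lambda>x. indicator \<Omega> x *\<^sub>R f x) = f" using assms(3) by (intro ext) (auto simp: indicator_def)
  then have "integral\<^sup>L (lebesgue_on \<Omega>) f = integral\<^sup>L lebesgue f"
    using assms(1) by (simp add: integral_restrict_space)
  also have "\<dots> = integral\<^sup>L lborel f"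
    using assms(2) by (intro integral_completion) (auto intro: borel_measurable_continuous_onI)
  finally show ?thesis .
qed

lemma integrable_lborel_bounded_support:
  fixes f :: "real^'n \<Rightarrow> real"
  assumes "continuous_on UNIV f" "\<And>x. \<bar>f x\<bar> \<le> B" "\<And>x. norm x > r \<Longrightarrow> f x = 0"
  shows "integrable lborel f"
proof (rule Bochner_Integration.integrable_bound[where f="\<lambda>x. B * indicator (cball 0 r) x"])
  show "integrable lborel (\<lambda>x::real^'n. B * indicator (cball 0 r) x)"
    using emeasure_lborel_cball_finite[of "0::real^'n" r] by (intro integrable_mult_right integrable_real_indicator) auto
  show "AE x in lborel. norm (f x) \<le> norm (B * indicator (cball 0 r) x)"
    using assms(2,3) by (intro AE_I2) (force simp: indicator_def not_le intro: order_trans)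
qed (use assms in \<open>auto intro: borel_measurable_continuous_onI\<close>)

text \<open>The difference quotients have integral 0 by translation invariance.\<close>
lemma integral_partial_eq_0:
  assumes "\<phi> \<in> test_fun \<Omega>"
  shows "integral\<^sup>L lborel (partial \<phi> i) = 0"
proof -
  note D = test_funD[OF assms]
  define e :: "real^'a" where "e = axis i 1"
  have e: "norm e = 1" by (simp add: e_def)
  obtain B where B: "B > 0" "\<And>x. \<bar>\<phi> x\<bar> \<le> B" "\<And>x. norm (grad \<phi> x) \<le> B"
    using test_fun_bounded[OF assms] by metis
  obtain r where r: "\<And>x. x \<in> closure {x. \<phi> x \<noteq> 0} \<Longrightarrow> norm x \<le> r"
    using compact_imp_bounded[OF D(2)] by (auto simp: bounded_iff)
  have van: "\<phi> x = 0" if "norm x > r" for x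
    using r[of x] that closure_subset[of "{x. \<phi> x \<noteq> 0}"] by force
  have cont: "continuous_on UNIV \<phi>" using D by (intro smooth_continuous)
  have [measurable]: "\<phi> \<in> borel_measurable borel"
    by (rule borel_measurable_continuous_onI[OF cont])
  have [measurable]: "partial \<phi> i \<in> borel_measurable borel"
    using D by (intro borel_measurable_continuous_onI smooth_continuous smooth_partial)
  have int: "integrable lborel \<phi>"
    by (rule integrable_lborel_bounded_support[OF cont B(2) van])
  define g where "g n x = real (Suc n) * (\<phi> (x + (1 / real (Suc n)) *\<^sub>R e) - \<phi> x)" for n x
  have shift: "integrable lborel (\<lambda>x. \<phi> (x + c)) \<and> (\<integral>x. \<phi> (x + c) \<partial>lborel) = integral\<^sup>L lborel \<phi>" for c
    using integrable_distr_eq[of "(+) c" lborel borel \<phi>] integral_distr[of "(+) c" lborel borel \<phi>] int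
    by (simp add: lborel_distr_plus add.commute)
  have g0: "integral\<^sup>L lborel (g n) = 0" for n
    unfolding g_def using shift int by simp
  \<comment> \<open>The gradient bound makes \<open>\<phi>\<close> Lipschitz with constant B, so B
    dominates every difference quotient.\<close>
  have lip: "\<bar>\<phi> y - \<phi> x\<bar> \<le> B * norm (y - x)" for x y
  proof -
    have "norm (\<phi> y - \<phi> x) \<le> B * norm (y - x)"
    proof (rule differentiable_bound[of UNIV \<phi> "\<lambda>x v. grad \<phi> x \<bullet> v"])
      show "onorm (\<lambda>v. grad \<phi> x \<bullet> v) \<le> B" for x
      proof (rule onorm_le)
        fix v show "norm (grad \<phi> x \<bullet> v) \<le> B * norm v"
          using Cauchy_Schwarz_ineq2[of "grad \<phi> x" v] B(3)[of x]
          by (metis mult_right_mono norm_ge_zero order_trans real_norm_def)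
      qed
    qed (use has_derivative_grad[OF D(1)] in auto)
    then show ?thesis by simp
  qed
  have "(\<lambda>n. integral\<^sup>L lborel (g n)) \<longlonglongrightarrow> integral\<^sup>L lborel (partial \<phi> i)"
  proof (rule integral_dominated_convergence)
    \<comment> \<open>The shifts have length at most 1, so beyond radius r + 1 both points of a
      difference quotient miss the support.\<close>
    show "integrable lborel (\<lambda>x::real^'a. B * indicator (cball 0 (r + 1)) x)"
      using emeasure_lborel_cball_finite[of "0::real^'a" "r + 1"] by (intro integrable_mult_right integrable_real_indicator) auto
    show "AE x in lborel. norm (g n x) \<le> B * indicator (cball 0 (r + 1)) x" for n
    proof (rule AE_I2)
      fix x
      show "norm (g n x) \<le> B * indicator (cball 0 (r + 1)) x"
      proof (cases "norm x > r + 1")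
        case True
        have "norm ((1 / real (Suc n)) *\<^sub>R e) \<le> 1" using e by simp
        then have "norm (x + (1 / real (Suc n)) *\<^sub>R e) > r"
          using True norm_diff_ineq[of x "(1 / real (Suc n)) *\<^sub>R e"] by linarith
        then show ?thesis using van[of x] van True B by (simp add: g_def)
      next
        case False
        have "\<bar>\<phi> (x + (1 / real (Suc n)) *\<^sub>R e) - \<phi> x\<bar> \<le> B * (1 / real (Suc n))"
          using lip[of "x + (1 / real (Suc n)) *\<^sub>R e" x] e by simp
        then have "real (Suc n) * \<bar>\<phi> (x + (1 / real (Suc n)) *\<^sub>R e) - \<phi> x\<bar> \<le> real (Suc n) * (B * (1 / real (Suc n)))"
          by (rule mult_left_mono) simp
        then have "\<bar>g n x\<bar> \<le> B"
          unfolding g_def abs_mult by simp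
        then show ?thesis using False by (simp add: indicator_def)
      qed
    qed
    show "AE x in lborel. (\<lambda>n. g n x) \<longlonglongrightarrow> partial \<phi> i x"
    proof (rule AE_I2)
      fix x
      have "((\<lambda>t. \<phi> (x + t *\<^sub>R e)) has_derivative (\<lambda>t. grad \<phi> x \<bullet> (t *\<^sub>R e))) (at 0)"
        by (rule has_derivative_compose[where f="\<lambda>t. x + t *\<^sub>R e" and g=\<phi>, of "\<lambda>t. t *\<^sub>R e"])
           (auto intro!: derivative_eq_intros has_derivative_grad D)
      then have "((\<lambda>t. \<phi> (x + t *\<^sub>R e)) has_real_derivative partial \<phi> i x) (at 0)"
        by (simp add: has_field_derivative_def e_def inner_axis partial_eq_grad_nth mult_commute_abs)
      then have "((\<lambda>t. (\<phi> (x + t *\<^sub>R e) - \<phi> x) / t) \<longlongrightarrow> partial \<phi> i x) (at 0)"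
        by (simp add: has_field_derivative_iff)
      moreover have "filterlim (\<lambda>n. 1 / real (Suc n)) (at 0) sequentially"
        using LIMSEQ_Suc[OF lim_1_over_n[where 'a=real]] by (auto simp: filterlim_at)
      ultimately have "(\<lambda>n. (\<phi> (x + (1 / real (Suc n)) *\<^sub>R e) - \<phi> x) / (1 / real (Suc n))) \<longlonglongrightarrow> partial \<phi> i x"
        by (rule filterlim_compose)
      then show "(\<lambda>n. g n x) \<longlonglongrightarrow> partial \<phi> i x"
        by (simp add: g_def mult.commute)
    qed
  next
    show "g n \<in> borel_measurable lborel" for n unfolding g_def[abs_def] by measurable
  qed auto
  then show ?thesis using g0 by (simp add: LIMSEQ_const_iff)
qed

text \<open>The product \<open>v x * \<phi> x\<close> is again a test function, so its partial
  derivative has integral 0; the product rule splits that integral into the two sides.\<close>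

lemma test_fun_integration_by_parts:
  fixes \<Omega> :: "(real^'n) set"
  assumes "open \<Omega>" "bounded \<Omega>" and v: "v \<in> test_fun \<Omega>" and \<phi>: "\<phi> \<in> test_fun \<Omega>"
  shows "(\<integral>x. v x * partial \<phi> i x \<partial>lebesgue_on \<Omega>) = - (\<integral>x. grad v x $ i * \<phi> x \<partial>lebesgue_on \<Omega>)"
proof -
  interpret finite_measure "lebesgue_on \<Omega>"
    using assms by (intro finite_measure_lebesgue_on_bounded)
  note Dv = test_funD[OF v] and D\<phi> = test_funD[OF \<phi>]
  have "(\<lambda>x. v x * \<phi> x) \<in> test_fun \<Omega>"
    using Dv \<phi> by (intro test_fun_mult_right)
  note T = this
  have eq: "partial (\<lambda>x. v x * \<phi> x) i = (\<lambda>x. v x * partial \<phi> i x + grad v x $ i * \<phi> x)"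
    using Dv D\<phi> by (intro ext) (simp add: partial_mult smooth_differentiable partial_eq_grad_nth[symmetric])
  have c: "continuous_on UNIV (\<lambda>x. v x * partial \<phi> i x)" "continuous_on UNIV (\<lambda>x. grad v x $ i * \<phi> x)"
    by (intro continuous_intros smooth_continuous[OF Dv(1)] smooth_continuous[OF D\<phi>(1)]
        smooth_continuous[OF smooth_partial[OF D\<phi>(1)]] continuous_on_grad[OF Dv(1)])+
  obtain B where B: "B > 0" "\<And>x. \<bar>v x\<bar> \<le> B" "\<And>x. norm (grad v x) \<le> B"
    using test_fun_bounded[OF v] by metis
  obtain C where C: "C > 0" "\<And>x. \<bar>\<phi> x\<bar> \<le> C" "\<And>x. norm (grad \<phi> x) \<le> C"
    using test_fun_bounded[OF \<phi>] by metis
  have i1: "integrable (lebesgue_on \<Omega>) (\<lambda>x. v x * partial \<phi> i x)"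
    using B C continuous_lebesgue_on_measurable[OF assms(1) c(1)]
    by (intro integrable_const_bound[where B="B * C"] AE_I2)
       (auto simp: abs_mult partial_eq_grad_nth intro!: mult_mono order_trans[OF component_le_norm_cart])
  have i2: "integrable (lebesgue_on \<Omega>) (\<lambda>x. grad v x $ i * \<phi> x)"
    using B C continuous_lebesgue_on_measurable[OF assms(1) c(2)]
    by (intro integrable_const_bound[where B="B * C"] AE_I2)
       (auto simp: abs_mult intro!: mult_mono order_trans[OF component_le_norm_cart])
  have "(\<integral>x. v x * partial \<phi> i x + grad v x $ i * \<phi> x \<partial>lebesgue_on \<Omega>)
      = (\<integral>x. v x * partial \<phi> i x + grad v x $ i * \<phi> x \<partial>lborel)"
    using assms(1) c test_fun_vanishes[OF v] test_fun_vanishes[OF \<phi>]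
    by (intro integral_lebesgue_on_eq_lborel continuous_on_add) auto
  also have "\<dots> = 0" using integral_partial_eq_0[OF T, of i] eq by simp
  finally show ?thesis using i1 i2 by simp
qed

subsection \<open>Morrey's inequality for test functions\<close>

lemma nn_integral_lborel_affine:
  fixes f :: "real^'n \<Rightarrow> ennreal"
  assumes "t \<noteq> 0" and [measurable]: "f \<in> borel_measurable borel"
  shows "(\<integral>\<^sup>+x. f x \<partial>lborel) = ennreal (\<bar>t\<bar> ^ CARD('n)) * (\<integral>\<^sup>+x. f (a + t *\<^sub>R x) \<partial>lborel)"
  by (subst lborel_affine[OF assms(1), of a])
     (simp add: nn_integral_density nn_integral_distr nn_integral_cmult ennreal_power)

text \<open>E is an antiderivative of the bound with E 0 = 0, and both E + A and E - A have
  nonnegative derivative on the open interval. The singularity at 0 is harmless because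
  \<open>\<gamma> < 1\<close> keeps E continuous there.\<close>

lemma deriv_bound_powr:
  fixes A A' :: "real \<Rightarrow> real"
  assumes \<gamma>: "\<gamma> < 1" and cont: "continuous_on {0..1} A"
    and deriv: "\<And>t. 0 < t \<Longrightarrow> t < 1 \<Longrightarrow> (A has_real_derivative A' t) (at t)"
    and bound: "\<And>t. 0 < t \<Longrightarrow> t < 1 \<Longrightarrow> \<bar>A' t\<bar> \<le> C * t powr (- \<gamma>)"
  shows "\<bar>A 1 - A 0\<bar> \<le> C / (1 - \<gamma>)"
proof -
  define E where "E t = C / (1 - \<gamma>) * t powr (1 - \<gamma>)" for t :: real
  have contE: "continuous_on {0..1} E"
    unfolding E_def using \<gamma> by (intro continuous_intros continuous_on_powr') auto
  have dE: "(E has_real_derivative C * t powr (- \<gamma>)) (at t)" if "0 < t" for t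
  proof -
    have "((\<lambda>t. t powr (1 - \<gamma>)) has_real_derivative (1 - \<gamma>) * t powr (1 - \<gamma> - 1)) (at t)"
      using that by (rule has_real_derivative_powr)
    from DERIV_cmult[OF this, of "C / (1 - \<gamma>)"] show ?thesis
      using \<gamma> by (simp add: E_def[abs_def])
  qed
  have "E 0 + A 0 \<le> E 1 + A 1"
  proof (rule DERIV_nonneg_imp_increasing_open[where f="\<lambda>t. E t + A t"])
    fix t :: real assume t: "0 < t" "t < 1"
    have "((\<lambda>t. E t + A t) has_real_derivative C * t powr (- \<gamma>) + A' t) (at t)"
      using t by (intro DERIV_add dE deriv)
    then show "\<exists>y. ((\<lambda>t. E t + A t) has_real_derivative y) (at t) \<and> 0 \<le> y"
      using bound[OF t] by (intro exI conjI) auto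
  qed (use cont contE in \<open>auto intro: continuous_on_add\<close>)
  moreover have "E 0 - A 0 \<le> E 1 - A 1"
  proof (rule DERIV_nonneg_imp_increasing_open[where f="\<lambda>t. E t - A t"])
    fix t :: real assume t: "0 < t" "t < 1"
    have "((\<lambda>t. E t - A t) has_real_derivative C * t powr (- \<gamma>) - A' t) (at t)"
      using t by (intro DERIV_diff dE deriv)
    then show "\<exists>y. ((\<lambda>t. E t - A t) has_real_derivative y) (at t) \<and> 0 \<le> y"
      using bound[OF t] by (intro exI conjI) auto
  qed (use cont contE in \<open>auto intro: continuous_on_diff\<close>)
  ultimately show ?thesis by (simp add: E_def)
qed

text \<open>Hoelder's inequality against the indicator of the unit cube, whose volume 1 leaves no
  constant. The p-th power enters as a nonnegative integral, the form in which a change of variables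
  delivers it; its finiteness gives integrability.\<close>

lemma integral_unit_box_le:
  fixes f :: "real^'n \<Rightarrow> real"
  assumes p: "p > 1" and f: "continuous_on UNIV f"
    and b: "\<And>x. \<bar>f x\<bar> \<le> B"
    and K: "(\<integral>\<^sup>+x. ennreal (\<bar>f x\<bar> powr p) \<partial>lborel) \<le> ennreal K" "K \<ge> 0"
  shows "(\<integral>x. indicator (cbox 0 One) x * \<bar>f x\<bar> \<partial>lborel) \<le> K powr (1 / p)"
proof -
  define q where "q = p / (p - 1)"
  have q: "q > 1" "1/p + 1/q = 1" using p by (auto simp: q_def field_simps)
  have [measurable]: "f \<in> borel_measurable borel" using f by (rule borel_measurable_continuous_onI)
  have fp: "integrable lborel (\<lambda>x. \<bar>\<bar>f x\<bar>\<bar> powr p)"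
    using K by (intro integrableI_bounded) (auto simp: le_less_trans[OF _ ennreal_less_top])
  have "indicator (cbox 0 One) x powr q = (indicator (cbox 0 One) x :: real)" for x :: "real^'n"
    by (auto simp: indicator_def)
  then have ind: "(\<lambda>x::real^'n. \<bar>indicator (cbox 0 One) x\<bar> powr q) = indicat_real (cbox 0 One)"
    by auto
  have "emeasure lborel (cbox (0::real^'n) One) = 1"
    by (subst emeasure_lborel_cbox) auto
  then have ii: "integrable lborel (indicat_real (cbox (0::real^'n) One))"
      "integral\<^sup>L lborel (indicat_real (cbox (0::real^'n) One)) = 1"
    by (auto simp: measure_def)
  have "(\<integral>x. \<bar>indicator (cbox 0 One) x * \<bar>f x\<bar>\<bar> \<partial>lborel)
     \<le> (\<integral>x. \<bar>indicat_real (cbox (0::real^'n) One) x\<bar> powr q \<partial>lborel) powr (1/q) * (\<integral>x. \<bar>\<bar>f x\<bar>\<bar> powr p \<partial>lborel) powr (1/p)"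
    by (rule Holder_inequality) (use p q fp ind ii in auto)
  also have "\<dots> = (\<integral>x. \<bar>f x\<bar> powr p \<partial>lborel) powr (1/p)"
    unfolding ind ii by simp
  also have "\<dots> \<le> K powr (1 / p)"
  proof (rule powr_mono2)
    have "ennreal (\<integral>x. \<bar>f x\<bar> powr p \<partial>lborel) \<le> ennreal K"
      using K fp by (subst nn_integral_eq_integral[symmetric]) auto
    then show "(\<integral>x. \<bar>f x\<bar> powr p \<partial>lborel) \<le> K" using K(2) by simp
  qed (use p in auto)
  finally show ?thesis by (simp add: abs_mult)
qed

text \<open>\<open>A(t) = \<integral>\<^sub>Q \<phi>(x + t z) dz\<close> over the unit cube \<open>Q\<close> joins \<open>\<phi>(x)\<close> to a mean value of \<open>\<phi>\<close>; by Hoelder's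
  inequality and scaling \<open>|A'(t)|\<close> is at most a multiple of \<open>t\<^sup>-\<^sup>N\<^sup>/\<^sup>p\<close>, which is integrable on \<open>(0,1)\<close> since \<open>p > N\<close>.\<close>
theorem Morrey_test_fun:
  fixes \<Omega> :: "(real^'n) set"
  assumes \<Omega>: "open \<Omega>" and p: "p > real CARD('n)"
  obtains C where "C > 0" "\<And>\<phi> x. \<phi> \<in> test_fun \<Omega> \<Longrightarrow> \<bar>\<phi> x\<bar> \<le> C * W1_norm \<Omega> p \<phi> (grad \<phi>)"
proof -
  define \<gamma> where "\<gamma> = real CARD('n) / p"
  \<comment> \<open>The dimension bounds the norm of a point z of the unit cube through the l^1
    norm; z enters as the direction of differentiation in \<open>A'\<close>.\<close>
  define D where "D = real CARD('n)"
  have D1: "D \<ge> 1" by (simp add: D_def Suc_leI)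
  have p1: "p > 1" using p D1 unfolding D_def by linarith
  have \<gamma>: "\<gamma> < 1" using p p1 by (simp add: \<gamma>_def)
  have main: "\<bar>\<phi> x\<bar> \<le> Lp_norm \<Omega> p \<phi> + D * Lp_norm \<Omega> p (\<lambda>x. norm (grad \<phi> x)) / (1 - \<gamma>)"
    if \<phi>: "\<phi> \<in> test_fun \<Omega>" for \<phi> x
  proof -
    note T = test_funD[OF \<phi>]
    have cont: "continuous_on UNIV \<phi>" "continuous_on UNIV (grad \<phi>)"
      using T by (auto intro: smooth_continuous continuous_on_grad)
    have [measurable]: "\<phi> \<in> borel_measurable borel" "grad \<phi> \<in> borel_measurable borel"
      using cont by (auto intro: borel_measurable_continuous_onI)
    obtain B where B: "B > 0" "\<And>x. \<bar>\<phi> x\<bar> \<le> B" "\<And>x. norm (grad \<phi> x) \<le> B"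
      using test_fun_bounded[OF \<phi>] by metis
    obtain r where r: "\<And>x. x \<in> closure {x. \<phi> x \<noteq> 0} \<Longrightarrow> norm x \<le> r"
      using compact_imp_bounded[OF T(2)] by (auto simp: bounded_iff)
    have van: "\<phi> x = 0" "grad \<phi> x = 0" if "norm x > r" for x
      using r[of x] that closure_subset[of "{x. \<phi> x \<noteq> 0}"] grad_outside_support[of x \<phi>] by force+
    have pb: "\<bar>a\<bar> powr p \<le> B powr p" if "\<bar>a\<bar> \<le> B" for a
      using that p1 by (intro powr_mono2) auto
    define I0 where "I0 = (\<integral>x. \<bar>\<phi> x\<bar> powr p \<partial>lborel)"
    define I1 where "I1 = (\<integral>x. norm (grad \<phi> x) powr p \<partial>lborel)"
    have c0: "continuous_on UNIV (\<lambda>x. \<bar>\<phi> x\<bar> powr p)" and c1: "continuous_on UNIV (\<lambda>x. norm (grad \<phi> x) powr p)"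
      using p1 cont by (auto intro!: continuous_intros continuous_on_powr')
    have L0: "Lp_norm \<Omega> p \<phi> = I0 powr (1/p)"
      unfolding Lp_norm_def I0_def using test_fun_vanishes[OF \<phi>] c0 \<Omega>
      by (subst integral_lebesgue_on_eq_lborel) auto
    have L1: "Lp_norm \<Omega> p (\<lambda>x. norm (grad \<phi> x)) = I1 powr (1/p)"
      unfolding Lp_norm_def I1_def using test_fun_vanishes[OF \<phi>] c1 \<Omega>
      by (subst integral_lebesgue_on_eq_lborel) auto
    have i0: "integrable lborel (\<lambda>x. \<bar>\<phi> x\<bar> powr p)"
      by (rule integrable_lborel_bounded_support[OF c0, of "B powr p" r]) (use B pb van in auto)
    have i1: "integrable lborel (\<lambda>x. norm (grad \<phi> x) powr p)"
      by (rule integrable_lborel_bounded_support[OF c1, of "B powr p" r])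
         (use B pb[of "norm (grad \<phi> _)"] van in auto)
    have n0: "(\<integral>\<^sup>+x. ennreal (\<bar>\<phi> x\<bar> powr p) \<partial>lborel) = ennreal I0"
      unfolding I0_def using i0 by (intro nn_integral_eq_integral) auto
    have n1: "(\<integral>\<^sup>+x. ennreal (norm (grad \<phi> x) powr p) \<partial>lborel) = ennreal I1"
      unfolding I1_def using i1 by (intro nn_integral_eq_integral) auto
    have I: "I0 \<ge> 0" "I1 \<ge> 0" by (auto simp: I0_def I1_def)
    let ?Q = "cbox (0::real^'n) One"
    have Q: "emeasure lborel ?Q = 1" by (subst emeasure_lborel_cbox) auto
    \<comment> \<open>\<open>A\<close> and \<open>A'\<close> are gauge integrals, to which the
      Leibniz rule is applied; this identity carries them to Lebesgue integrals for Hoelder's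
      inequality and scaling.\<close>
    have set_int: "integral ?Q f = (\<integral>z. indicator ?Q z * f z \<partial>lborel)"
      if "continuous_on UNIV f" for f :: "real^'n \<Rightarrow> real"
    proof -
      have "set_integrable lborel ?Q f"
        unfolding set_integrable_def
        by (intro borel_integrable_compact continuous_on_subset[OF that]) auto
      then show ?thesis
        using set_borel_integral_eq_integral(2)[of ?Q f] by (simp add: set_lebesgue_integral_def)
    qed
    define A where "A t = integral ?Q (\<lambda>z. \<phi> (x + t *\<^sub>R z))" for t
    define A' where "A' t = integral ?Q (\<lambda>z. grad \<phi> (x + t *\<^sub>R z) \<bullet> z)" for t
    have ct: "continuous_on UNIV (\<lambda>z. \<phi> (x + t *\<^sub>R z))" "continuous_on UNIV (\<lambda>z. grad \<phi> (x + t *\<^sub>R z))" for t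
      by (auto intro!: continuous_on_compose2[OF cont(1)] continuous_on_compose2[OF cont(2)] continuous_intros)
    have dA: "(A has_real_derivative A' t) (at t)" for t
    proof -
      have "(A has_real_derivative A' t) (at t within UNIV)"
        unfolding A_def A'_def
      proof (rule leibniz_rule_field_derivative)
        show "((\<lambda>t. \<phi> (x + t *\<^sub>R z)) has_real_derivative grad \<phi> (x + t *\<^sub>R z) \<bullet> z) (at t within UNIV)" for t z
        proof -
          have "((\<lambda>t. \<phi> (x + t *\<^sub>R z)) has_derivative (\<lambda>s. grad \<phi> (x + t *\<^sub>R z) \<bullet> (s *\<^sub>R z))) (at t)"
            by (rule has_derivative_compose[where f="\<lambda>t. x + t *\<^sub>R z" and g=\<phi>, of "\<lambda>t. t *\<^sub>R z"])
               (auto intro!: derivative_eq_intros has_derivative_grad T)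
          then show ?thesis by (simp add: has_field_derivative_def mult.commute[of _ "_ \<bullet> _"])
        qed
        show "(\<lambda>z. \<phi> (x + t *\<^sub>R z)) integrable_on ?Q" for t
          by (intro integrable_continuous continuous_on_subset[OF ct(1)]) auto
        show "continuous_on (UNIV \<times> ?Q) (\<lambda>(t, z). grad \<phi> (x + t *\<^sub>R z) \<bullet> z)"
          unfolding split_def
          by (intro continuous_intros continuous_on_compose2[OF cont(2)]) auto
      qed auto
      then show ?thesis by simp
    qed
    have nz: "norm z \<le> D" if "z \<in> ?Q" for z
    proof -
      have "norm z \<le> (\<Sum>b\<in>Basis. \<bar>z \<bullet> b\<bar>)" by (rule norm_le_l1)
      also have "\<dots> \<le> (\<Sum>b\<in>(Basis :: (real^'n) set). 1)"
        using that by (intro sum_mono) (auto simp: mem_box)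
      finally show ?thesis by (simp add: D_def)
    qed
    have "\<bar>A 1 - A 0\<bar> \<le> (D * I1 powr (1/p)) / (1 - \<gamma>)"
    proof (rule deriv_bound_powr[OF \<gamma>])
      show "continuous_on {0..1} A"
        using dA by (meson DERIV_isCont continuous_at_imp_continuous_on)
      show "(A has_real_derivative A' t) (at t)" for t by (rule dA)
      fix t :: real assume t: "0 < t" "t < 1"
      have cg: "continuous_on UNIV (\<lambda>z. norm (grad \<phi> (x + t *\<^sub>R z)))"
        by (intro continuous_intros ct)
      have "ennreal I1 = ennreal (t ^ CARD('n)) * (\<integral>\<^sup>+z. ennreal (norm (grad \<phi> (x + t *\<^sub>R z)) powr p) \<partial>lborel)"
        using t nn_integral_lborel_affine[of t "\<lambda>z. ennreal (norm (grad \<phi> z) powr p)" x] by (simp add: n1)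
      then have "ennreal (1 / t ^ CARD('n)) * ennreal I1
          = ennreal (1 / t ^ CARD('n)) * ennreal (t ^ CARD('n)) * (\<integral>\<^sup>+z. ennreal (norm (grad \<phi> (x + t *\<^sub>R z)) powr p) \<partial>lborel)"
        by (simp add: mult.assoc)
      also have "ennreal (1 / t ^ CARD('n)) * ennreal (t ^ CARD('n)) = 1"
        using t by (simp flip: ennreal_mult)
      finally have sc: "(\<integral>\<^sup>+z. ennreal (norm (grad \<phi> (x + t *\<^sub>R z)) powr p) \<partial>lborel) = ennreal (I1 / t ^ CARD('n))"
        using t I by (simp flip: ennreal_mult)
      have "\<bar>A' t\<bar> = \<bar>\<integral>z. indicator ?Q z * (grad \<phi> (x + t *\<^sub>R z) \<bullet> z) \<partial>lborel\<bar>"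
        unfolding A'_def by (subst set_int) (auto intro!: continuous_intros ct)
      also have "\<dots> \<le> (\<integral>z. \<bar>indicator ?Q z * (grad \<phi> (x + t *\<^sub>R z) \<bullet> z)\<bar> \<partial>lborel)"
        using integral_norm_bound[of lborel "\<lambda>z. indicator ?Q z * (grad \<phi> (x + t *\<^sub>R z) \<bullet> z)"] by simp
      also have "\<dots> \<le> (\<integral>z. D * (indicator ?Q z * \<bar>norm (grad \<phi> (x + t *\<^sub>R z))\<bar>) \<partial>lborel)"
      proof (rule integral_mono')
        have "set_integrable lborel ?Q (\<lambda>z. norm (grad \<phi> (x + t *\<^sub>R z)))"
          unfolding set_integrable_def
          by (intro borel_integrable_compact continuous_on_subset[OF cg]) auto
        then show "integrable lborel (\<lambda>z. D * (indicator ?Q z * \<bar>norm (grad \<phi> (x + t *\<^sub>R z))\<bar>))"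
          by (simp add: set_integrable_def)
        fix z
        have "\<bar>grad \<phi> (x + t *\<^sub>R z) \<bullet> z\<bar> \<le> D * norm (grad \<phi> (x + t *\<^sub>R z))" if "z \<in> ?Q"
          using Cauchy_Schwarz_ineq2[of "grad \<phi> (x + t *\<^sub>R z)" z] mult_left_mono[OF nz[OF that], of "norm (grad \<phi> (x + t *\<^sub>R z))"]
          by (simp add: mult.commute)
        then show "\<bar>indicator ?Q z * (grad \<phi> (x + t *\<^sub>R z) \<bullet> z)\<bar> \<le> D * (indicator ?Q z * \<bar>norm (grad \<phi> (x + t *\<^sub>R z))\<bar>)"
          by (simp add: indicator_def)
      qed (use D1 in auto)
      also have "\<dots> = D * (\<integral>z. indicator ?Q z * \<bar>norm (grad \<phi> (x + t *\<^sub>R z))\<bar> \<partial>lborel)"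
        by simp
      also have "\<dots> \<le> D * (I1 / t ^ CARD('n)) powr (1 / p)"
        using D1 B I t sc p1
        by (intro mult_left_mono integral_unit_box_le[OF _ cg, where B=B]) auto
      also have "\<dots> = D * I1 powr (1/p) * t powr (- \<gamma>)"
        using t I by (simp add: powr_divide powr_minus_divide powr_powr \<gamma>_def flip: powr_realpow)
      finally show "\<bar>A' t\<bar> \<le> D * I1 powr (1/p) * t powr (- \<gamma>)" .
    qed
    \<comment> \<open>At t = 0 the integrand is the constant \<open>\<phi> x\<close>, and the cube
      has volume 1.\<close>
    moreover have "A 0 = \<phi> x"
      unfolding A_def using Q by (simp add: content_def measure_def)
    moreover have "\<bar>A 1\<bar> \<le> I0 powr (1/p)"
    proof -
      have c: "continuous_on UNIV (\<lambda>z. \<phi> (x + z))" using ct(1)[of 1] by simp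
      have "\<bar>A 1\<bar> \<le> (\<integral>z. \<bar>indicator ?Q z * \<phi> (x + z)\<bar> \<partial>lborel)"
        unfolding A_def using integral_norm_bound[of lborel "\<lambda>z. indicator ?Q z * \<phi> (x + z)"] set_int[OF c] by simp
      also have "\<dots> = (\<integral>z. indicator ?Q z * \<bar>\<phi> (x + z)\<bar> \<partial>lborel)" by (simp add: abs_mult)
      also have "\<dots> \<le> I0 powr (1/p)"
        using nn_integral_lborel_affine[of 1 "\<lambda>z. ennreal (\<bar>\<phi> z\<bar> powr p)" x] n0 B I p1
        by (intro integral_unit_box_le[OF _ c, where B=B]) auto
      finally show ?thesis .
    qed
    ultimately show ?thesis by (simp add: L0 L1)
  qed
  define C where "C = 1 + D / (1 - \<gamma>)"
  have DC: "D / (1 - \<gamma>) \<ge> 0" using D1 \<gamma> by simp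
  show ?thesis
  proof (rule that[of C])
    show "C > 0" using DC by (simp add: C_def)
    fix \<phi> x assume "\<phi> \<in> test_fun \<Omega>"
    from main[OF this, of x]
    have "\<bar>\<phi> x\<bar> \<le> 1 * Lp_norm \<Omega> p \<phi> + D / (1 - \<gamma>) * Lp_norm \<Omega> p (\<lambda>x. norm (grad \<phi> x))" by simp
    also have "\<dots> \<le> C * Lp_norm \<Omega> p \<phi> + C * Lp_norm \<Omega> p (\<lambda>x. norm (grad \<phi> x))"
      using DC by (intro add_mono mult_right_mono Lp_norm_nonneg) (auto simp: C_def)
    finally show "\<bar>\<phi> x\<bar> \<le> C * W1_norm \<Omega> p \<phi> (grad \<phi>)"
      by (simp add: W1_norm_def distrib_left)
  qed
qed

subsection \<open>Membership in the Sobolev space\<close>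

text \<open>\<open>W1p\<close> asserts measurability of the norm of a gradient only. Measurability
  of its components has to come from local integrability, by exhausting \<open>\<Omega>\<close> with
  countably many compact sets.\<close>

lemma loc_int_measurable:
  assumes "open \<Omega>" "loc_int \<Omega> f"
  shows "f \<in> borel_measurable (lebesgue_on \<Omega>)"
proof -
  obtain K :: "nat \<Rightarrow> (real^'a) set" where K: "\<And>n. compact (K n)" "\<And>n. K n \<subseteq> \<Omega>" "\<Union>(range K) = \<Omega>"
    using open_Union_compact_subsets[OF assms(1)] by metis
  show ?thesis
  proof (rule measurable_piecewise_restrict[where C="range K"])
    fix L assume "L \<in> range K"
    then have L: "compact L" "L \<subseteq> \<Omega>" using K by auto
    have ms: "L \<in> sets lebesgue" "\<Omega> \<in> sets lebesgue" using L assms(1) by (auto intro: lmeasurable_compact fmeasurableD)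
    then show "L \<inter> space (lebesgue_on \<Omega>) \<in> sets (lebesgue_on \<Omega>)"
      using L by (auto simp: sets_restrict_space_iff)
    have "restrict_space (lebesgue_on \<Omega>) L = lebesgue_on L"
      using L ms by (subst restrict_restrict_space) (auto simp: Int_absorb1)
    moreover have "integrable (lebesgue_on L) f" using assms(2) L by (auto simp: loc_int_def)
    ultimately show "f \<in> measurable (restrict_space (lebesgue_on \<Omega>) L) borel" by simp
  qed (use K in auto)
qed

lemma integrable_imp_loc_int:
  assumes "open \<Omega>" and f: "integrable (lebesgue_on \<Omega>) f"
  shows "loc_int \<Omega> f"
  unfolding loc_int_def
proof (intro allI impI)
  fix K assume "compact K \<and> K \<subseteq> \<Omega>"
  then have K: "compact K" "K \<subseteq> \<Omega>" by auto
  have ms: "K \<in> sets lebesgue" "\<Omega> \<in> sets lebesgue"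
    using K assms(1) by (auto intro: lmeasurable_compact fmeasurableD)
  then have Ks: "K \<in> sets (lebesgue_on \<Omega>)" using K by (auto simp: sets_restrict_space_iff)
  have "restrict_space (lebesgue_on \<Omega>) K = lebesgue_on K"
    using K ms by (subst restrict_restrict_space) (auto simp: Int_absorb1)
  moreover have "integrable (restrict_space (lebesgue_on \<Omega>) K) f"
    using integrable_mult_indicator[OF Ks f] Ks K by (subst integrable_restrict_space) (auto simp: Int_absorb2)
  ultimately show "integrable (lebesgue_on K) f" by simp
qed

lemma borel_measurable_cartI:
  fixes g :: "'a \<Rightarrow> real^'n"
  assumes "\<And>i. (\<lambda>x. g x $ i) \<in> borel_measurable M"
  shows "g \<in> borel_measurable M"
  unfolding borel_measurable_euclidean_space[of g]
  using assms by (auto simp: Basis_vec_def inner_axis)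

lemma W1p_2D:
  assumes "open \<Omega>" "W1p \<Omega> 2 u Du"
  shows "u \<in> borel_measurable (lebesgue_on \<Omega>)" "Du \<in> borel_measurable (lebesgue_on \<Omega>)"
    "integrable (lebesgue_on \<Omega>) (\<lambda>x. (u x)\<^sup>2)" "integrable (lebesgue_on \<Omega>) (\<lambda>x. (norm (Du x))\<^sup>2)"
proof -
  show "u \<in> borel_measurable (lebesgue_on \<Omega>)"
    using assms by (auto simp: W1p_def in_Lp_def)
  show "integrable (lebesgue_on \<Omega>) (\<lambda>x. (u x)\<^sup>2)" "integrable (lebesgue_on \<Omega>) (\<lambda>x. (norm (Du x))\<^sup>2)"
    using assms(2) by (auto simp: W1p_def in_Lp_def)
  show "Du \<in> borel_measurable (lebesgue_on \<Omega>)"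
    using assms by (intro borel_measurable_cartI loc_int_measurable) (auto simp: W1p_def weak_grad_def)
qed

lemma power2_add_le: "((a::real) + b)\<^sup>2 \<le> 2 * a\<^sup>2 + 2 * b\<^sup>2"
  using zero_le_power2[of "a - b"] by (simp add: power2_eq_square algebra_simps)

lemma square_integrable_norm_diff:
  fixes f g :: "'a \<Rightarrow> 'b::{banach, second_countable_topology}"
  assumes [measurable]: "f \<in> borel_measurable M" "g \<in> borel_measurable M"
    and i: "integrable M (\<lambda>x. (norm (f x))\<^sup>2)" "integrable M (\<lambda>x. (norm (g x))\<^sup>2)"
  shows "integrable M (\<lambda>x. (norm (f x - g x))\<^sup>2)"
proof (rule Bochner_Integration.integrable_bound)
  show "integrable M (\<lambda>x. 2 * (norm (f x))\<^sup>2 + 2 * (norm (g x))\<^sup>2)" using i by simp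
  show "AE x in M. norm ((norm (f x - g x))\<^sup>2) \<le> norm (2 * (norm (f x))\<^sup>2 + 2 * (norm (g x))\<^sup>2)"
  proof (rule AE_I2)
    fix x
    have "(norm (f x - g x))\<^sup>2 \<le> (norm (f x) + norm (g x))\<^sup>2"
      by (intro power_mono norm_triangle_ineq4) simp
    also have "\<dots> \<le> 2 * (norm (f x))\<^sup>2 + 2 * (norm (g x))\<^sup>2"
      by (rule power2_add_le)
    finally show "norm ((norm (f x - g x))\<^sup>2) \<le> norm (2 * (norm (f x))\<^sup>2 + 2 * (norm (g x))\<^sup>2)"
      by simp
  qed
qed simp

lemma test_fun_L2:
  assumes "open \<Omega>" "bounded \<Omega>" "v \<in> test_fun (\<Omega> :: (real^'n) set)"
  shows "v \<in> borel_measurable (lebesgue_on \<Omega>)" "grad v \<in> borel_measurable (lebesgue_on \<Omega>)"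
    "integrable (lebesgue_on \<Omega>) (\<lambda>x. (v x)\<^sup>2)" "integrable (lebesgue_on \<Omega>) (\<lambda>x. (norm (grad v x))\<^sup>2)"
proof -
  interpret finite_measure "lebesgue_on \<Omega>"
    using assms by (intro finite_measure_lebesgue_on_bounded)
  note D = test_funD[OF assms(3)]
  show m[measurable]: "v \<in> borel_measurable (lebesgue_on \<Omega>)" "grad v \<in> borel_measurable (lebesgue_on \<Omega>)"
    using D assms(1) by (auto intro!: continuous_lebesgue_on_measurable smooth_continuous continuous_on_grad)
  obtain B where B: "B > 0" "\<And>x. \<bar>v x\<bar> \<le> B" "\<And>x. norm (grad v x) \<le> B"
    using test_fun_bounded[OF assms(3)] by metis
  have "(v x)\<^sup>2 \<le> B\<^sup>2" "(norm (grad v x))\<^sup>2 \<le> B\<^sup>2" for x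
    using B power_mono[of "\<bar>v x\<bar>" B 2] by (auto intro: power_mono)
  then show "integrable (lebesgue_on \<Omega>) (\<lambda>x. (v x)\<^sup>2)" "integrable (lebesgue_on \<Omega>) (\<lambda>x. (norm (grad v x))\<^sup>2)"
    by (auto intro!: integrable_const_bound[where B="B\<^sup>2"])
qed

text \<open>The weak gradient is inherited from the approximants: integration by parts holds for
  each \<open>v k\<close>, and L^2 convergence lets it pass to the limit against the bounded
  functions \<open>\<phi>\<close> and \<open>partial \<phi> i\<close>. Membership in H_0^1 is
  thereby reduced to two L^2 limits.\<close>

lemma W01p_limitI:
  fixes \<Omega> :: "(real^'n) set"
  assumes \<Omega>: "open \<Omega>" "bounded \<Omega>"
    and m[measurable]: "z \<in> borel_measurable (lebesgue_on \<Omega>)" "Dz \<in> borel_measurable (lebesgue_on \<Omega>)"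
    and i: "integrable (lebesgue_on \<Omega>) (\<lambda>x. (z x)\<^sup>2)" "integrable (lebesgue_on \<Omega>) (\<lambda>x. (norm (Dz x))\<^sup>2)"
    and v: "\<And>k. v k \<in> test_fun \<Omega>"
    and lim: "(\<lambda>k. \<integral>x. (v k x - z x)\<^sup>2 \<partial>lebesgue_on \<Omega>) \<longlonglongrightarrow> 0"
      "(\<lambda>k. \<integral>x. (norm (grad (v k) x - Dz x))\<^sup>2 \<partial>lebesgue_on \<Omega>) \<longlonglongrightarrow> 0"
  shows "W01p \<Omega> 2 z Dz"
proof -
  let ?M = "lebesgue_on \<Omega>"
  have fin: "finite_measure ?M" using \<Omega> by (intro finite_measure_lebesgue_on_bounded)
  note L2 = test_fun_L2[OF \<Omega>]
  note [measurable] = L2(1,2)[OF v]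
  have i1: "integrable ?M (\<lambda>x. (v k x - z x)\<^sup>2)" for k
    using square_integrable_norm_diff[of "v k" ?M z] L2(3)[OF v] i by simp
  have i2: "integrable ?M (\<lambda>x. (norm (grad (v k) x - Dz x))\<^sup>2)" for k
    using square_integrable_norm_diff[of "grad (v k)" ?M Dz] L2(4)[OF v] i by simp
  have comp: "(y $ i)\<^sup>2 \<le> (norm y)\<^sup>2" for y :: "real^'n" and i
    using power_mono[OF component_le_norm_cart[of y i], of 2] by simp
  have mi[measurable]: "(\<lambda>x. Dz x $ i) \<in> borel_measurable ?M" "(\<lambda>x. grad (v k) x $ i) \<in> borel_measurable ?M" for i k
    by (rule measurable_compose[OF m(2)] measurable_compose[OF L2(2)[OF v]],
        rule borel_measurable_continuous_onI, intro continuous_intros)+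
  have Dzi: "integrable ?M (\<lambda>x. (Dz x $ i)\<^sup>2)" for i
    by (rule Bochner_Integration.integrable_bound[OF i(2)]) (auto simp: comp)
  have gi: "integrable ?M (\<lambda>x. (grad (v k) x $ i)\<^sup>2)" for i k
    by (rule Bochner_Integration.integrable_bound[OF L2(4)[OF v[of k]]]) (auto simp: comp)
  have i3: "integrable ?M (\<lambda>x. (grad (v k) x $ i - Dz x $ i)\<^sup>2)" for i k
    using square_integrable_norm_diff[of "\<lambda>x. grad (v k) x $ i" ?M "\<lambda>x. Dz x $ i"] gi Dzi by simp
  have lim3: "(\<lambda>k. \<integral>x. (grad (v k) x $ i - Dz x $ i)\<^sup>2 \<partial>?M) \<longlonglongrightarrow> 0" for i
  proof (rule tendsto_sandwich[OF _ _ tendsto_const lim(2)])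
    show "\<forall>\<^sub>F k in sequentially. (\<integral>x. (grad (v k) x $ i - Dz x $ i)\<^sup>2 \<partial>?M) \<le> (\<integral>x. (norm (grad (v k) x - Dz x))\<^sup>2 \<partial>?M)"
      using comp[of "grad (v _) _ - Dz _" i] by (intro always_eventually allI integral_mono i2 i3) auto
  qed auto
  have zi: "integrable ?M z" and Dzint: "integrable ?M (\<lambda>x. Dz x $ i)" for i
    by (rule integrable_of_square[OF fin _ i(1)], simp) (rule integrable_of_square[OF fin _ Dzi], simp)
  have "weak_grad \<Omega> z Dz"
    unfolding weak_grad_def
  proof (intro conjI ballI allI)
    show "loc_int \<Omega> z" "loc_int \<Omega> (\<lambda>x. Dz x $ i)" for i
      by (rule integrable_imp_loc_int[OF \<Omega>(1) zi] integrable_imp_loc_int[OF \<Omega>(1) Dzint])+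
    fix \<phi> i assume \<phi>: "\<phi> \<in> test_fun \<Omega>"
    obtain B where B: "B > 0" "\<And>x. \<bar>\<phi> x\<bar> \<le> B" "\<And>x. norm (grad \<phi> x) \<le> B"
      using test_fun_bounded[OF \<phi>] by metis
    have B': "\<bar>partial \<phi> i x\<bar> \<le> B" for x
      using component_le_norm_cart[of "grad \<phi> x" i] B(3)[of x] by (simp add: partial_eq_grad_nth)
    have [measurable]: "\<phi> \<in> borel_measurable ?M" "partial \<phi> i \<in> borel_measurable ?M"
      using \<Omega>(1) test_funD[OF \<phi>] by (auto intro!: continuous_lebesgue_on_measurable smooth_continuous smooth_partial)
    have int: "integrable ?M (\<lambda>x. f x * \<phi> x)" "integrable ?M (\<lambda>x. f x * partial \<phi> i x)" if "integrable ?M f" for f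
      by (rule integrable_mult_bounded[OF that _ B(2)], simp) (rule integrable_mult_bounded[OF that _ B'], simp)
    have vi: "integrable ?M (v k)" "integrable ?M (\<lambda>x. grad (v k) x $ i)" for k
      by (rule integrable_of_square[OF fin _ L2(3)[OF v]], simp) (rule integrable_of_square[OF fin _ gi], simp)
    have "(\<lambda>k. \<integral>x. (v k x - z x) * partial \<phi> i x \<partial>?M) \<longlonglongrightarrow> 0"
      by (rule integral_square_tendsto_imp[OF fin _ i1 lim(1) _ B']) auto
    then have "(\<lambda>k. (\<integral>x. v k x * partial \<phi> i x \<partial>?M) - (\<integral>x. z x * partial \<phi> i x \<partial>?M)) \<longlonglongrightarrow> 0"
      by (simp add: left_diff_distrib int vi zi)
    then have l1: "(\<lambda>k. \<integral>x. v k x * partial \<phi> i x \<partial>?M) \<longlonglongrightarrow> (\<integral>x. z x * partial \<phi> i x \<partial>?M)"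
      using LIM_zero_iff by blast
    have "(\<lambda>k. \<integral>x. (grad (v k) x $ i - Dz x $ i) * \<phi> x \<partial>?M) \<longlonglongrightarrow> 0"
      by (rule integral_square_tendsto_imp[OF fin _ i3 lim3 _ B(2)]) auto
    then have "(\<lambda>k. (\<integral>x. grad (v k) x $ i * \<phi> x \<partial>?M) - (\<integral>x. Dz x $ i * \<phi> x \<partial>?M)) \<longlonglongrightarrow> 0"
      by (simp add: left_diff_distrib int vi Dzint)
    then have "(\<lambda>k. \<integral>x. grad (v k) x $ i * \<phi> x \<partial>?M) \<longlonglongrightarrow> (\<integral>x. Dz x $ i * \<phi> x \<partial>?M)"
      using LIM_zero_iff by blast
    then have "(\<lambda>k. \<integral>x. v k x * partial \<phi> i x \<partial>?M) \<longlonglongrightarrow> - (\<integral>x. Dz x $ i * \<phi> x \<partial>?M)"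
      unfolding test_fun_integration_by_parts[OF \<Omega> v \<phi>] by (rule tendsto_minus)
    with l1 show "(\<integral>x. z x * partial \<phi> i x \<partial>?M) = - (\<integral>x. Dz x $ i * \<phi> x \<partial>?M)"
      using LIMSEQ_unique by blast
  qed
  moreover have "in_Lp \<Omega> 2 z" "in_Lp \<Omega> 2 (\<lambda>x. norm (Dz x))"
    using i by (auto simp: in_Lp_def)
  ultimately have "W1p \<Omega> 2 z Dz" by (simp add: W1p_def)
  moreover have "(\<lambda>k. Lp_norm \<Omega> 2 (\<lambda>x. v k x - z x)) \<longlonglongrightarrow> 0"
    "(\<lambda>k. Lp_norm \<Omega> 2 (\<lambda>x. norm (grad (v k) x - Dz x))) \<longlonglongrightarrow> 0"
    unfolding Lp_norm_2 using tendsto_real_sqrt[OF lim(1)] tendsto_real_sqrt[OF lim(2)] by simp_all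
  ultimately show ?thesis using v by (auto simp: W01p_def)
qed

lemma test_fun_W01p:
  assumes "open \<Omega>" "bounded \<Omega>" "v \<in> test_fun \<Omega>" shows "W01p \<Omega> 2 v (grad v)"
  using test_fun_L2[OF assms] assms by (intro W01p_limitI[where v="\<lambda>_. v"]) auto

subsection \<open>Chain rule\<close>

text \<open>Weierstrass approximation is applied to the derivative and the polynomial is integrated
  from 0; accuracy e / (1 + r) for the derivative leaves an error of at most e after integrating
  over length r. Normalising the antiderivative to agree with f at 0 makes its constant term vanish
  when f 0 = 0.\<close>

lemma polynomial_approx_C1:
  fixes f f' :: "real \<Rightarrow> real"
  assumes f: "\<And>s. (f has_real_derivative f' s) (at s)" and f': "continuous_on UNIV f'"
    and "r \<ge> 0" "e > 0"
  shows "\<exists>a n. \<forall>s. \<bar>s\<bar> \<le> r \<longrightarrow>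
    \<bar>(f 0 + (\<Sum>i\<le>n. a i / real (Suc i) * s ^ Suc i)) - f s\<bar> \<le> e \<and>
    \<bar>(\<Sum>i\<le>n. a i * s ^ i) - f' s\<bar> \<le> e"
proof -
  define d where "d = e / (1 + r)"
  have d: "d > 0" "d * r \<le> e" "d \<le> e" using assms by (auto simp: d_def field_simps)
  obtain g where g: "real_polynomial_function g" "\<And>s. s \<in> {-r..r} \<Longrightarrow> \<bar>f' s - g s\<bar> < d"
    using Stone_Weierstrass_real_polynomial_function[OF compact_Icc continuous_on_subset[OF f'] d(1)] by blast
  obtain a n where an: "g = (\<lambda>x. \<Sum>i\<le>n. a i * x ^ i)"
    using g(1) real_polynomial_function_iff_sum by blast
  define P where "P s = f 0 + (\<Sum>i\<le>n. a i / real (Suc i) * s ^ Suc i)" for s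
  have P: "(P has_real_derivative g s) (at s)" for s
    unfolding P_def an
    by (auto intro!: derivative_eq_intros sum.cong simp del: power_Suc)
  have P0: "P 0 = f 0" by (simp add: P_def)
  have "\<bar>P s - f s\<bar> \<le> e" if s: "\<bar>s\<bar> \<le> r" for s
  proof -
    have "norm ((P s - f s) - (P 0 - f 0)) \<le> d * norm (s - 0)"
    proof (rule field_differentiable_bound[of "{-r..r}" "\<lambda>s. P s - f s" "\<lambda>s. g s - f' s"])
      fix t assume "t \<in> {-r..r}"
      then show "norm (g t - f' t) \<le> d" using g(2)[of t] by (simp add: abs_minus_commute)
      show "((\<lambda>s. P s - f s) has_real_derivative g t - f' t) (at t within {-r..r})"
        by (intro DERIV_diff P f has_field_derivative_at_within)
    qed (use s \<open>r \<ge> 0\<close> in auto)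
    also have "\<dots> \<le> d * r" using s d by simp
    finally show ?thesis using d P0 by simp
  qed
  moreover have "\<bar>(\<Sum>i\<le>n. a i * s ^ i) - f' s\<bar> \<le> e" if s: "\<bar>s\<bar> \<le> r" for s
    using g(2)[of s] s d(3) unfolding an atLeastAtMost_iff by linarith
  ultimately show ?thesis unfolding P_def by blast
qed

lemma smooth_polynomial:
  fixes v :: "real^'n \<Rightarrow> real"
  assumes "smooth v"
  shows "smooth (\<lambda>x. c + (\<Sum>i\<le>n. a i / real (Suc i) * v x ^ Suc i))"
    and "grad (\<lambda>x. c + (\<Sum>i\<le>n. a i / real (Suc i) * v x ^ Suc i)) x = (\<Sum>i\<le>n. a i * v x ^ i) *\<^sub>R grad v x"
proof -
  show "smooth (\<lambda>x. c + (\<Sum>i\<le>n. a i / real (Suc i) * v x ^ Suc i))"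
    by (intro smooth_add smooth_sum smooth_mult smooth_power smooth_const assms)
  define P where "P s = c + (\<Sum>i\<le>n. a i / real (Suc i) * s ^ Suc i)" for s
  have "(P has_real_derivative (\<Sum>i\<le>n. a i * v x ^ i)) (at (v x))"
    unfolding P_def by (auto intro!: derivative_eq_intros sum.cong simp del: power_Suc)
  then have "((\<lambda>x. P (v x)) has_derivative (\<lambda>y. (\<Sum>i\<le>n. a i * v x ^ i) * (grad v x \<bullet> y))) (at x)"
    unfolding has_field_derivative_def by (rule has_derivative_compose[OF has_derivative_grad[OF assms]])
  then show "grad (\<lambda>x. c + (\<Sum>i\<le>n. a i / real (Suc i) * v x ^ Suc i)) x = (\<Sum>i\<le>n. a i * v x ^ i) *\<^sub>R grad v x"
    by (intro grad_eqI) (simp add: P_def)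
qed

lemma grad_mult:
  assumes "smooth f" "smooth g"
  shows "grad (\<lambda>x. f x * g x) x = g x *\<^sub>R grad f x + f x *\<^sub>R grad g x"
  by (rule grad_eqI) (auto intro!: derivative_eq_intros has_derivative_grad assms simp: inner_add_left)

text \<open>The approximants are \<open>P\<^sub>k(v\<^sub>k) \<phi>\<close> with polynomials \<open>P\<^sub>k\<close> close to \<open>f\<close> in \<open>C\<^sup>1\<close> on the range of
  the test functions \<open>v\<^sub>k \<rightarrow> u\<close>; composing with polynomials keeps them smooth although \<open>f\<close> is only \<open>C\<^sup>1\<close>.\<close>
lemma W01p_chain_rule:
  fixes \<Omega> :: "(real^'n) set" and f f' :: "real \<Rightarrow> real"
  assumes \<Omega>: "open \<Omega>" "bounded \<Omega>" and u: "W01p \<Omega> 2 u Du"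
    and f: "\<And>s. (f has_real_derivative f' s) (at s)" and f': "continuous_on UNIV f'"
    and C: "\<And>s. \<bar>f s\<bar> \<le> C" "\<And>s. \<bar>f' s\<bar> \<le> C"
    and \<phi>: "\<phi> \<in> test_fun \<Omega> \<or> \<phi> = (\<lambda>_. 1) \<and> f 0 = 0"
  shows "W01p \<Omega> 2 (\<lambda>x. f (u x) * \<phi> x) (\<lambda>x. (f' (u x) * \<phi> x) *\<^sub>R Du x + f (u x) *\<^sub>R grad \<phi> x)"
proof -
  let ?M = "lebesgue_on \<Omega>"
  have fin: "finite_measure ?M" using \<Omega> by (intro finite_measure_lebesgue_on_bounded)
  then interpret finite_measure ?M .
  have C0: "C \<ge> 0" using C(1)[of 0] by linarith
  have sm: "smooth \<phi>" using \<phi> test_funD(1) smooth_const by blast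
  obtain B where B: "B > 0" "\<And>x. \<bar>\<phi> x\<bar> \<le> B" "\<And>x. norm (grad \<phi> x) \<le> B"
  proof (cases "\<phi> \<in> test_fun \<Omega>")
    case True then show ?thesis using test_fun_bounded[of \<phi> \<Omega>] that by metis
  next
    case False then have "\<phi> = (\<lambda>_. 1)" using \<phi> by auto
    then show ?thesis using that[of 1] by simp
  qed
  have [measurable]: "\<phi> \<in> borel_measurable ?M" "grad \<phi> \<in> borel_measurable ?M"
    using \<Omega> sm by (auto intro!: continuous_lebesgue_on_measurable smooth_continuous continuous_on_grad)
  have uW: "W1p \<Omega> 2 u Du" using u by (simp add: W01p_def)
  note U = W1p_2D[OF \<Omega>(1) uW]
  note [measurable] = U(1,2)
  have fc: "continuous_on UNIV f"
    using f by (meson DERIV_isCont continuous_at_imp_continuous_on)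
  have [measurable]: "f \<in> borel_measurable borel" "f' \<in> borel_measurable borel"
    using f' fc by (auto intro: borel_measurable_continuous_onI)
  obtain u0 where u0: "\<And>k. u0 k \<in> test_fun \<Omega>"
    "(\<lambda>k. Lp_norm \<Omega> 2 (\<lambda>x. u0 k x - u x)) \<longlonglongrightarrow> 0"
    "(\<lambda>k. Lp_norm \<Omega> 2 (\<lambda>x. norm (grad (u0 k) x - Du x))) \<longlonglongrightarrow> 0"
    using u by (auto simp: W01p_def)
  note [measurable] = test_fun_L2(1,2)[OF \<Omega> u0(1)]
  have sq: "(\<lambda>k. \<integral>x. (u0 k x - u x)\<^sup>2 \<partial>?M) \<longlonglongrightarrow> 0"
     "(\<lambda>k. \<integral>x. (norm (grad (u0 k) x - Du x))\<^sup>2 \<partial>?M) \<longlonglongrightarrow> 0"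
    using tendsto_power[OF u0(2), of 2] tendsto_power[OF u0(3), of 2] by (simp_all add: Lp_norm_2)
  have i0: "integrable ?M (\<lambda>x. (u0 k x - u x)\<^sup>2)" for k
    using square_integrable_norm_diff[of "u0 k" ?M u] test_fun_L2(3)[OF \<Omega> u0(1)] U by simp
  have i0': "integrable ?M (\<lambda>x. (norm (grad (u0 k) x - Du x))\<^sup>2)" for k
    using square_integrable_norm_diff[of "grad (u0 k)" ?M Du] test_fun_L2(4)[OF \<Omega> u0(1)] U by simp
  \<comment> \<open>\<open>f'\<close> is merely continuous, so convergence of
    \<open>f' (v k x)\<close> needs pointwise convergence; L^2 convergence gives L^1 convergence and
    hence an almost everywhere convergent subsequence.\<close>
  have "(\<lambda>k. \<integral>x. \<bar>u0 k x - u x\<bar> * 1 \<partial>?M) \<longlonglongrightarrow> 0"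
    by (rule integral_square_tendsto_imp[OF fin, where B=1]) (use sq i0 in auto)
  then have "\<exists>r::nat\<Rightarrow>nat. strict_mono r \<and> (AE x in ?M. (\<lambda>k. u0 (r k) x - u x) \<longlonglongrightarrow> 0)"
    by (intro tendsto_L1_AE_subseq integrable_of_square[OF fin _ i0]) simp_all
  then obtain r where r: "strict_mono r" "AE x in ?M. (\<lambda>k. u0 (r k) x - u x) \<longlonglongrightarrow> 0"
    by blast
  define v where "v k = u0 (r k)" for k
  have v: "v k \<in> test_fun \<Omega>" for k by (simp add: v_def u0)
  have [measurable]: "v k \<in> borel_measurable ?M" "grad (v k) \<in> borel_measurable ?M" for k
    using v test_fun_L2(1,2)[OF \<Omega>] by auto
  have vlim: "(\<lambda>k. \<integral>x. (v k x - u x)\<^sup>2 \<partial>?M) \<longlonglongrightarrow> 0" "(\<lambda>k. \<integral>x. (norm (grad (v k) x - Du x))\<^sup>2 \<partial>?M) \<longlonglongrightarrow> 0"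
    using sq[THEN LIMSEQ_subseq_LIMSEQ[OF _ r(1)]] by (auto simp: comp_def v_def)
  have vi: "integrable ?M (\<lambda>x. (v k x - u x)\<^sup>2)" "integrable ?M (\<lambda>x. (norm (grad (v k) x - Du x))\<^sup>2)" for k
    using i0 i0' by (auto simp: v_def)
  have vae: "AE x in ?M. (\<lambda>k. v k x) \<longlonglongrightarrow> u x"
    using r(2) by eventually_elim (simp add: LIM_zero_iff v_def)
  define e where "e k = 1 / real (Suc k)" for k
  have e: "e k > 0" "e k \<le> 1" for k by (auto simp: e_def)
  have elim: "e \<longlonglongrightarrow> 0"
    using LIMSEQ_Suc[OF lim_1_over_n[where 'a=real]] by (simp add: e_def[abs_def])
  define Q where "Q k a n \<longleftrightarrow> (\<forall>x. \<bar>(f 0 + (\<Sum>i\<le>n. a i / real (Suc i) * v k x ^ Suc i)) - f (v k x)\<bar> \<le> e k \<and>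
         \<bar>(\<Sum>i\<le>n. a i * v k x ^ i) - f' (v k x)\<bar> \<le> e k)" for k a n
  have "\<exists>a n. Q k a n" for k
  proof -
    obtain b where b: "b > 0" "\<And>x. \<bar>v k x\<bar> \<le> b" using test_fun_bounded[OF v[of k]] by metis
    have "\<exists>a n. \<forall>s. \<bar>s\<bar> \<le> b \<longrightarrow>
        \<bar>(f 0 + (\<Sum>i\<le>n. a i / real (Suc i) * s ^ Suc i)) - f s\<bar> \<le> e k \<and> \<bar>(\<Sum>i\<le>n. a i * s ^ i) - f' s\<bar> \<le> e k"
      using b(1) by (intro polynomial_approx_C1[OF f f' _ e(1)]) simp
    then obtain a n where "\<forall>s. \<bar>s\<bar> \<le> b \<longrightarrow>
        \<bar>(f 0 + (\<Sum>i\<le>n. a i / real (Suc i) * s ^ Suc i)) - f s\<bar> \<le> e k \<and> \<bar>(\<Sum>i\<le>n. a i * s ^ i) - f' s\<bar> \<le> e k"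
      by (elim exE)
    then have "Q k a n" using b(2) unfolding Q_def by simp
    then show ?thesis by blast
  qed
  then obtain a n where "\<And>k. Q k (a k) (n k)" by metis
  then have an: "\<bar>(f 0 + (\<Sum>i\<le>n k. a k i / real (Suc i) * v k x ^ Suc i)) - f (v k x)\<bar> \<le> e k"
       "\<bar>(\<Sum>i\<le>n k. a k i * v k x ^ i) - f' (v k x)\<bar> \<le> e k" for k x
    unfolding Q_def by blast+
  define p where "p k x = f 0 + (\<Sum>i\<le>n k. a k i / real (Suc i) * v k x ^ Suc i)" for k x
  define p' where "p' k x = (\<Sum>i\<le>n k. a k i * v k x ^ i)" for k x
  have ps: "smooth (p k)" and pg: "grad (p k) x = p' k x *\<^sub>R grad (v k) x" for k x
    using smooth_polynomial[OF test_funD(1)[OF v[of k]]] by (auto simp: p_def[abs_def] p'_def)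
  have pe: "\<bar>p k x - f (v k x)\<bar> \<le> e k" "\<bar>p' k x - f' (v k x)\<bar> \<le> e k" for k x
    using an by (auto simp: p_def p'_def)
  define w where "w k x = p k x * \<phi> x" for k x
  have w: "w k \<in> test_fun \<Omega>" for k
  proof (cases "\<phi> \<in> test_fun \<Omega>")
    case True then show ?thesis unfolding w_def[abs_def] using ps by (intro test_fun_mult_right)
  next
    \<comment> \<open>With the constant factor 1 the support must come from \<open>v k\<close>: as f
      0 = 0, the polynomial has no constant term and vanishes where \<open>v k\<close> does.\<close>
    case False
    then have "\<phi> = (\<lambda>_. 1)" "f 0 = 0" using \<phi> by auto
    then have "w k x \<noteq> 0 \<Longrightarrow> v k x \<noteq> 0" for x by (auto simp: w_def p_def)
    moreover have "smooth (w k)" unfolding w_def[abs_def] by (intro smooth_mult ps sm)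
    ultimately show ?thesis by (intro test_fun_subset_support[OF _ v[of k]]) auto
  qed
  have wg: "grad (w k) x = (p' k x * \<phi> x) *\<^sub>R grad (v k) x + p k x *\<^sub>R grad \<phi> x" for k x
    using grad_mult[OF ps sm] by (simp add: w_def[abs_def] pg mult.commute)
  define z where "z x = f (u x) * \<phi> x" for x
  define Dz where "Dz x = (f' (u x) * \<phi> x) *\<^sub>R Du x + f (u x) *\<^sub>R grad \<phi> x" for x
  have [measurable]: "z \<in> borel_measurable ?M" "Dz \<in> borel_measurable ?M"
    unfolding z_def[abs_def] Dz_def[abs_def] by measurable
  have lip: "\<bar>f s - f t\<bar> \<le> C * \<bar>s - t\<bar>" for s t
    using field_differentiable_bound[of UNIV f f' C s t] f C(2) by simp
  have fe: "\<bar>p k x - f (u x)\<bar> \<le> e k + C * \<bar>v k x - u x\<bar>" for k x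
    using pe(1)[of k x] lip[of "v k x" "u x"] by linarith
  have z2: "integrable ?M (\<lambda>x. (z x)\<^sup>2)"
  proof (rule integrable_const_bound[where B="(C * B)\<^sup>2"])
    have "\<bar>z x\<bar> \<le> C * B" for x
      unfolding z_def abs_mult using C B C0 by (intro mult_mono) auto
    then show "AE x in ?M. norm ((z x)\<^sup>2) \<le> (C * B)\<^sup>2"
      by (intro AE_I2) (metis abs_ge_zero norm_power power_mono real_norm_def)
  qed simp
  have Dz2: "integrable ?M (\<lambda>x. (norm (Dz x))\<^sup>2)"
  proof (rule Bochner_Integration.integrable_bound)
    show "integrable ?M (\<lambda>x. 2 * (C * B)\<^sup>2 * (norm (Du x))\<^sup>2 + 2 * (C * B)\<^sup>2)"
      using U(4) by simp
    show "AE x in ?M. norm ((norm (Dz x))\<^sup>2) \<le> norm (2 * (C * B)\<^sup>2 * (norm (Du x))\<^sup>2 + 2 * (C * B)\<^sup>2)"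
    proof (rule AE_I2)
      fix x
      have "\<bar>f' (u x)\<bar> * \<bar>\<phi> x\<bar> \<le> C * B" "\<bar>f (u x)\<bar> * norm (grad \<phi> x) \<le> C * B"
        using C B C0 by (auto intro!: mult_mono)
      then have "norm (Dz x) \<le> C * B * norm (Du x) + C * B"
        unfolding Dz_def by (intro norm_triangle_le add_mono) (auto simp: abs_mult intro!: mult_right_mono)
      then have "(norm (Dz x))\<^sup>2 \<le> (C * B * norm (Du x) + C * B)\<^sup>2"
        by (intro power_mono) auto
      also have "\<dots> \<le> 2 * (C * B)\<^sup>2 * (norm (Du x))\<^sup>2 + 2 * (C * B)\<^sup>2"
        using power2_add_le[of "C * B * norm (Du x)" "C * B"] by (simp add: power_mult_distrib)
      finally show "norm ((norm (Dz x))\<^sup>2) \<le> norm (2 * (C * B)\<^sup>2 * (norm (Du x))\<^sup>2 + 2 * (C * B)\<^sup>2)"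
        by simp
    qed
  qed simp
  \<comment> \<open>The error in f is Lipschitz in \<open>v k - u\<close>, but the one in
    \<open>f'\<close> has no rate. It is treated by dominated convergence, with 2 C |Du| as square
    integrable majorant.\<close>
  define d where "d k x = \<bar>f' (v k x) - f' (u x)\<bar> * norm (Du x)" for k x
  have [measurable]: "d k \<in> borel_measurable ?M" for k unfolding d_def[abs_def] by measurable
  have db: "(d k x)\<^sup>2 \<le> (2 * C)\<^sup>2 * (norm (Du x))\<^sup>2" for k x
  proof -
    have "\<bar>f' (v k x) - f' (u x)\<bar> \<le> 2 * C" using C(2)[of "v k x"] C(2)[of "u x"] by linarith
    then have "d k x \<le> 2 * C * norm (Du x)" unfolding d_def by (intro mult_right_mono) auto
    then have "(d k x)\<^sup>2 \<le> (2 * C * norm (Du x))\<^sup>2" by (intro power_mono) (auto simp: d_def)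
    then show ?thesis by (simp add: power_mult_distrib)
  qed
  have dint: "integrable ?M (\<lambda>x. (d k x)\<^sup>2)" for k
    by (rule Bochner_Integration.integrable_bound[where f="\<lambda>x. (2 * C)\<^sup>2 * (norm (Du x))\<^sup>2"]) (use U(4) db in auto)
  have "(\<lambda>k. \<integral>x. (d k x)\<^sup>2 \<partial>?M) \<longlonglongrightarrow> (\<integral>x. 0 \<partial>?M)"
  proof (rule integral_dominated_convergence[where w="\<lambda>x. (2 * C)\<^sup>2 * (norm (Du x))\<^sup>2"])
    show "AE x in ?M. (\<lambda>k. (d k x)\<^sup>2) \<longlonglongrightarrow> 0"
      using vae
    proof eventually_elim
      fix x assume "(\<lambda>k. v k x) \<longlonglongrightarrow> u x"
      then have "(\<lambda>k. f' (v k x)) \<longlonglongrightarrow> f' (u x)"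
        by (intro continuous_on_tendsto_compose[OF f']) auto
      then have "(\<lambda>k. (\<bar>f' (v k x) - f' (u x)\<bar> * norm (Du x))\<^sup>2) \<longlonglongrightarrow> (\<bar>f' (u x) - f' (u x)\<bar> * norm (Du x))\<^sup>2"
        by (intro tendsto_intros)
      then show "(\<lambda>k. (d k x)\<^sup>2) \<longlonglongrightarrow> 0" by (simp add: d_def)
    qed
  qed (use U(4) db in auto)
  then have dlim: "(\<lambda>k. \<integral>x. (d k x)\<^sup>2 \<partial>?M) \<longlonglongrightarrow> 0" by simp
  \<comment> \<open>One factor for all error terms: B bounds \<open>\<phi>\<close> and its gradient,
    1 + C bounds the approximating derivatives and the Lipschitz constant of f.\<close>
  define K where "K = B * (1 + C)"
  have K: "K \<ge> 0" using B C0 by (simp add: K_def)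
  \<comment> \<open>A common majorant for the squared errors of the functions and of their
    gradients. The factor 16 = 2^4 comes from splitting a square of five summands by four uses of
    \<open>power2_add_le\<close>.\<close>
  define G where "G k x = 16 * K\<^sup>2 * ((norm (grad (v k) x - Du x))\<^sup>2 + (e k)\<^sup>2 * (norm (Du x))\<^sup>2 + (d k x)\<^sup>2 + (e k)\<^sup>2 + (v k x - u x)\<^sup>2)" for k x
  have Gi: "integrable ?M (G k)" for k
    unfolding G_def[abs_def] using vi dint U(4) by (intro integrable_mult_right Bochner_Integration.integrable_add) auto
  have "(\<lambda>k. 16 * K\<^sup>2 * ((\<integral>x. (norm (grad (v k) x - Du x))\<^sup>2 \<partial>?M) + (e k)\<^sup>2 * (\<integral>x. (norm (Du x))\<^sup>2 \<partial>?M)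
     + (\<integral>x. (d k x)\<^sup>2 \<partial>?M) + (e k)\<^sup>2 * measure ?M (space ?M) + (\<integral>x. (v k x - u x)\<^sup>2 \<partial>?M)))
     \<longlonglongrightarrow> 16 * K\<^sup>2 * (0 + 0\<^sup>2 * (\<integral>x. (norm (Du x))\<^sup>2 \<partial>?M) + 0 + 0\<^sup>2 * measure ?M (space ?M) + 0)"
    by (intro tendsto_intros vlim dlim elim)
  also have "(\<lambda>k. 16 * K\<^sup>2 * ((\<integral>x. (norm (grad (v k) x - Du x))\<^sup>2 \<partial>?M) + (e k)\<^sup>2 * (\<integral>x. (norm (Du x))\<^sup>2 \<partial>?M)
     + (\<integral>x. (d k x)\<^sup>2 \<partial>?M) + (e k)\<^sup>2 * measure ?M (space ?M) + (\<integral>x. (v k x - u x)\<^sup>2 \<partial>?M)))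
     = (\<lambda>k. integral\<^sup>L ?M (G k))"
    unfolding G_def[abs_def] using vi dint U(4) by (simp add: Bochner_Integration.integrable_add mult.commute)
  finally have Glim: "(\<lambda>k. integral\<^sup>L ?M (G k)) \<longlonglongrightarrow> 0" by simp
  have five: "(K * (x1 + x2 + x3 + x4 + x5))\<^sup>2 \<le> 16 * K\<^sup>2 * (x1\<^sup>2 + x2\<^sup>2 + x3\<^sup>2 + x4\<^sup>2 + x5\<^sup>2)" for x1 x2 x3 x4 x5 :: real
  proof -
    have "(x1 + x2 + x3 + x4 + x5)\<^sup>2 \<le> 16 * (x1\<^sup>2 + x2\<^sup>2 + x3\<^sup>2 + x4\<^sup>2 + x5\<^sup>2)"
    proof -
      have chain: "a \<le> 16 * (s1 + s2 + s3 + s4 + s5)"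
        if "a \<le> 2 * b + 2 * s5" "b \<le> 2 * c + 2 * s4" "c \<le> 2 * d + 2 * s3" "d \<le> 2 * s1 + 2 * s2"
          "s1 \<ge> 0" "s2 \<ge> 0" "s3 \<ge> 0" "s4 \<ge> 0" "s5 \<ge> 0" for a b c d s1 s2 s3 s4 s5 :: real
      proof -
        have "c \<le> 4 * s1 + 4 * s2 + 2 * s3" using that by linarith
        then have "b \<le> 8 * s1 + 8 * s2 + 4 * s3 + 2 * s4" using that by linarith
        then have "a \<le> 16 * s1 + 16 * s2 + 8 * s3 + 4 * s4 + 2 * s5" using that by linarith
        then show ?thesis using that(5-) by (simp add: distrib_left)
      qed
      show ?thesis
        by (rule chain[OF power2_add_le power2_add_le power2_add_le power2_add_le]) simp_all
    qed
    then have "K\<^sup>2 * (x1 + x2 + x3 + x4 + x5)\<^sup>2 \<le> K\<^sup>2 * (16 * (x1\<^sup>2 + x2\<^sup>2 + x3\<^sup>2 + x4\<^sup>2 + x5\<^sup>2))"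
      by (intro mult_left_mono) auto
    then show ?thesis by (simp add: power_mult_distrib mult_ac)
  qed
  have wz: "\<bar>w k x - z x\<bar> \<le> K * (e k + \<bar>v k x - u x\<bar>)" for k x
  proof -
    have "\<bar>w k x - z x\<bar> = \<bar>p k x - f (u x)\<bar> * \<bar>\<phi> x\<bar>"
      by (simp add: w_def z_def flip: left_diff_distrib abs_mult)
    also have "\<dots> \<le> (e k + C * \<bar>v k x - u x\<bar>) * B"
      using fe[of k x] B(2)[of x] e(1)[of k] C0 by (intro mult_mono) (auto intro: add_nonneg_nonneg less_imp_le)
    also have "\<dots> \<le> ((1 + C) * e k + (1 + C) * \<bar>v k x - u x\<bar>) * B"
      using B C0 e(1)[of k] by (intro mult_right_mono add_mono) (auto simp: distrib_right)
    finally show ?thesis by (simp add: K_def algebra_simps)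
  qed
  have gz: "norm (grad (w k) x - Dz x) \<le> K * (norm (grad (v k) x - Du x) + e k * norm (Du x) + d k x + e k + \<bar>v k x - u x\<bar>)" for k x
  proof -
    let ?b = "norm (grad (v k) x - Du x)"
    have "grad (w k) x - Dz x = \<phi> x *\<^sub>R (p' k x *\<^sub>R grad (v k) x - f' (u x) *\<^sub>R Du x) + (p k x - f (u x)) *\<^sub>R grad \<phi> x"
      by (simp add: wg Dz_def algebra_simps)
    also have "norm \<dots> \<le> \<bar>\<phi> x\<bar> * norm (p' k x *\<^sub>R grad (v k) x - f' (u x) *\<^sub>R Du x) + \<bar>p k x - f (u x)\<bar> * norm (grad \<phi> x)"
      by (metis norm_scaleR norm_triangle_ineq)
    also have "\<dots> \<le> B * norm (p' k x *\<^sub>R grad (v k) x - f' (u x) *\<^sub>R Du x) + (e k + C * \<bar>v k x - u x\<bar>) * B"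
      using fe[of k x] B(2,3)[of x] e(1)[of k] C0
      by (intro add_mono mult_mono) (auto intro: add_nonneg_nonneg less_imp_le)
    also have "norm (p' k x *\<^sub>R grad (v k) x - f' (u x) *\<^sub>R Du x) \<le> (e k + C) * ?b + e k * norm (Du x) + d k x"
    proof -
      have "p' k x *\<^sub>R grad (v k) x - f' (u x) *\<^sub>R Du x
         = p' k x *\<^sub>R (grad (v k) x - Du x) + (p' k x - f' (v k x)) *\<^sub>R Du x + (f' (v k x) - f' (u x)) *\<^sub>R Du x"
        by (simp add: algebra_simps)
      also have "norm \<dots> \<le> \<bar>p' k x\<bar> * ?b + \<bar>p' k x - f' (v k x)\<bar> * norm (Du x) + \<bar>f' (v k x) - f' (u x)\<bar> * norm (Du x)"
        by (intro norm_triangle_le add_mono) auto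
      also have "\<dots> \<le> (e k + C) * ?b + e k * norm (Du x) + d k x"
        using pe(2)[of k x] C(2)[of "v k x"] unfolding d_def
        by (intro add_mono mult_right_mono) auto
      finally show ?thesis .
    qed
    also have "(e k + C) * ?b \<le> (1 + C) * ?b"
      using e(2)[of k] by (intro mult_right_mono) auto
    finally have "norm (grad (w k) x - Dz x) \<le> B * ((1 + C) * ?b + e k * norm (Du x) + d k x) + (e k + C * \<bar>v k x - u x\<bar>) * B"
      using B(1) by simp
    also have "\<dots> \<le> B * ((1 + C) * ?b + (1 + C) * (e k * norm (Du x)) + (1 + C) * d k x) + ((1 + C) * e k + (1 + C) * \<bar>v k x - u x\<bar>) * B"
    proof -
      have "t \<le> (1 + C) * t" "C * t \<le> (1 + C) * t" if "t \<ge> 0" for t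
        using that C0 by (auto simp: distrib_right)
      moreover have "d k x \<ge> 0" "e k * norm (Du x) \<ge> 0" using e(1)[of k] by (auto simp: d_def)
      ultimately show ?thesis
        using B(1) e(1)[of k] by (intro add_mono mult_left_mono mult_right_mono order_refl) (auto simp: less_imp_le)
    qed
    also have "\<dots> = K * (?b + e k * norm (Du x) + d k x + e k + \<bar>v k x - u x\<bar>)"
      by (simp add: K_def algebra_simps)
    finally show ?thesis .
  qed
  have wz2: "(w k x - z x)\<^sup>2 \<le> G k x" for k x
  proof -
    have "(w k x - z x)\<^sup>2 \<le> (K * (0 + 0 + 0 + e k + \<bar>v k x - u x\<bar>))\<^sup>2"
      using power_mono[OF wz[of k x], of 2] by simp
    also have "\<dots> \<le> G k x"
      unfolding G_def
      by (rule order_trans[OF five]) (intro mult_left_mono, auto)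
    finally show ?thesis .
  qed
  have gz2: "(norm (grad (w k) x - Dz x))\<^sup>2 \<le> G k x" for k x
  proof -
    have "(norm (grad (w k) x - Dz x))\<^sup>2 \<le> (K * (norm (grad (v k) x - Du x) + e k * norm (Du x) + d k x + e k + \<bar>v k x - u x\<bar>))\<^sup>2"
      using gz[of k x] by (intro power_mono) auto
    also have "\<dots> \<le> G k x"
      unfolding G_def by (rule order_trans[OF five]) (simp add: power_mult_distrib)
    finally show ?thesis .
  qed
  have G0: "0 \<le> G k x" for k x by (rule order_trans[OF zero_le_power2 wz2])
  have "W01p \<Omega> 2 z Dz"
  proof (rule W01p_limitI[OF \<Omega> _ _ z2 Dz2 w])
    show "(\<lambda>k. \<integral>x. (w k x - z x)\<^sup>2 \<partial>?M) \<longlonglongrightarrow> 0"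
      by (rule tendsto_sandwich[OF _ _ tendsto_const Glim])
         (auto intro!: always_eventually integral_mono' Gi wz2 G0)
    show "(\<lambda>k. \<integral>x. (norm (grad (w k) x - Dz x))\<^sup>2 \<partial>?M) \<longlonglongrightarrow> 0"
      by (rule tendsto_sandwich[OF _ _ tendsto_const Glim])
         (auto intro!: always_eventually integral_mono' Gi gz2 G0)
  qed auto
  then show ?thesis by (simp add: z_def[abs_def] Dz_def[abs_def])
qed

subsection \<open>Caratheodory functions and growth of the derivative\<close>

text \<open>For Y of finite range the composition is measurable piece by piece; a general Y is a
  pointwise limit of simple functions, and continuity in the second argument carries the limit
  through.\<close>

lemma Caratheodory_measurable:
  fixes g :: "'a \<Rightarrow> 'b::{metric_space, second_countable_topology} \<Rightarrow> real"
  assumes g: "\<And>y. (\<lambda>x. g x y) \<in> borel_measurable M"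
    and cont: "\<And>x. x \<in> space M \<Longrightarrow> continuous_on UNIV (g x)"
    and Y: "Y \<in> borel_measurable M"
  shows "(\<lambda>x. g x (Y x)) \<in> borel_measurable M"
proof -
  obtain F where F: "\<And>i. simple_function M (F i)" "\<And>x. x \<in> space M \<Longrightarrow> (\<lambda>i. F i x) \<longlonglongrightarrow> Y x"
    using borel_measurable_implies_sequence_metric[OF Y] by blast
  show ?thesis
  proof (rule borel_measurable_LIMSEQ_real)
    show "(\<lambda>x. g x (F i x)) \<in> borel_measurable M" for i
    proof (rule measurable_compose_countable'[where I="F i ` space M" and f="\<lambda>y x. g x y"])
      show "F i \<in> measurable M (count_space (F i ` space M))"
        using F(1)[of i] by (auto simp: simple_function_def measurable_count_space_eq2)
      show "countable (F i ` space M)"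
        using F(1)[of i] by (auto simp: simple_function_def intro: countable_finite)
    qed (rule g)
    show "(\<lambda>i. g x (F i x)) \<longlonglongrightarrow> g x (Y x)" if "x \<in> space M" for x
      by (rule continuous_on_tendsto_compose[OF cont[OF that] F(2)[OF that]]) auto
  qed
qed

text \<open>Measurability is assumed for g only. A directional derivative is a pointwise limit of
  difference quotients, each of which is a measurable composition.\<close>

lemma Caratheodory_derivative_measurable:
  fixes g :: "'a \<Rightarrow> 'b::euclidean_space \<Rightarrow> real" and g' :: "'a \<Rightarrow> 'b \<Rightarrow> 'b \<Rightarrow> real"
  assumes g: "\<And>y. (\<lambda>x. g x y) \<in> borel_measurable M"
    and deriv: "\<And>x y. x \<in> space M \<Longrightarrow> (g x has_derivative g' x y) (at y)"
    and Y[measurable]: "Y \<in> borel_measurable M"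
  shows "(\<lambda>x. g' x (Y x) b) \<in> borel_measurable M"
proof (rule borel_measurable_LIMSEQ_real)
  have cont: "continuous_on UNIV (g x)" if "x \<in> space M" for x
    using deriv[OF that] by (meson continuous_at_imp_continuous_on has_derivative_continuous)
  have [measurable]: "(\<lambda>x. g x (Z x)) \<in> borel_measurable M" if "Z \<in> borel_measurable M" for Z
    using g cont that by (rule Caratheodory_measurable)
  show "(\<lambda>x. (g x (Y x + (1 / real (Suc n)) *\<^sub>R b) - g x (Y x)) / (1 / real (Suc n))) \<in> borel_measurable M" for n
    by measurable
  fix x assume x: "x \<in> space M"
  interpret bounded_linear "g' x (Y x)" using deriv[OF x] by (rule has_derivative_bounded_linear)
  have "((\<lambda>t. g x (Y x + t *\<^sub>R b)) has_derivative (\<lambda>t. g' x (Y x) (t *\<^sub>R b))) (at 0)"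
    by (rule has_derivative_compose[where f="\<lambda>t. Y x + t *\<^sub>R b" and g="g x", of "\<lambda>t. t *\<^sub>R b"])
       (auto intro!: derivative_eq_intros deriv[OF x])
  then have "((\<lambda>t. g x (Y x + t *\<^sub>R b)) has_real_derivative g' x (Y x) b) (at 0)"
    by (simp add: has_field_derivative_def scaleR mult_commute_abs)
  then have "((\<lambda>t. (g x (Y x + t *\<^sub>R b) - g x (Y x)) / t) \<longlongrightarrow> g' x (Y x) b) (at 0)"
    by (simp add: has_field_derivative_iff)
  moreover have "filterlim (\<lambda>n. 1 / real (Suc n)) (at 0) sequentially"
    using LIMSEQ_Suc[OF lim_1_over_n[where 'a=real]] by (auto simp: filterlim_at)
  ultimately show "(\<lambda>n. (g x (Y x + (1 / real (Suc n)) *\<^sub>R b) - g x (Y x)) / (1 / real (Suc n))) \<longlonglongrightarrow> g' x (Y x) b"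
    by (rule filterlim_compose)
qed

text \<open>Convexity bounds the difference quotients along \<open>\<eta>\<close> for 0 < t < 1 by
  the increment at t = 1; then t tends to 0 from the right. The direction 0 is separate because
  strict convexity compares distinct points.\<close>

lemma strictly_convex_above_tangent:
  fixes J :: "'a::euclidean_space \<Rightarrow> real"
  assumes J: "strictly_convex_fun J" and D: "(J has_derivative (\<lambda>b. D \<bullet> b)) (at \<xi>)"
  shows "J \<xi> + D \<bullet> \<eta> \<le> J (\<xi> + \<eta>)"
proof (cases "\<eta> = 0")
  case False
  have "((\<lambda>t. J (\<xi> + t *\<^sub>R \<eta>)) has_derivative (\<lambda>t. D \<bullet> (t *\<^sub>R \<eta>))) (at 0)"
    by (rule has_derivative_compose[where f="\<lambda>t. \<xi> + t *\<^sub>R \<eta>" and g=J, of "\<lambda>t. t *\<^sub>R \<eta>"])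
       (auto intro!: derivative_eq_intros D)
  then have "((\<lambda>t. J (\<xi> + t *\<^sub>R \<eta>)) has_real_derivative D \<bullet> \<eta>) (at 0)"
    by (simp add: has_field_derivative_def mult_commute_abs)
  then have "((\<lambda>t. (J (\<xi> + t *\<^sub>R \<eta>) - J \<xi>) / t) \<longlongrightarrow> D \<bullet> \<eta>) (at_right 0)"
    by (simp add: has_field_derivative_iff filterlim_at_split)
  moreover have "\<forall>\<^sub>F t in at_right 0. (J (\<xi> + t *\<^sub>R \<eta>) - J \<xi>) / t \<le> J (\<xi> + \<eta>) - J \<xi>"
    using eventually_at_right_real[OF zero_less_one]
  proof eventually_elim
    case (elim t)
    then have t: "0 < t" "t < 1" by auto
    have "(1 - t) *\<^sub>R \<xi> + t *\<^sub>R (\<xi> + \<eta>) = \<xi> + t *\<^sub>R \<eta>" by (simp add: algebra_simps)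
    then have "J (\<xi> + t *\<^sub>R \<eta>) < (1 - t) * J \<xi> + t * J (\<xi> + \<eta>)"
      using J t False unfolding strictly_convex_fun_def by (metis add_cancel_left_right)
    then show ?case unfolding pos_divide_le_eq[OF t(1)] by (simp add: algebra_simps)
  qed
  ultimately have "D \<bullet> \<eta> \<le> J (\<xi> + \<eta>) - J \<xi>"
    by (rule tendsto_upperbound) simp
  then show ?thesis by simp
qed simp

text \<open>The growth of a convex function controls its slope: a tangent steeper than this would
  exceed the quadratic bound when followed in the direction of D. It provides the linear growth of
  the flux, with the factor 4.\<close>

lemma convex_quadratic_growth_derivative_bound:
  fixes J :: "'a::euclidean_space \<Rightarrow> real"
  assumes "strictly_convex_fun J" "(J has_derivative (\<lambda>b. D \<bullet> b)) (at \<xi>)"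
    and A: "A > 0" and J: "\<And>\<eta>. 0 \<le> J \<eta>" "\<And>\<eta>. J \<eta> \<le> A * (norm \<eta>)\<^sup>2"
  shows "norm D \<le> 4 * A * norm \<xi>"
proof -
  \<comment> \<open>With this step length the term 2 A t^2 |D|^2 on the right equals t |D|^2 / 2,
    half of the left side, and is absorbed.\<close>
  define t where "t = 1 / (4 * A)"
  have t: "t > 0" "A * t = 1 / 4" using A by (auto simp: t_def)
  have "J \<xi> + D \<bullet> (t *\<^sub>R D) \<le> J (\<xi> + t *\<^sub>R D)"
    by (rule strictly_convex_above_tangent[OF assms(1,2)])
  then have "t * (norm D)\<^sup>2 \<le> A * (norm (\<xi> + t *\<^sub>R D))\<^sup>2"
    using J(1)[of \<xi>] J(2)[of "\<xi> + t *\<^sub>R D"] by (simp add: power2_norm_eq_inner)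
  also have "\<dots> \<le> A * (norm \<xi> + t * norm D)\<^sup>2"
    using A t norm_triangle_ineq[of \<xi> "t *\<^sub>R D"] by (intro mult_left_mono power_mono) auto
  also have "\<dots> \<le> A * (2 * (norm \<xi>)\<^sup>2 + 2 * (t * norm D)\<^sup>2)"
    using A power2_add_le by (intro mult_left_mono) auto
  also have "\<dots> = 2 * A * (norm \<xi>)\<^sup>2 + t * (norm D)\<^sup>2 / 2"
  proof -
    have "A * (2 * (t * norm D)\<^sup>2) = 2 * (A * t) * t * (norm D)\<^sup>2" by (simp add: power2_eq_square)
    then show ?thesis using t(2) by (simp add: distrib_left)
  qed
  finally have "t * (norm D)\<^sup>2 \<le> 4 * A * (norm \<xi>)\<^sup>2" by simp
  then have "(norm D)\<^sup>2 \<le> (4 * A * norm \<xi>)\<^sup>2"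
    using A by (simp add: t_def field_simps power2_eq_square)
  then show ?thesis by (rule power2_le_imp_le) (use A in simp)
qed

section \<open>Integrability by Fatou's lemma and a weighted Hoelder estimate\<close>

lemma Fatou_integrable:
  fixes f :: "nat \<Rightarrow> 'a \<Rightarrow> real"
  assumes f: "\<And>n. integrable M (f n)" "\<And>n x. x \<in> space M \<Longrightarrow> 0 \<le> f n x" "\<And>n. integral\<^sup>L M (f n) \<le> K"
    and lim: "\<And>x. x \<in> space M \<Longrightarrow> (\<lambda>n. f n x) \<longlonglongrightarrow> g x"
  shows "integrable M g"
proof (rule integrableI_bounded)
  show [measurable]: "g \<in> borel_measurable M"
    by (rule borel_measurable_LIMSEQ_real[OF lim]) (use f(1) in auto)
  have g0: "0 \<le> g x" if "x \<in> space M" for x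
    by (rule LIMSEQ_le_const[OF lim[OF that]]) (use f(2)[OF that] in auto)
  have [measurable]: "f n \<in> borel_measurable M" for n using f(1) by auto
  have "(\<integral>\<^sup>+x. norm (g x) \<partial>M) = (\<integral>\<^sup>+x. liminf (\<lambda>n. ennreal (f n x)) \<partial>M)"
  proof (rule nn_integral_cong)
    fix x assume x: "x \<in> space M"
    have "(\<lambda>n. ennreal (f n x)) \<longlonglongrightarrow> ennreal (g x)" by (intro tendsto_intros lim x)
    then show "ennreal (norm (g x)) = liminf (\<lambda>n. ennreal (f n x))"
      using g0[OF x] by (simp add: lim_imp_Liminf)
  qed
  also have "\<dots> \<le> liminf (\<lambda>n. \<integral>\<^sup>+x. ennreal (f n x) \<partial>M)"
    by (rule nn_integral_liminf) simp
  also have "\<dots> \<le> liminf (\<lambda>n::nat. ennreal K)"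
  proof (intro Liminf_mono always_eventually allI)
    show "(\<integral>\<^sup>+x. ennreal (f n x) \<partial>M) \<le> ennreal K" for n
      using f(2) by (subst nn_integral_eq_integral[OF f(1)]) (auto intro: ennreal_leI f(3))
  qed
  also have "\<dots> < \<infinity>" by (simp add: Liminf_const)
  finally show "(\<integral>\<^sup>+x. ennreal (norm (g x)) \<partial>M) < \<infinity>" .
qed

text \<open>Hoelder's inequality for f^2 and g^2 with the conjugate exponents p / (p - 2) and p / 2.
  It separates a bounded factor, which will tend to 0, from gradients known only to be bounded in
  L^p.\<close>

lemma Holder_square_mult:
  fixes f g :: "'a \<Rightarrow> real"
  assumes M: "finite_measure M" and p: "p > 2"
    and [measurable]: "f \<in> borel_measurable M" "g \<in> borel_measurable M"
    and f: "\<And>x. \<bar>f x\<bar> \<le> C" and g: "integrable M (\<lambda>x. \<bar>g x\<bar> powr p)"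
  shows "integrable M (\<lambda>x. (f x * g x)\<^sup>2)"
    and "(\<integral>x. (f x * g x)\<^sup>2 \<partial>M)
      \<le> (\<integral>x. (f x)\<^sup>2 powr (p / (p - 2)) \<partial>M) powr ((p - 2) / p) * ((\<integral>x. \<bar>g x\<bar> powr p \<partial>M) powr (1 / p))\<^sup>2"
proof -
  have fb: "(f x)\<^sup>2 powr (p / (p - 2)) \<le> C\<^sup>2 powr (p / (p - 2))" for x
    using f[of x] p power_mono[of "\<bar>f x\<bar>" C 2] by (intro powr_mono2) auto
  have fi: "integrable M (\<lambda>x. \<bar>(f x)\<^sup>2\<bar> powr (p / (p - 2)))"
    using fb by (intro finite_measure.integrable_const_bound[OF M, where B="C\<^sup>2 powr (p / (p - 2))"]) auto
  have ge: "(g x)\<^sup>2 powr (p / 2) = \<bar>g x\<bar> powr p" for x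
  proof -
    have "(g x)\<^sup>2 = \<bar>g x\<bar> powr 2" by simp
    then show ?thesis by (simp only: powr_powr) simp
  qed
  note H = Holder_inequality[of "p / (p - 2)" "p / 2" "\<lambda>x. (f x)\<^sup>2" M "\<lambda>x. (g x)\<^sup>2"]
  have pp: "p / (p - 2) > 1" "p / 2 > 1" "1 / (p / (p - 2)) + 1 / (p / 2) = 1"
    using p by (auto simp: field_simps)
  show "integrable M (\<lambda>x. (f x * g x)\<^sup>2)"
    using H(1)[OF pp _ _ fi] g by (simp add: ge power_mult_distrib)
  have "(\<integral>x. \<bar>(f x)\<^sup>2 * (g x)\<^sup>2\<bar> \<partial>M)
      \<le> (\<integral>x. \<bar>(f x)\<^sup>2\<bar> powr (p / (p - 2)) \<partial>M) powr (1 / (p / (p - 2))) * (\<integral>x. \<bar>(g x)\<^sup>2\<bar> powr (p / 2) \<partial>M) powr (1 / (p / 2))"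
    by (rule H(2)[OF pp _ _ fi]) (use g in \<open>auto simp: ge\<close>)
  moreover have "(\<integral>x. \<bar>g x\<bar> powr p \<partial>M) powr (2 / p) = ((\<integral>x. \<bar>g x\<bar> powr p \<partial>M) powr (1 / p))\<^sup>2"
    by (simp add: power2_eq_square flip: powr_add)
  ultimately show "(\<integral>x. (f x * g x)\<^sup>2 \<partial>M)
      \<le> (\<integral>x. (f x)\<^sup>2 powr (p / (p - 2)) \<partial>M) powr ((p - 2) / p) * ((\<integral>x. \<bar>g x\<bar> powr p \<partial>M) powr (1 / p))\<^sup>2"
    by (simp add: power_mult_distrib ge)
qed

subsection \<open>Weak solutions\<close>

text \<open>Along a solution only \<open>F = j\<^sub>\<xi>(x,u,\<nabla>u)\<close> and \<open>b = j\<^sub>s(x,u,\<nabla>u)\<close> matter; the integrand \<open>j\<close> enters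
  through the growth bounds and the sign condition on them.\<close>
locale weak_solution =
  fixes \<Omega> :: "(real^'n) set" and u :: "real^'n \<Rightarrow> real" and Du F :: "real^'n \<Rightarrow> real^'n"
    and b :: "real^'n \<Rightarrow> real" and \<alpha> \<beta> :: "real \<Rightarrow> real" and R :: real
    and w :: "(real^'n \<Rightarrow> real) \<Rightarrow> real"
  assumes \<Omega>: "open \<Omega>" "bounded \<Omega>"
    and F_meas[measurable]: "F \<in> borel_measurable (lebesgue_on \<Omega>)"
    and b_meas[measurable]: "b \<in> borel_measurable (lebesgue_on \<Omega>)"
    and F_bound: "\<And>x k. x \<in> \<Omega> \<Longrightarrow> \<bar>u x\<bar> \<le> k \<Longrightarrow> norm (F x) \<le> \<alpha> k * norm (Du x)"
    and b_bound: "\<And>x k. x \<in> \<Omega> \<Longrightarrow> \<bar>u x\<bar> \<le> k \<Longrightarrow> \<bar>b x\<bar> \<le> \<beta> k * (norm (Du x))\<^sup>2"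
    and \<alpha>_nonneg: "\<And>k. k \<ge> 0 \<Longrightarrow> \<alpha> k \<ge> 0" and \<beta>_nonneg: "\<And>k. k \<ge> 0 \<Longrightarrow> \<beta> k \<ge> 0"
    and R_pos: "R > 0"
    and b_sign: "\<And>x. x \<in> \<Omega> \<Longrightarrow> \<bar>u x\<bar> \<ge> R \<Longrightarrow> b x * u x \<ge> 0"
    and w_Hm1: "in_Hm1 \<Omega> w"
    and u_W01p: "W01p \<Omega> 2 u Du"
    and weak_eq: "\<And>z Dz. W01p \<Omega> 2 z Dz \<Longrightarrow>
               (\<exists>M. AE x in lebesgue_on \<Omega>. \<bar>z x\<bar> \<le> M) \<Longrightarrow>
               (\<exists>M. AE x in lebesgue_on \<Omega>. z x \<noteq> 0 \<longrightarrow> \<bar>u x\<bar> \<le> M) \<Longrightarrow>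
               (\<integral>x. F x \<bullet> Dz x \<partial>lebesgue_on \<Omega>) + (\<integral>x. b x * z x \<partial>lebesgue_on \<Omega>) = w z"
    and FDu_integrable: "integrable (lebesgue_on \<Omega>) (\<lambda>x. F x \<bullet> Du x)"
begin

abbreviation "M \<equiv> lebesgue_on \<Omega>"

sublocale finite_measure M
  using \<Omega> by (rule finite_measure_lebesgue_on_bounded)

lemma finite: "finite_measure M" by unfold_locales

lemmas u_facts = W1p_2D[OF \<Omega>(1) conjunct1[OF u_W01p[unfolded W01p_def]]]

declare u_facts(1,2)[measurable]

lemma Du_integrable: "integrable M (\<lambda>x. norm (Du x))"
  by (rule integrable_of_square[OF finite _ u_facts(4)]) simp

text \<open>Some continuity constant of w on H_0^1, not the least one. The absolute value makes it
  nonnegative, so that it may multiply upper bounds.\<close>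

definition "w_norm = \<bar>SOME C. \<forall>z g. W01p \<Omega> 2 z g \<longrightarrow> \<bar>w z\<bar> \<le> C * W1_norm \<Omega> 2 z g\<bar>"

lemma W1_norm_nonneg: "W1_norm \<Omega> p z g \<ge> 0"
  by (simp add: W1_norm_def Lp_norm_nonneg)

lemma w_norm_nonneg: "w_norm \<ge> 0"
  by (simp add: w_norm_def)

lemma w_bound:
  assumes "W01p \<Omega> 2 z g"
  shows "\<bar>w z\<bar> \<le> w_norm * (sqrt (\<integral>x. (z x)\<^sup>2 \<partial>M) + sqrt (\<integral>x. (norm (g x))\<^sup>2 \<partial>M))"
proof -
  have "\<exists>C. \<forall>z g. W01p \<Omega> 2 z g \<longrightarrow> \<bar>w z\<bar> \<le> C * W1_norm \<Omega> 2 z g"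
    using w_Hm1 by (simp add: in_Hm1_def)
  from someI_ex[OF this] assms
  have "\<bar>w z\<bar> \<le> (SOME C. \<forall>z g. W01p \<Omega> 2 z g \<longrightarrow> \<bar>w z\<bar> \<le> C * W1_norm \<Omega> 2 z g) * W1_norm \<Omega> 2 z g"
    by blast
  also have "\<dots> \<le> w_norm * W1_norm \<Omega> 2 z g"
    unfolding w_norm_def by (intro mult_right_mono W1_norm_nonneg) simp
  finally show ?thesis by (simp add: W1_norm_def Lp_norm_2)
qed

lemma w_linear:
  "W01p \<Omega> 2 z1 g1 \<Longrightarrow> W01p \<Omega> 2 z2 g2 \<Longrightarrow> w (\<lambda>x. c * z1 x + d * z2 x) = c * w z1 + d * w z2"
  using w_Hm1 unfolding in_Hm1_def by blast

text \<open>Where \<open>f (u x)\<close> is nonzero, |u| is at most k, so the growth functions can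
  be frozen there. They are evaluated at |k| because k may be negative when f vanishes identically,
  while \<open>\<alpha>\<close> and \<open>\<beta>\<close> are controlled on nonnegative arguments
  only.\<close>

lemma truncated_flux:
  assumes f: "f \<in> borel_measurable borel" "\<And>s. \<bar>f s\<bar> \<le> C" "\<And>s. f s \<noteq> 0 \<Longrightarrow> \<bar>s\<bar> \<le> k"
  shows "(\<lambda>x. f (u x) *\<^sub>R F x) \<in> borel_measurable M"
    and "\<And>x. x \<in> \<Omega> \<Longrightarrow> norm (f (u x) *\<^sub>R F x) \<le> C * \<alpha> \<bar>k\<bar> * norm (Du x)"
    and "\<And>x. x \<in> \<Omega> \<Longrightarrow> \<bar>b x * f (u x)\<bar> \<le> C * \<beta> \<bar>k\<bar> * (norm (Du x))\<^sup>2"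
proof -
  note f(1)[measurable]
  show "(\<lambda>x. f (u x) *\<^sub>R F x) \<in> borel_measurable M" by measurable
  have C: "C \<ge> 0" using f(2)[of 0] by linarith
  fix x assume x: "x \<in> \<Omega>"
  show "norm (f (u x) *\<^sub>R F x) \<le> C * \<alpha> \<bar>k\<bar> * norm (Du x)"
  proof (cases "f (u x) = 0")
    case False
    then have "\<bar>u x\<bar> \<le> \<bar>k\<bar>" using f(3)[of "u x"] by linarith
    then have "norm (F x) \<le> \<alpha> \<bar>k\<bar> * norm (Du x)" using F_bound[OF x] by blast
    then have "\<bar>f (u x)\<bar> * norm (F x) \<le> C * (\<alpha> \<bar>k\<bar> * norm (Du x))"
      using f(2) C by (intro mult_mono) auto
    then show ?thesis by (simp add: mult.assoc)
  qed (use C \<alpha>_nonneg in auto)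
  show "\<bar>b x * f (u x)\<bar> \<le> C * \<beta> \<bar>k\<bar> * (norm (Du x))\<^sup>2"
  proof (cases "f (u x) = 0")
    case False
    then have "\<bar>u x\<bar> \<le> \<bar>k\<bar>" using f(3)[of "u x"] by linarith
    then have "\<bar>b x\<bar> \<le> \<beta> \<bar>k\<bar> * (norm (Du x))\<^sup>2" using b_bound[OF x] by blast
    then have "\<bar>f (u x)\<bar> * \<bar>b x\<bar> \<le> C * (\<beta> \<bar>k\<bar> * (norm (Du x))\<^sup>2)"
      using f(2) C by (intro mult_mono) auto
    then show ?thesis by (simp add: abs_mult mult_ac)
  qed (use C \<beta>_nonneg in auto)
qed

lemma truncated_reaction_integrable:
  assumes f: "f \<in> borel_measurable borel" "\<And>s. \<bar>f s\<bar> \<le> C" "\<And>s. f s \<noteq> 0 \<Longrightarrow> \<bar>s\<bar> \<le> k"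
  shows "integrable M (\<lambda>x. b x * f (u x))"
proof (rule Bochner_Integration.integrable_bound)
  note f(1)[measurable]
  show "integrable M (\<lambda>x. C * \<beta> \<bar>k\<bar> * (norm (Du x))\<^sup>2)" using u_facts(4) by simp
  show "AE x in M. norm (b x * f (u x)) \<le> norm (C * \<beta> \<bar>k\<bar> * (norm (Du x))\<^sup>2)"
    using truncated_flux(3)[OF f] by (intro AE_I2) (simp, meson abs_ge_self order_trans)
  show "(\<lambda>x. b x * f (u x)) \<in> borel_measurable M" by measurable
qed

lemma truncated_flux_integrable:
  assumes f: "f \<in> borel_measurable borel" "\<And>s. \<bar>f s\<bar> \<le> C" "\<And>s. f s \<noteq> 0 \<Longrightarrow> \<bar>s\<bar> \<le> k"
    and g: "g \<in> borel_measurable M" "\<And>x. norm (g x) \<le> B"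
  shows "integrable M (\<lambda>x. (f (u x) *\<^sub>R F x) \<bullet> g x)"
proof (rule Bochner_Integration.integrable_bound)
  note truncated_flux(1)[OF f, measurable] g(1)[measurable]
  show "integrable M (\<lambda>x. C * \<alpha> \<bar>k\<bar> * norm (Du x) * B)" using Du_integrable by simp
  show "AE x in M. norm ((f (u x) *\<^sub>R F x) \<bullet> g x) \<le> norm (C * \<alpha> \<bar>k\<bar> * norm (Du x) * B)"
  proof (rule AE_I2)
    fix x assume "x \<in> space M"
    then have x: "x \<in> \<Omega>" by simp
    have "\<bar>(f (u x) *\<^sub>R F x) \<bullet> g x\<bar> \<le> norm (f (u x) *\<^sub>R F x) * norm (g x)"
      by (rule Cauchy_Schwarz_ineq2)
    also have "\<dots> \<le> C * \<alpha> \<bar>k\<bar> * norm (Du x) * B"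
      using order_trans[OF norm_ge_zero truncated_flux(2)[OF f x]]
      by (intro mult_mono truncated_flux(2)[OF f x] g(2)) auto
    finally show "norm ((f (u x) *\<^sub>R F x) \<bullet> g x) \<le> norm (C * \<alpha> \<bar>k\<bar> * norm (Du x) * B)"
      by simp
  qed
  show "(\<lambda>x. (f (u x) *\<^sub>R F x) \<bullet> g x) \<in> borel_measurable M" by measurable
qed

text \<open>The bounded support of f keeps |u| below k wherever the test function is nonzero, so it
  is admissible. The flux term may be split because each part is integrable: F . Du by hypothesis,
  and F . grad \<open>\<phi>\<close> after multiplication by \<open>f (u x)\<close>.\<close>

lemma weak_eq_truncated:
  assumes f: "\<And>s. (f has_real_derivative f' s) (at s)" and f': "continuous_on UNIV f'"
    and C: "\<And>s. \<bar>f s\<bar> \<le> C" "\<And>s. \<bar>f' s\<bar> \<le> C" and k: "\<And>s. f s \<noteq> 0 \<Longrightarrow> \<bar>s\<bar> \<le> k"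
    and \<phi>: "\<phi> \<in> test_fun \<Omega> \<or> \<phi> = (\<lambda>_. 1) \<and> f 0 = 0"
  shows "(\<integral>x. (F x \<bullet> Du x) * (f' (u x) * \<phi> x) \<partial>M) + (\<integral>x. (f (u x) *\<^sub>R F x) \<bullet> grad \<phi> x \<partial>M)
     + (\<integral>x. (b x * f (u x)) * \<phi> x \<partial>M) = w (\<lambda>x. f (u x) * \<phi> x)"
proof -
  have fm[measurable]: "f \<in> borel_measurable borel" "f' \<in> borel_measurable borel"
    using f' f by (auto intro!: borel_measurable_continuous_onI) (meson DERIV_isCont continuous_at_imp_continuous_on)
  have sm: "smooth \<phi>" using \<phi> test_funD(1) smooth_const by blast
  have C0: "C \<ge> 0" using C(1)[of 0] by linarith
  obtain B where B: "B > 0" "\<And>x. \<bar>\<phi> x\<bar> \<le> B" "\<And>x. norm (grad \<phi> x) \<le> B"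
  proof (cases "\<phi> \<in> test_fun \<Omega>")
    case True then show ?thesis using test_fun_bounded[of \<phi> \<Omega>] that by metis
  next
    case False then have "\<phi> = (\<lambda>_. 1)" using \<phi> by auto
    then show ?thesis using that[of 1] by simp
  qed
  have m\<phi>[measurable]: "\<phi> \<in> borel_measurable M" "grad \<phi> \<in> borel_measurable M"
    using \<Omega> sm by (auto intro!: continuous_lebesgue_on_measurable smooth_continuous continuous_on_grad)
  have fb: "\<bar>f' (u x) * \<phi> x\<bar> \<le> C * B" "\<bar>f (u x) * \<phi> x\<bar> \<le> C * B" for x
    unfolding abs_mult using C B C0 by (auto intro!: mult_mono)
  have i1: "integrable M (\<lambda>x. (F x \<bullet> Du x) * (f' (u x) * \<phi> x))"
    by (rule integrable_mult_bounded[OF FDu_integrable _ fb(1)]) measurable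
  have i2: "integrable M (\<lambda>x. (f (u x) *\<^sub>R F x) \<bullet> grad \<phi> x)"
    by (rule truncated_flux_integrable[OF fm(1) C(1) k m\<phi>(2) B(3)])
  have "(\<integral>x. F x \<bullet> ((f' (u x) * \<phi> x) *\<^sub>R Du x + f (u x) *\<^sub>R grad \<phi> x) \<partial>M) + (\<integral>x. b x * (f (u x) * \<phi> x) \<partial>M)
      = w (\<lambda>x. f (u x) * \<phi> x)"
  proof (rule weak_eq)
    show "W01p \<Omega> 2 (\<lambda>x. f (u x) * \<phi> x) (\<lambda>x. (f' (u x) * \<phi> x) *\<^sub>R Du x + f (u x) *\<^sub>R grad \<phi> x)"
      by (rule W01p_chain_rule[OF \<Omega> u_W01p f f' C \<phi>])
    show "\<exists>M. AE x in lebesgue_on \<Omega>. \<bar>f (u x) * \<phi> x\<bar> \<le> M"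
      using fb(2) by blast
    show "\<exists>M. AE x in lebesgue_on \<Omega>. f (u x) * \<phi> x \<noteq> 0 \<longrightarrow> \<bar>u x\<bar> \<le> M"
      using k by (intro exI[of _ k]) simp
  qed
  also have "(\<integral>x. F x \<bullet> ((f' (u x) * \<phi> x) *\<^sub>R Du x + f (u x) *\<^sub>R grad \<phi> x) \<partial>M)
      = (\<integral>x. (F x \<bullet> Du x) * (f' (u x) * \<phi> x) + (f (u x) *\<^sub>R F x) \<bullet> grad \<phi> x \<partial>M)"
    by (intro Bochner_Integration.integral_cong) (auto simp: inner_add_right mult_ac)
  also have "\<dots> = (\<integral>x. (F x \<bullet> Du x) * (f' (u x) * \<phi> x) \<partial>M) + (\<integral>x. (f (u x) *\<^sub>R F x) \<bullet> grad \<phi> x \<partial>M)"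
    using i1 i2 by (rule Bochner_Integration.integral_add)
  finally show ?thesis by (simp add: mult.assoc)
qed

end

text \<open>Only C is uniform in h. The support radius \<open>k h\<close> may be unbounded, so
  bounds involving \<open>\<alpha>\<close> or \<open>\<beta>\<close> at \<open>k h\<close> are
  usable for fixed h only.\<close>

locale truncated_weak_solution = weak_solution \<Omega> u Du F b \<alpha> \<beta> R w
  for \<Omega> :: "(real^'n) set" and u Du F b \<alpha> \<beta> R w +
  fixes th dth :: "nat \<Rightarrow> real \<Rightarrow> real" and C :: real and k :: "nat \<Rightarrow> real"
  assumes th_deriv: "\<And>h s. (th h has_real_derivative dth h s) (at s)"
    and dth_cont: "\<And>h. continuous_on UNIV (dth h)"
    and th_supp: "\<And>h s. th h s \<noteq> 0 \<Longrightarrow> \<bar>s\<bar> \<le> k h"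
    and th_bdd: "\<And>h s. \<bar>th h s\<bar> \<le> C" and dth_bdd: "\<And>h s. \<bar>dth h s\<bar> \<le> C"
    and th_lim: "\<And>s. (\<lambda>h. th h s) \<longlonglongrightarrow> 1"
    and dth_lim: "\<And>s. (\<lambda>h. dth h s) \<longlonglongrightarrow> 0"
begin

lemma C_nonneg: "C \<ge> 0" using th_bdd[of 0 0] by linarith

lemma th_cont: "continuous_on UNIV (th h)"
  using th_deriv by (meson DERIV_isCont continuous_at_imp_continuous_on)

lemma th_meas[measurable]: "th h \<in> borel_measurable borel" "dth h \<in> borel_measurable borel"
  using th_cont dth_cont by (auto intro: borel_measurable_continuous_onI)

text \<open>Testing with \<open>\<vartheta>\<^sub>h(u)\<^sup>2 arctan u\<close>, the sign condition makes the integrand of the lower order term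
  bounded below, and Fatou's lemma applies.\<close>
lemma b_integrable: "integrable M b"
proof -
  \<comment> \<open>The square removes the sign of \<open>th h\<close>. The arctangent keeps the
    sign of u, and as it vanishes at 0 the function can be tested with the constant factor
    1.\<close>
  define \<psi> where "\<psi> h s = (th h s)\<^sup>2 * arctan s" for h s
  define \<psi>' where "\<psi>' h s = 2 * th h s * dth h s * arctan s + (th h s)\<^sup>2 * inverse (1 + s\<^sup>2)" for h s
  \<comment> \<open>With |arctan| at most 2, the derivative is at most 2 * 2 * C^2 + C^2, and
    \<open>\<psi>\<close> itself at most 2 * C^2.\<close>
  define K where "K = 5 * C\<^sup>2"
  have d\<psi>: "(\<psi> h has_real_derivative \<psi>' h s) (at s)" for h s
    unfolding \<psi>_def[abs_def] \<psi>'_def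
    by (auto intro!: derivative_eq_intros th_deriv simp: power2_eq_square field_simps)
  have c\<psi>: "continuous_on UNIV (\<psi>' h)" for h
    unfolding \<psi>'_def[abs_def]
    by (intro continuous_intros th_cont dth_cont) (auto simp: add_nonneg_eq_0_iff)
  have at: "\<bar>arctan s\<bar> \<le> 2" for s
    using arctan_lbound[of s] arctan_ubound[of s] pi_less_4 by linarith
  have C2: "(th h s)\<^sup>2 \<le> C\<^sup>2" "\<bar>th h s * dth h s\<bar> \<le> C\<^sup>2" for h s
  proof -
    show "(th h s)\<^sup>2 \<le> C\<^sup>2" using power_mono[OF th_bdd[of h s], of 2] by simp
    show "\<bar>th h s * dth h s\<bar> \<le> C\<^sup>2"
      unfolding abs_mult power2_eq_square using th_bdd dth_bdd C_nonneg by (intro mult_mono) auto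
  qed
  have \<psi>b: "\<bar>\<psi> h s\<bar> \<le> K" for h s
  proof -
    have "\<bar>\<psi> h s\<bar> \<le> C\<^sup>2 * 2"
      unfolding \<psi>_def abs_mult using C2 at by (intro mult_mono) auto
    then show ?thesis using zero_le_power2[of C] by (simp add: K_def)
  qed
  have \<psi>'b: "\<bar>\<psi>' h s\<bar> \<le> K" for h s
  proof -
    have "\<bar>(th h s * dth h s) * arctan s\<bar> \<le> C\<^sup>2 * 2"
      unfolding abs_mult[of "th h s * dth h s"] using C2 at by (intro mult_mono) auto
    moreover have "\<bar>(th h s)\<^sup>2 * inverse (1 + s\<^sup>2)\<bar> \<le> C\<^sup>2 * 1"
    proof -
      have "inverse (1 + s\<^sup>2) \<le> 1" by (simp add: inverse_le_1_iff)
      moreover have "inverse (1 + s\<^sup>2) \<ge> 0" by simp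
      ultimately show ?thesis unfolding abs_mult using C2 by (intro mult_mono) auto
    qed
    moreover have "\<psi>' h s = 2 * ((th h s * dth h s) * arctan s) + (th h s)\<^sup>2 * inverse (1 + s\<^sup>2)"
      by (simp add: \<psi>'_def)
    ultimately show ?thesis unfolding K_def by linarith
  qed
  have K0: "K \<ge> 0" by (simp add: K_def)
  have supp: "\<bar>s\<bar> \<le> k h" if "\<psi> h s \<noteq> 0" for h s using that th_supp by (auto simp: \<psi>_def)
  have \<psi>0: "\<psi> h 0 = 0" for h by (simp add: \<psi>_def)
  have \<psi>m[measurable]: "\<psi> h \<in> borel_measurable borel" "\<psi>' h \<in> borel_measurable borel" for h
    using c\<psi> d\<psi> by (auto intro!: borel_measurable_continuous_onI) (meson DERIV_isCont continuous_at_imp_continuous_on)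
  have int: "integrable M (\<lambda>x. b x * \<psi> h (u x))" for h
    by (rule truncated_reaction_integrable[OF \<psi>m(1) \<psi>b supp])
  \<comment> \<open>Independent of h: \<open>\<psi> h\<close> and \<open>\<psi>' h\<close> are
    bounded by K, so the test functions are bounded in H_0^1 and the flux term is bounded by K times
    the L^1 norm of F . Du.\<close>
  define W where "W = w_norm * (sqrt (K\<^sup>2 * measure M (space M)) + sqrt (K\<^sup>2 * (\<integral>x. (norm (Du x))\<^sup>2 \<partial>M)))
      + K * (\<integral>x. \<bar>F x \<bullet> Du x\<bar> \<partial>M)"
  have bW: "(\<integral>x. b x * \<psi> h (u x) \<partial>M) \<le> W" for h
  proof -
    have "W01p \<Omega> 2 (\<lambda>x. \<psi> h (u x) * 1) (\<lambda>x. (\<psi>' h (u x) * 1) *\<^sub>R Du x + \<psi> h (u x) *\<^sub>R grad (\<lambda>_. 1) x)"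
      by (rule W01p_chain_rule[OF \<Omega> u_W01p d\<psi> c\<psi> \<psi>b \<psi>'b]) (use \<psi>0 in auto)
    then have "\<bar>w (\<lambda>x. \<psi> h (u x))\<bar> \<le> w_norm * (sqrt (\<integral>x. (\<psi> h (u x))\<^sup>2 \<partial>M) + sqrt (\<integral>x. (norm (\<psi>' h (u x) *\<^sub>R Du x))\<^sup>2 \<partial>M))"
      using w_bound by fastforce
    also have "\<dots> \<le> w_norm * (sqrt (K\<^sup>2 * measure M (space M)) + sqrt (K\<^sup>2 * (\<integral>x. (norm (Du x))\<^sup>2 \<partial>M)))"
    proof (intro mult_left_mono add_mono real_sqrt_le_mono w_norm_nonneg)
      have sqb: "(\<psi> h s)\<^sup>2 \<le> K\<^sup>2" "(\<psi>' h s)\<^sup>2 \<le> K\<^sup>2" for s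
        using power_mono[OF \<psi>b[of h s], of 2] power_mono[OF \<psi>'b[of h s], of 2] by simp_all
      have "(\<integral>x. (\<psi> h (u x))\<^sup>2 \<partial>M) \<le> (\<integral>x. K\<^sup>2 \<partial>M)"
        by (rule integral_mono') (use sqb in auto)
      then show "(\<integral>x. (\<psi> h (u x))\<^sup>2 \<partial>M) \<le> K\<^sup>2 * measure M (space M)" by (simp add: mult.commute)
      have "(\<integral>x. (norm (\<psi>' h (u x) *\<^sub>R Du x))\<^sup>2 \<partial>M) \<le> (\<integral>x. K\<^sup>2 * (norm (Du x))\<^sup>2 \<partial>M)"
        by (rule integral_mono') (use sqb u_facts(4) in \<open>auto simp: power_mult_distrib mult_right_mono\<close>)
      then show "(\<integral>x. (norm (\<psi>' h (u x) *\<^sub>R Du x))\<^sup>2 \<partial>M) \<le> K\<^sup>2 * (\<integral>x. (norm (Du x))\<^sup>2 \<partial>M)" by simp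
    qed
    finally have 1: "\<bar>w (\<lambda>x. \<psi> h (u x))\<bar> \<le> \<dots>" .
    have "\<bar>\<integral>x. (F x \<bullet> Du x) * \<psi>' h (u x) \<partial>M\<bar> \<le> (\<integral>x. \<bar>(F x \<bullet> Du x) * \<psi>' h (u x)\<bar> \<partial>M)"
      by (rule integral_abs_bound)
    also have "\<dots> \<le> (\<integral>x. \<bar>F x \<bullet> Du x\<bar> * K \<partial>M)"
      by (rule integral_mono') (use FDu_integrable \<psi>'b K0 in \<open>auto simp: abs_mult mult_left_mono\<close>)
    finally have 2: "\<bar>\<integral>x. (F x \<bullet> Du x) * \<psi>' h (u x) \<partial>M\<bar> \<le> K * (\<integral>x. \<bar>F x \<bullet> Du x\<bar> \<partial>M)"
      by (simp add: mult.commute)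
    have "(\<integral>x. (F x \<bullet> Du x) * \<psi>' h (u x) \<partial>M) + (\<integral>x. b x * \<psi> h (u x) \<partial>M) = w (\<lambda>x. \<psi> h (u x))"
      using weak_eq_truncated[where \<phi>="\<lambda>_. 1" and f="\<psi> h" and f'="\<psi>' h" and C=K and k="k h",
          OF d\<psi> c\<psi> \<psi>b \<psi>'b supp] \<psi>0 by simp
    with 1 2 show ?thesis unfolding W_def by linarith
  qed
  \<comment> \<open>Below R the sign of b is unknown, but there |b| is at most
    \<open>\<beta> R\<close> times |Du|^2; adding L |Du|^2 makes the integrands nonnegative, as
    Fatou's lemma requires.\<close>
  define L where "L = K * \<beta> R"
  have "integrable M (\<lambda>x. b x * arctan (u x) + L * (norm (Du x))\<^sup>2)"
  proof (rule Fatou_integrable[where f="\<lambda>h x. b x * \<psi> h (u x) + L * (norm (Du x))\<^sup>2"])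
    show "integrable M (\<lambda>x. b x * \<psi> h (u x) + L * (norm (Du x))\<^sup>2)" for h using int u_facts(4) by simp
    show "(\<integral>x. b x * \<psi> h (u x) + L * (norm (Du x))\<^sup>2 \<partial>M) \<le> W + L * (\<integral>x. (norm (Du x))\<^sup>2 \<partial>M)" for h
      using int u_facts(4) bW by simp
    fix x assume "x \<in> space M"
    then have x: "x \<in> \<Omega>" by simp
    show "0 \<le> b x * \<psi> h (u x) + L * (norm (Du x))\<^sup>2" for h
    proof (cases "\<bar>u x\<bar> \<ge> R")
      case True
      have "b x * arctan (u x) \<ge> 0"
        using b_sign[OF x True] R_pos True by (auto simp: zero_le_mult_iff)
      moreover have "b x * \<psi> h (u x) = (th h (u x))\<^sup>2 * (b x * arctan (u x))" by (simp add: \<psi>_def)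
      ultimately have "b x * \<psi> h (u x) \<ge> 0" by (metis mult_nonneg_nonneg zero_le_power2)
      moreover have "L \<ge> 0" using K0 \<beta>_nonneg R_pos by (simp add: L_def)
      ultimately show ?thesis by simp
    next
      case False
      have "\<bar>b x * \<psi> h (u x)\<bar> \<le> (\<beta> R * (norm (Du x))\<^sup>2) * K"
        unfolding abs_mult using b_bound[OF x, of R] False \<psi>b \<beta>_nonneg R_pos by (intro mult_mono) auto
      also have "\<dots> = L * (norm (Du x))\<^sup>2" by (simp add: L_def mult_ac)
      finally show ?thesis by linarith
    qed
    have "(\<lambda>h. b x * ((th h (u x))\<^sup>2 * arctan (u x)) + L * (norm (Du x))\<^sup>2) \<longlonglongrightarrow> b x * (1\<^sup>2 * arctan (u x)) + L * (norm (Du x))\<^sup>2"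
      by (intro tendsto_intros th_lim)
    then show "(\<lambda>h. b x * \<psi> h (u x) + L * (norm (Du x))\<^sup>2) \<longlonglongrightarrow> b x * arctan (u x) + L * (norm (Du x))\<^sup>2"
      by (simp add: \<psi>_def)
  qed
  from Bochner_Integration.integrable_diff[OF this integrable_mult_right[OF u_facts(4), of L]]
  have ba: "integrable M (\<lambda>x. b x * arctan (u x))" by simp
  show ?thesis
  proof (rule Bochner_Integration.integrable_bound)
    \<comment> \<open>The first summand dominates |b| where |u| is at most R, the second where |u| >
      R, since there |arctan u| is at least arctan R > 0.\<close>
    show "integrable M (\<lambda>x. \<beta> R * (norm (Du x))\<^sup>2 + \<bar>b x * arctan (u x)\<bar> / arctan R)"
      using ba u_facts(4) by simp
    show "AE x in M. norm (b x) \<le> norm (\<beta> R * (norm (Du x))\<^sup>2 + \<bar>b x * arctan (u x)\<bar> / arctan R)"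
    proof (rule AE_I2)
      fix x assume "x \<in> space M"
      then have x: "x \<in> \<Omega>" by simp
      have aR: "arctan R > 0" using R_pos by simp
      have "\<beta> R * (norm (Du x))\<^sup>2 \<ge> 0" using \<beta>_nonneg R_pos by simp
      moreover have "\<bar>b x * arctan (u x)\<bar> / arctan R \<ge> 0" using aR by simp
      moreover have "\<bar>b x\<bar> \<le> \<beta> R * (norm (Du x))\<^sup>2 \<or> \<bar>b x\<bar> \<le> \<bar>b x * arctan (u x)\<bar> / arctan R"
      proof (cases "\<bar>u x\<bar> \<le> R")
        case False
        have "arctan R \<le> \<bar>arctan (u x)\<bar>"
          using False arctan_monotone'[of R "u x"] arctan_monotone'[of R "- u x"] by (cases "u x \<ge> 0") (auto simp: arctan_minus)
        then have "\<bar>b x\<bar> * arctan R \<le> \<bar>b x\<bar> * \<bar>arctan (u x)\<bar>" by (rule mult_left_mono) simp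
        then show ?thesis using aR by (simp add: pos_le_divide_eq abs_mult)
      qed (use b_bound[OF x] in auto)
      ultimately show "norm (b x) \<le> norm (\<beta> R * (norm (Du x))\<^sup>2 + \<bar>b x * arctan (u x)\<bar> / arctan R)"
        unfolding real_norm_def by linarith
    qed
  qed (rule b_meas)
qed

end

subsection \<open>Convergence in the dual space\<close>

lemma integral_lincomb:
  fixes f g :: "'a \<Rightarrow> real"
  assumes "integrable M f" "integrable M g"
  shows "(\<integral>x. c * f x + d * g x \<partial>M) = c * integral\<^sup>L M f + d * integral\<^sup>L M g"
  using assms by simp

context truncated_weak_solution
begin

text \<open>Formally the divergence of F, read off from the weak equation because F itself need not
  be integrable. This choice makes the limit identity immediate and leaves the convergence as the
  substance.\<close>

definition T :: "(real^'n \<Rightarrow> real) \<Rightarrow> real" where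
  "T \<phi> = (\<integral>x. b x * \<phi> x \<partial>M) - w \<phi>"

definition flux_div :: "nat \<Rightarrow> (real^'n \<Rightarrow> real) \<Rightarrow> real" where
  "flux_div h = div_dist \<Omega> (\<lambda>x. th h (u x) *\<^sub>R F x)"

lemma grad_powr_integrable:
  assumes "\<phi> \<in> test_fun \<Omega>" "p > 0"
  shows "integrable M (\<lambda>x. \<bar>norm (grad \<phi> x)\<bar> powr p)"
proof -
  note [measurable] = test_fun_L2(1,2)[OF \<Omega> assms(1)]
  obtain B where B: "B > 0" "\<And>x. \<bar>\<phi> x\<bar> \<le> B" "\<And>x. norm (grad \<phi> x) \<le> B"
    using test_fun_bounded[OF assms(1)] by metis
  then show ?thesis
    using assms(2) by (intro integrable_const_bound[where B="B powr p"]) (auto intro!: powr_mono2)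
qed

text \<open>Hoelder's inequality against the constant 1; the constant depends only on p and the
  finite volume of \<open>\<Omega>\<close>.\<close>

lemma grad_L2_le_W1_norm:
  assumes p: "p > 2"
  obtains c where "c \<ge> 0" "\<And>\<phi>. \<phi> \<in> test_fun \<Omega> \<Longrightarrow> sqrt (\<integral>x. (norm (grad \<phi> x))\<^sup>2 \<partial>M) \<le> c * W1_norm \<Omega> p \<phi> (grad \<phi>)"
proof
  define c where "c = (\<integral>x. 1\<^sup>2 powr (p / (p - 2)) \<partial>M) powr ((p - 2) / p)"
  show "sqrt c \<ge> 0" by (simp add: c_def)
  fix \<phi> assume \<phi>: "\<phi> \<in> test_fun \<Omega>"
  note [measurable] = test_fun_L2(1,2)[OF \<Omega> \<phi>]
  have "(\<integral>x. (1 * norm (grad \<phi> x))\<^sup>2 \<partial>M)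
      \<le> c * ((\<integral>x. \<bar>norm (grad \<phi> x)\<bar> powr p \<partial>M) powr (1 / p))\<^sup>2"
    unfolding c_def using p grad_powr_integrable[OF \<phi>, of p]
    by (intro Holder_square_mult[OF finite, where C=1]) auto
  then have "(\<integral>x. (norm (grad \<phi> x))\<^sup>2 \<partial>M) \<le> c * (Lp_norm \<Omega> p (\<lambda>x. norm (grad \<phi> x)))\<^sup>2"
    by (simp add: Lp_norm_def)
  then have "sqrt (\<integral>x. (norm (grad \<phi> x))\<^sup>2 \<partial>M) \<le> sqrt (c * (Lp_norm \<Omega> p (\<lambda>x. norm (grad \<phi> x)))\<^sup>2)"
    by (rule real_sqrt_le_mono)
  also have "\<dots> = sqrt c * Lp_norm \<Omega> p (\<lambda>x. norm (grad \<phi> x))"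
    by (simp add: real_sqrt_mult abs_of_nonneg[OF Lp_norm_nonneg])
  also have "\<dots> \<le> sqrt c * W1_norm \<Omega> p \<phi> (grad \<phi>)"
    using Lp_norm_nonneg by (intro mult_left_mono) (auto simp: W1_norm_def c_def)
  finally show "sqrt (\<integral>x. (norm (grad \<phi> x))\<^sup>2 \<partial>M) \<le> sqrt c * W1_norm \<Omega> p \<phi> (grad \<phi>)" .
qed

lemma flux_integrable:
  assumes "\<phi> \<in> test_fun \<Omega>"
  shows "integrable M (\<lambda>x. (th h (u x) *\<^sub>R F x) \<bullet> grad \<phi> x)"
proof -
  obtain B where B: "B > 0" "\<And>x. \<bar>\<phi> x\<bar> \<le> B" "\<And>x. norm (grad \<phi> x) \<le> B"
    using test_fun_bounded[OF assms] by metis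
  show ?thesis
    by (rule truncated_flux_integrable[OF th_meas(1) th_bdd th_supp test_fun_L2(2)[OF \<Omega> assms] B(3)])
qed

lemma b_mult_integrable:
  assumes "\<phi> \<in> test_fun \<Omega>" "f \<in> borel_measurable borel" "\<And>s. \<bar>f s\<bar> \<le> A"
  shows "integrable M (\<lambda>x. b x * (f (u x) * \<phi> x))" "integrable M (\<lambda>x. (F x \<bullet> Du x) * (f (u x) * \<phi> x))"
proof -
  note [measurable] = test_fun_L2(1,2)[OF \<Omega> assms(1)] assms(2)
  obtain B where B: "B > 0" "\<And>x. \<bar>\<phi> x\<bar> \<le> B" using test_fun_bounded[OF assms(1)] by metis
  have A: "A \<ge> 0" using assms(3)[of 0] by linarith
  have *: "\<bar>f (u x) * \<phi> x\<bar> \<le> A * B" for x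
    unfolding abs_mult using assms(3) B A by (intro mult_mono) auto
  show "integrable M (\<lambda>x. b x * (f (u x) * \<phi> x))"
    by (rule integrable_mult_bounded[OF b_integrable _ *]) measurable
  show "integrable M (\<lambda>x. (F x \<bullet> Du x) * (f (u x) * \<phi> x))"
    by (rule integrable_mult_bounded[OF FDu_integrable _ *]) measurable
qed

text \<open>For fixed h the truncated flux is bounded by a multiple of |Du|, hence in L^2, and
  gradients are controlled in L^2 since p > 2. The constant involves
  \<open>\<alpha> \<bar>k h\<bar>\<close> and is not uniform in h.\<close>

lemma flux_div_in_Wm1q:
  assumes p: "conj_exp q > 2"
  shows "in_Wm1q \<Omega> q (flux_div h)"
  unfolding in_Wm1q_def
proof (intro conjI ballI allI)
  fix \<phi> \<psi> c d assume \<phi>: "\<phi> \<in> test_fun \<Omega>" and \<psi>: "\<psi> \<in> test_fun \<Omega>"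
  have "flux_div h (\<lambda>x. c * \<phi> x + d * \<psi> x)
      = - (\<integral>x. c * ((th h (u x) *\<^sub>R F x) \<bullet> grad \<phi> x) + d * ((th h (u x) *\<^sub>R F x) \<bullet> grad \<psi> x) \<partial>M)"
    unfolding flux_div_def div_dist_def grad_lincomb[OF test_funD(1)[OF \<phi>] test_funD(1)[OF \<psi>]]
    by (simp add: inner_add_right algebra_simps)
  also have "\<dots> = c * flux_div h \<phi> + d * flux_div h \<psi>"
    unfolding flux_div_def div_dist_def
    integral_lincomb[OF flux_integrable[OF \<phi>, of h] flux_integrable[OF \<psi>, of h]] by simp
  finally show "flux_div h (\<lambda>x. c * \<phi> x + d * \<psi> x) = c * flux_div h \<phi> + d * flux_div h \<psi>" .
next
  obtain c where c: "c \<ge> 0"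
      "\<And>\<phi>. \<phi> \<in> test_fun \<Omega> \<Longrightarrow> sqrt (\<integral>x. (norm (grad \<phi> x))\<^sup>2 \<partial>M) \<le> c * W1_norm \<Omega> (conj_exp q) \<phi> (grad \<phi>)"
    using grad_L2_le_W1_norm[OF p] by metis
  define G where "G x = norm (th h (u x) *\<^sub>R F x)" for x
  note Fm[measurable] = truncated_flux(1)[OF th_meas(1) th_bdd th_supp]
  have [measurable]: "G \<in> borel_measurable M" unfolding G_def[abs_def] by measurable
  have G2: "integrable M (\<lambda>x. (G x)\<^sup>2)"
  proof (rule Bochner_Integration.integrable_bound)
    show "integrable M (\<lambda>x. (C * \<alpha> \<bar>k h\<bar>)\<^sup>2 * (norm (Du x))\<^sup>2)" using u_facts(4) by simp
    show "AE x in M. norm ((G x)\<^sup>2) \<le> norm ((C * \<alpha> \<bar>k h\<bar>)\<^sup>2 * (norm (Du x))\<^sup>2)"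
    proof (rule AE_I2)
      fix x assume "x \<in> space M"
      then have x: "x \<in> \<Omega>" by simp
      have "G x \<le> C * \<alpha> \<bar>k h\<bar> * norm (Du x)"
        unfolding G_def by (intro truncated_flux(2)[OF th_meas(1) th_bdd th_supp] x)
      then have "(G x)\<^sup>2 \<le> (C * \<alpha> \<bar>k h\<bar> * norm (Du x))\<^sup>2" by (intro power_mono) (auto simp: G_def)
      then show "norm ((G x)\<^sup>2) \<le> norm ((C * \<alpha> \<bar>k h\<bar>)\<^sup>2 * (norm (Du x))\<^sup>2)"
        by (simp add: power_mult_distrib)
    qed
  qed simp
  have "\<bar>flux_div h \<phi>\<bar> \<le> (sqrt (\<integral>x. (G x)\<^sup>2 \<partial>M) * c) * W1_norm \<Omega> (conj_exp q) \<phi> (grad \<phi>)"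
    if \<phi>: "\<phi> \<in> test_fun \<Omega>" for \<phi>
  proof -
    note L2 = test_fun_L2[OF \<Omega> \<phi>]
    note [measurable] = L2(1,2)
    have "\<bar>flux_div h \<phi>\<bar> \<le> (\<integral>x. \<bar>(th h (u x) *\<^sub>R F x) \<bullet> grad \<phi> x\<bar> \<partial>M)"
      unfolding flux_div_def div_dist_def abs_minus by (rule integral_abs_bound)
    also have "\<dots> \<le> (\<integral>x. \<bar>G x * norm (grad \<phi> x)\<bar> \<partial>M)"
    proof (rule integral_mono')
      have "integrable M (\<lambda>x. G x * norm (grad \<phi> x))"
        using L2 G2 by (intro Cauchy_Schwarz_integral) auto
      then show "integrable M (\<lambda>x. \<bar>G x * norm (grad \<phi> x)\<bar>)" by simp
      show "\<bar>(th h (u x) *\<^sub>R F x) \<bullet> grad \<phi> x\<bar> \<le> \<bar>G x * norm (grad \<phi> x)\<bar>" for x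
        unfolding G_def abs_mult abs_norm_cancel by (rule Cauchy_Schwarz_ineq2)
    qed simp
    also have "\<dots> \<le> sqrt (\<integral>x. (G x)\<^sup>2 \<partial>M) * sqrt (\<integral>x. (norm (grad \<phi> x))\<^sup>2 \<partial>M)"
      using L2 G2 by (intro Cauchy_Schwarz_integral) auto
    also have "\<dots> \<le> sqrt (\<integral>x. (G x)\<^sup>2 \<partial>M) * (c * W1_norm \<Omega> (conj_exp q) \<phi> (grad \<phi>))"
      using c(2)[OF \<phi>] by (intro mult_left_mono) auto
    finally show ?thesis by (simp add: mult.assoc)
  qed
  then show "\<exists>C. \<forall>\<phi>\<in>test_fun \<Omega>. \<bar>flux_div h \<phi>\<bar> \<le> C * W1_norm \<Omega> (conj_exp q) \<phi> (grad \<phi>)"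
    by blast
qed

text \<open>As b is only in L^1, its pairing with \<open>\<phi>\<close> uses the supremum bound of
  Morrey's inequality; w uses the L^2 bounds of \<open>\<phi>\<close> and its gradient.\<close>

lemma T_in_Wm1q:
  assumes p: "conj_exp q > 2" "conj_exp q > real CARD('n)"
  shows "in_Wm1q \<Omega> q T"
  unfolding in_Wm1q_def
proof (intro conjI ballI allI)
  fix \<phi> \<psi> c d assume \<phi>: "\<phi> \<in> test_fun \<Omega>" and \<psi>: "\<psi> \<in> test_fun \<Omega>"
  have "(\<integral>x. b x * (c * \<phi> x + d * \<psi> x) \<partial>M) = (\<integral>x. c * (b x * \<phi> x) + d * (b x * \<psi> x) \<partial>M)"
    by (simp add: algebra_simps)
  also have "\<dots> = c * (\<integral>x. b x * \<phi> x \<partial>M) + d * (\<integral>x. b x * \<psi> x \<partial>M)"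
    using b_mult_integrable(1)[OF \<phi>, of "\<lambda>_. 1" 1] b_mult_integrable(1)[OF \<psi>, of "\<lambda>_. 1" 1] by simp
  finally show "T (\<lambda>x. c * \<phi> x + d * \<psi> x) = c * T \<phi> + d * T \<psi>"
    using w_linear[OF test_fun_W01p[OF \<Omega> \<phi>] test_fun_W01p[OF \<Omega> \<psi>], of c d]
    by (simp add: T_def algebra_simps)
next
  let ?W = "\<lambda>\<phi>. W1_norm \<Omega> (conj_exp q) \<phi> (grad \<phi>)"
  obtain c where c: "c \<ge> 0"
      "\<And>\<phi>. \<phi> \<in> test_fun \<Omega> \<Longrightarrow> sqrt (\<integral>x. (norm (grad \<phi> x))\<^sup>2 \<partial>M) \<le> c * ?W \<phi>"
    using grad_L2_le_W1_norm[OF p(1)] by metis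
  obtain K where K: "K > 0" "\<And>\<phi> x. \<phi> \<in> test_fun \<Omega> \<Longrightarrow> \<bar>\<phi> x\<bar> \<le> K * ?W \<phi>"
    using Morrey_test_fun[OF \<Omega>(1) p(2)] by metis
  have "\<bar>T \<phi>\<bar> \<le> ((\<integral>x. \<bar>b x\<bar> \<partial>M) * K + w_norm * (K * sqrt (measure M (space M)) + c)) * ?W \<phi>"
    if \<phi>: "\<phi> \<in> test_fun \<Omega>" for \<phi>
  proof -
    have "\<bar>\<integral>x. b x * \<phi> x \<partial>M\<bar> \<le> (\<integral>x. \<bar>b x * \<phi> x\<bar> \<partial>M)" by (rule integral_abs_bound)
    also have "\<dots> \<le> (\<integral>x. \<bar>b x\<bar> * (K * ?W \<phi>) \<partial>M)"
      using b_integrable K W1_norm_nonneg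
      by (intro integral_mono') (auto simp: abs_mult intro!: mult_left_mono K(2)[OF \<phi>])
    finally have 1: "\<bar>\<integral>x. b x * \<phi> x \<partial>M\<bar> \<le> (\<integral>x. \<bar>b x\<bar> \<partial>M) * (K * ?W \<phi>)"
      by simp
    have "(\<integral>x. (\<phi> x)\<^sup>2 \<partial>M) \<le> (\<integral>x. (K * ?W \<phi>)\<^sup>2 \<partial>M)"
    proof (rule integral_mono')
      show "(\<phi> x)\<^sup>2 \<le> (K * ?W \<phi>)\<^sup>2" for x
        using power_mono[OF K(2)[OF \<phi>, of x], of 2] by simp
    qed auto
    then have "sqrt (\<integral>x. (\<phi> x)\<^sup>2 \<partial>M) \<le> sqrt (measure M (space M) * (K * ?W \<phi>)\<^sup>2)"
      by (intro real_sqrt_le_mono) simp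
    also have "\<dots> = sqrt (measure M (space M)) * (K * ?W \<phi>)"
      using K(1) W1_norm_nonneg by (simp add: real_sqrt_mult)
    finally have "\<bar>w \<phi>\<bar> \<le> w_norm * (sqrt (measure M (space M)) * (K * ?W \<phi>) + c * ?W \<phi>)"
      using c(2)[OF \<phi>] by (intro order_trans[OF w_bound[OF test_fun_W01p[OF \<Omega> \<phi>]]] mult_left_mono add_mono w_norm_nonneg)
    with 1 have "\<bar>T \<phi>\<bar> \<le> (\<integral>x. \<bar>b x\<bar> \<partial>M) * (K * ?W \<phi>) + w_norm * (sqrt (measure M (space M)) * (K * ?W \<phi>) + c * ?W \<phi>)"
      unfolding T_def by linarith
    then show ?thesis by (simp add: algebra_simps)
  qed
  then show "\<exists>C. \<forall>\<phi>\<in>test_fun \<Omega>. \<bar>T \<phi>\<bar> \<le> C * ?W \<phi>" by blast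
qed

lemma flux_div_minus_T:
  assumes \<phi>: "\<phi> \<in> test_fun \<Omega>"
  shows "flux_div h \<phi> - T \<phi> = (\<integral>x. (F x \<bullet> Du x) * (dth h (u x) * \<phi> x) \<partial>M)
     - (\<integral>x. b x * ((1 - th h (u x)) * \<phi> x) \<partial>M) + w (\<lambda>x. (1 - th h (u x)) * \<phi> x)"
proof -
  have eq: "(\<integral>x. (F x \<bullet> Du x) * (dth h (u x) * \<phi> x) \<partial>M) + (\<integral>x. (th h (u x) *\<^sub>R F x) \<bullet> grad \<phi> x \<partial>M)
     + (\<integral>x. (b x * th h (u x)) * \<phi> x \<partial>M) = w (\<lambda>x. th h (u x) * \<phi> x)"
    by (rule weak_eq_truncated[OF th_deriv dth_cont th_bdd dth_bdd th_supp disjI1[OF \<phi>]])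
  have "(\<integral>x. b x * ((1 - th h (u x)) * \<phi> x) \<partial>M) = (\<integral>x. b x * (1 * \<phi> x) - b x * (th h (u x) * \<phi> x) \<partial>M)"
    by (simp add: algebra_simps)
  also have "\<dots> = (\<integral>x. b x * \<phi> x \<partial>M) - (\<integral>x. b x * (th h (u x) * \<phi> x) \<partial>M)"
    using b_mult_integrable(1)[OF \<phi>, of "\<lambda>_. 1" 1] b_mult_integrable(1)[OF \<phi> th_meas(1) th_bdd, of h] by simp
  finally have eb: "(\<integral>x. b x * ((1 - th h (u x)) * \<phi> x) \<partial>M) = (\<integral>x. b x * \<phi> x \<partial>M) - (\<integral>x. (b x * th h (u x)) * \<phi> x \<partial>M)"
    by (simp add: mult.assoc)
  \<comment> \<open>Linearity of w is available on H_0^1 only, so membership must be known before w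
    is split.\<close>
  have "W01p \<Omega> 2 (\<lambda>x. th h (u x) * \<phi> x) (\<lambda>x. (dth h (u x) * \<phi> x) *\<^sub>R Du x + th h (u x) *\<^sub>R grad \<phi> x)"
    by (rule W01p_chain_rule[OF \<Omega> u_W01p th_deriv dth_cont th_bdd dth_bdd disjI1[OF \<phi>]])
  from w_linear[OF test_fun_W01p[OF \<Omega> \<phi>] this, of 1 "-1"]
  have "w (\<lambda>x. (1 - th h (u x)) * \<phi> x) = w \<phi> - w (\<lambda>x. th h (u x) * \<phi> x)"
    by (simp add: algebra_simps)
  with eq eb show ?thesis by (simp add: flux_div_def div_dist_def T_def)
qed

text \<open>Morrey's inequality controls \<open>\<phi>\<close> uniformly, so every term of \<open>flux_div_minus_T\<close> is dominated by an
  integral that tends to 0 independently of \<open>\<phi>\<close> by dominated convergence.\<close>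
lemma flux_div_tendsto:
  assumes p: "conj_exp q > 2" "conj_exp q > real CARD('n)"
  shows "(\<lambda>h. Wm1q_norm \<Omega> q (\<lambda>\<phi>. flux_div h \<phi> - T \<phi>)) \<longlonglongrightarrow> 0"
proof -
  define r where "r = conj_exp q"
  have r: "r > 2" using p by (simp add: r_def)
  let ?W = "\<lambda>\<phi>. W1_norm \<Omega> r \<phi> (grad \<phi>)"
  obtain K where K: "K > 0" "\<And>\<phi> x. \<phi> \<in> test_fun \<Omega> \<Longrightarrow> \<bar>\<phi> x\<bar> \<le> K * ?W \<phi>"
    using Morrey_test_fun[OF \<Omega>(1) p(2)] unfolding r_def by metis
  \<comment> \<open>P and Q measure the flux and reaction errors. A, D and H measure the H_0^1 norm
    of the argument of w: its values, the gradient part with Du, and the gradient part with grad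
    \<open>\<phi>\<close>.\<close>
  define A where "A h = (\<integral>x. (1 - th h (u x))\<^sup>2 \<partial>M)" for h
  define D where "D h = (\<integral>x. (dth h (u x))\<^sup>2 * (norm (Du x))\<^sup>2 \<partial>M)" for h
  define H where "H h = (\<integral>x. (1 - th h (u x))\<^sup>2 powr (r / (r - 2)) \<partial>M)" for h
  define P where "P h = (\<integral>x. \<bar>(F x \<bullet> Du x) * dth h (u x)\<bar> \<partial>M)" for h
  define Q where "Q h = (\<integral>x. \<bar>b x * (1 - th h (u x))\<bar> \<partial>M)" for h
  define C1 where "C1 = 1 + C"
  have C1: "\<bar>1 - th h s\<bar> \<le> C1" "\<bar>dth h s\<bar> \<le> C1" "C1 \<ge> 0" for h s
    using th_bdd[of h s] dth_bdd[of h s] C_nonneg by (auto simp: C1_def)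
  have C1sq: "(1 - th h s)\<^sup>2 \<le> C1\<^sup>2" "(dth h s)\<^sup>2 \<le> C1\<^sup>2" for h s
    using power_mono[OF C1(1)[of h s], of 2] power_mono[OF C1(2)[of h s], of 2] by simp_all
  have l1: "(\<lambda>h. 1 - th h s) \<longlonglongrightarrow> 0" for s
    using tendsto_diff[OF tendsto_const[of 1] th_lim[of s]] by simp
  have A: "A \<longlonglongrightarrow> 0"
  proof -
    have "A \<longlonglongrightarrow> (\<integral>x. 0 \<partial>M)"
      unfolding A_def[abs_def]
    proof (rule integral_dominated_convergence[where w="\<lambda>_. C1\<^sup>2"])
      show "AE x in M. (\<lambda>h. (1 - th h (u x))\<^sup>2) \<longlonglongrightarrow> 0"
        using tendsto_power[OF l1, of _ 2] by (intro AE_I2) simp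
    qed (use C1sq in auto)
    then show ?thesis by simp
  qed
  have D: "D \<longlonglongrightarrow> 0"
  proof -
    have "D \<longlonglongrightarrow> (\<integral>x. 0 \<partial>M)"
      unfolding D_def[abs_def]
    proof (rule integral_dominated_convergence[where w="\<lambda>x. C1\<^sup>2 * (norm (Du x))\<^sup>2"])
      show "AE x in M. (\<lambda>h. (dth h (u x))\<^sup>2 * (norm (Du x))\<^sup>2) \<longlonglongrightarrow> 0"
      proof (rule AE_I2)
        fix x
        have "(\<lambda>h. (dth h (u x))\<^sup>2 * (norm (Du x))\<^sup>2) \<longlonglongrightarrow> 0\<^sup>2 * (norm (Du x))\<^sup>2"
          by (intro tendsto_intros dth_lim)
        then show "(\<lambda>h. (dth h (u x))\<^sup>2 * (norm (Du x))\<^sup>2) \<longlonglongrightarrow> 0" by simp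
      qed
    qed (use C1sq u_facts(4) in \<open>auto intro!: mult_right_mono\<close>)
    then show ?thesis by simp
  qed
  have H: "H \<longlonglongrightarrow> 0"
  proof -
    have "H \<longlonglongrightarrow> (\<integral>x. 0 \<partial>M)"
      unfolding H_def[abs_def]
    proof (rule integral_dominated_convergence[where w="\<lambda>_. C1\<^sup>2 powr (r / (r - 2))"])
      show "AE x in M. (\<lambda>h. (1 - th h (u x))\<^sup>2 powr (r / (r - 2))) \<longlonglongrightarrow> 0"
      proof (rule AE_I2)
        fix x
        have "(\<lambda>h. (1 - th h (u x))\<^sup>2) \<longlonglongrightarrow> 0" using tendsto_power[OF l1[of "u x"], of 2] by simp
        then have "(\<lambda>h. (1 - th h (u x))\<^sup>2 powr (r / (r - 2))) \<longlonglongrightarrow> 0 powr (r / (r - 2))"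
          using r by (intro tendsto_powr2) auto
        then show "(\<lambda>h. (1 - th h (u x))\<^sup>2 powr (r / (r - 2))) \<longlonglongrightarrow> 0" by simp
      qed
      show "AE x in M. norm ((1 - th h (u x))\<^sup>2 powr (r / (r - 2))) \<le> C1\<^sup>2 powr (r / (r - 2))" for h
        using C1sq r by (intro AE_I2) (auto intro!: powr_mono2)
    qed auto
    then show ?thesis by simp
  qed
  have P: "P \<longlonglongrightarrow> 0"
  proof -
    have "P \<longlonglongrightarrow> (\<integral>x. 0 \<partial>M)"
      unfolding P_def[abs_def]
    proof (rule integral_dominated_convergence[where w="\<lambda>x. \<bar>F x \<bullet> Du x\<bar> * C1"])
      show "AE x in M. (\<lambda>h. \<bar>(F x \<bullet> Du x) * dth h (u x)\<bar>) \<longlonglongrightarrow> 0"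
        using tendsto_rabs_zero[OF tendsto_mult_right_zero[OF dth_lim]] by (intro AE_I2)
      show "AE x in M. norm \<bar>(F x \<bullet> Du x) * dth h (u x)\<bar> \<le> \<bar>F x \<bullet> Du x\<bar> * C1" for h
        using C1 by (intro AE_I2) (auto simp: abs_mult intro!: mult_left_mono)
    qed (use FDu_integrable in auto)
    then show ?thesis by simp
  qed
  have Q: "Q \<longlonglongrightarrow> 0"
  proof -
    have "Q \<longlonglongrightarrow> (\<integral>x. 0 \<partial>M)"
      unfolding Q_def[abs_def]
    proof (rule integral_dominated_convergence[where w="\<lambda>x. \<bar>b x\<bar> * C1"])
      show "AE x in M. (\<lambda>h. \<bar>b x * (1 - th h (u x))\<bar>) \<longlonglongrightarrow> 0"
        using tendsto_rabs_zero[OF tendsto_mult_right_zero[OF l1]] by (intro AE_I2)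
      show "AE x in M. norm \<bar>b x * (1 - th h (u x))\<bar> \<le> \<bar>b x\<bar> * C1" for h
        using C1 by (intro AE_I2) (auto simp: abs_mult intro!: mult_left_mono)
    qed (use b_integrable in auto)
    then show ?thesis by simp
  qed
  \<comment> \<open>The rate depends on h but on no test function: \<open>\<phi>\<close> enters only
    through its supremum bound K and the bound 1 on the L^r norm of its gradient.\<close>
  define E where "E h = P h * K + Q h * K
     + w_norm * (sqrt (K\<^sup>2 * A h) + sqrt (2 * K\<^sup>2 * D h + 2 * H h powr ((r - 2) / r)))" for h
  have "(\<lambda>h. P h * K + Q h * K
     + w_norm * (sqrt (K\<^sup>2 * A h) + sqrt (2 * K\<^sup>2 * D h + 2 * H h powr ((r - 2) / r))))
     \<longlonglongrightarrow> 0 * K + 0 * K + w_norm * (sqrt (K\<^sup>2 * 0) + sqrt (2 * K\<^sup>2 * 0 + 2 * 0 powr ((r - 2) / r)))"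
    using r by (intro tendsto_intros A D P Q tendsto_powr2 H) (auto simp: H_def)
  then have E: "E \<longlonglongrightarrow> 0" by (simp add: E_def[abs_def])
  have main: "\<bar>flux_div h \<phi> - T \<phi>\<bar> \<le> E h" if \<phi>: "\<phi> \<in> test_fun \<Omega>" and W: "?W \<phi> \<le> 1" for \<phi> h
  proof -
    note L2 = test_fun_L2[OF \<Omega> \<phi>]
    note [measurable] = L2(1,2)
    have "K * ?W \<phi> \<le> K * 1" using W K(1) by (intro mult_left_mono) auto
    then have sup: "\<bar>\<phi> x\<bar> \<le> K" for x using K(2)[OF \<phi>, of x] by linarith
    have sup2: "(\<phi> x)\<^sup>2 \<le> K\<^sup>2" for x using power_mono[OF sup[of x], of 2] by simp
    let ?z = "\<lambda>x. (1 - th h (u x)) * \<phi> x"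
    let ?Dz = "\<lambda>x. ((0 - dth h (u x)) * \<phi> x) *\<^sub>R Du x + (1 - th h (u x)) *\<^sub>R grad \<phi> x"
    \<comment> \<open>The function 1 - th_h need not vanish at 0; the factor \<open>\<phi>\<close>
      supplies the compact support, so the first alternative of the chain rule applies.\<close>
    have "W01p \<Omega> 2 ?z ?Dz"
    proof (rule W01p_chain_rule[OF \<Omega> u_W01p, where f="\<lambda>s. 1 - th h s" and f'="\<lambda>s. 0 - dth h s" and C=C1])
      show "((\<lambda>s. 1 - th h s) has_real_derivative 0 - dth h s) (at s)" for s
        by (intro DERIV_diff DERIV_const th_deriv)
      show "continuous_on UNIV (\<lambda>s. 0 - dth h s)" by (intro continuous_intros dth_cont)
    qed (use \<phi> C1 in auto)
    then have wz: "\<bar>w ?z\<bar> \<le> w_norm * (sqrt (\<integral>x. (?z x)\<^sup>2 \<partial>M) + sqrt (\<integral>x. (norm (?Dz x))\<^sup>2 \<partial>M))"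
      by (rule w_bound)
    have iA: "integrable M (\<lambda>x. (1 - th h (u x))\<^sup>2)"
      using C1sq by (intro integrable_const_bound[where B="C1\<^sup>2"]) auto
    have z2: "(\<integral>x. (?z x)\<^sup>2 \<partial>M) \<le> K\<^sup>2 * A h"
    proof -
      have "(\<integral>x. (?z x)\<^sup>2 \<partial>M) \<le> (\<integral>x. K\<^sup>2 * (1 - th h (u x))\<^sup>2 \<partial>M)"
        using iA sup2 by (intro integral_mono') (auto simp: power_mult_distrib mult.commute intro!: mult_right_mono)
      then show ?thesis by (simp add: A_def)
    qed
    have iD: "integrable M (\<lambda>x. (dth h (u x))\<^sup>2 * (norm (Du x))\<^sup>2)"
      by (rule Bochner_Integration.integrable_bound[where f="\<lambda>x. C1\<^sup>2 * (norm (Du x))\<^sup>2"])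
         (use u_facts(4) C1sq in \<open>auto intro!: mult_right_mono\<close>)
    have r0: "r > 0" using r by simp
    note hol = Holder_square_mult[OF finite r, where f="\<lambda>x. 1 - th h (u x)" and g="\<lambda>x. norm (grad \<phi> x)" and C=C1,
        OF _ _ C1(1) grad_powr_integrable[OF \<phi> r0]]
    have iH: "integrable M (\<lambda>x. ((1 - th h (u x)) * norm (grad \<phi> x))\<^sup>2)" by (rule hol(1)) measurable
    have "Lp_norm \<Omega> r (\<lambda>x. norm (grad \<phi> x)) \<le> 1"
      using W Lp_norm_nonneg[of \<Omega> r \<phi>] by (simp add: W1_norm_def)
    then have Lp: "((\<integral>x. \<bar>norm (grad \<phi> x)\<bar> powr r \<partial>M) powr (1 / r))\<^sup>2 \<le> 1"
      unfolding Lp_norm_def by (simp add: power_le_one)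
    have "(\<integral>x. ((1 - th h (u x)) * norm (grad \<phi> x))\<^sup>2 \<partial>M) \<le> H h powr ((r - 2) / r) * ((\<integral>x. \<bar>norm (grad \<phi> x)\<bar> powr r \<partial>M) powr (1 / r))\<^sup>2"
      unfolding H_def by (rule hol(2)) measurable
    also have "\<dots> \<le> H h powr ((r - 2) / r) * 1"
      using Lp by (intro mult_left_mono) auto
    finally have bH: "(\<integral>x. ((1 - th h (u x)) * norm (grad \<phi> x))\<^sup>2 \<partial>M) \<le> H h powr ((r - 2) / r)" by simp
    have Dz2: "(\<integral>x. (norm (?Dz x))\<^sup>2 \<partial>M) \<le> 2 * K\<^sup>2 * D h + 2 * H h powr ((r - 2) / r)"
    proof -
      have "(\<integral>x. (norm (?Dz x))\<^sup>2 \<partial>M)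
        \<le> (\<integral>x. 2 * K\<^sup>2 * ((dth h (u x))\<^sup>2 * (norm (Du x))\<^sup>2) + 2 * ((1 - th h (u x)) * norm (grad \<phi> x))\<^sup>2 \<partial>M)"
      proof (rule integral_mono')
        show "integrable M (\<lambda>x. 2 * K\<^sup>2 * ((dth h (u x))\<^sup>2 * (norm (Du x))\<^sup>2) + 2 * ((1 - th h (u x)) * norm (grad \<phi> x))\<^sup>2)"
          using iD iH by (intro Bochner_Integration.integrable_add integrable_mult_right)
        fix x
        have "norm (?Dz x) \<le> \<bar>\<phi> x\<bar> * (\<bar>dth h (u x)\<bar> * norm (Du x)) + \<bar>1 - th h (u x)\<bar> * norm (grad \<phi> x)"
          by (rule norm_triangle_le) (simp add: abs_mult)
        then have "(norm (?Dz x))\<^sup>2 \<le> (\<bar>\<phi> x\<bar> * (\<bar>dth h (u x)\<bar> * norm (Du x)) + \<bar>1 - th h (u x)\<bar> * norm (grad \<phi> x))\<^sup>2"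
          by (rule power_mono) simp
        also have "\<dots> \<le> 2 * (\<bar>\<phi> x\<bar> * (\<bar>dth h (u x)\<bar> * norm (Du x)))\<^sup>2 + 2 * (\<bar>1 - th h (u x)\<bar> * norm (grad \<phi> x))\<^sup>2"
          by (rule power2_add_le)
        also have "\<dots> = 2 * ((\<phi> x)\<^sup>2 * ((dth h (u x))\<^sup>2 * (norm (Du x))\<^sup>2)) + 2 * ((1 - th h (u x)) * norm (grad \<phi> x))\<^sup>2"
          by (simp add: power_mult_distrib)
        also have "\<dots> \<le> 2 * (K\<^sup>2 * ((dth h (u x))\<^sup>2 * (norm (Du x))\<^sup>2)) + 2 * ((1 - th h (u x)) * norm (grad \<phi> x))\<^sup>2"
          using sup2[of x] by (intro add_mono mult_left_mono mult_right_mono) auto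
        finally show "(norm (?Dz x))\<^sup>2 \<le> 2 * K\<^sup>2 * ((dth h (u x))\<^sup>2 * (norm (Du x))\<^sup>2) + 2 * ((1 - th h (u x)) * norm (grad \<phi> x))\<^sup>2"
          by (simp add: mult.assoc)
      qed auto
      also have "\<dots> = 2 * K\<^sup>2 * D h + 2 * (\<integral>x. ((1 - th h (u x)) * norm (grad \<phi> x))\<^sup>2 \<partial>M)"
        unfolding D_def by (rule integral_lincomb[OF iD iH])
      finally show ?thesis using bH by linarith
    qed
    have wz': "\<bar>w ?z\<bar> \<le> w_norm * (sqrt (K\<^sup>2 * A h) + sqrt (2 * K\<^sup>2 * D h + 2 * H h powr ((r - 2) / r)))"
      by (rule order_trans[OF wz]) (intro mult_left_mono add_mono real_sqrt_le_mono z2 Dz2 w_norm_nonneg)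
    have bd: "\<bar>\<integral>x. g x * (f x * \<phi> x) \<partial>M\<bar> \<le> (\<integral>x. \<bar>g x * f x\<bar> \<partial>M) * K"
      if "integrable M (\<lambda>x. g x * f x)" for f g
    proof -
      have "\<bar>\<integral>x. g x * (f x * \<phi> x) \<partial>M\<bar> \<le> (\<integral>x. \<bar>g x * (f x * \<phi> x)\<bar> \<partial>M)" by (rule integral_abs_bound)
      also have "\<dots> \<le> (\<integral>x. \<bar>g x * f x\<bar> * K \<partial>M)"
      proof (rule integral_mono')
        show "integrable M (\<lambda>x. \<bar>g x * f x\<bar> * K)" using that by simp
        show "\<bar>g x * (f x * \<phi> x)\<bar> \<le> \<bar>g x * f x\<bar> * K" for x
          using sup[of x] by (simp only: abs_mult mult.assoc[symmetric]) (intro mult_left_mono, auto)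
      qed (use K(1) in auto)
      finally show ?thesis by simp
    qed
    have "integrable M (\<lambda>x. (F x \<bullet> Du x) * dth h (u x))"
      by (rule integrable_mult_bounded[OF FDu_integrable _ C1(2)]) measurable
    from bd[OF this] have b1: "\<bar>\<integral>x. (F x \<bullet> Du x) * (dth h (u x) * \<phi> x) \<partial>M\<bar> \<le> P h * K" by (simp add: P_def)
    have "integrable M (\<lambda>x. b x * (1 - th h (u x)))"
      by (rule integrable_mult_bounded[OF b_integrable _ C1(1)]) measurable
    from bd[OF this] have b2: "\<bar>\<integral>x. b x * ((1 - th h (u x)) * \<phi> x) \<partial>M\<bar> \<le> Q h * K" by (simp add: Q_def)
    show ?thesis using b1 b2 wz' unfolding flux_div_minus_T[OF \<phi>] E_def by linarith
  qed
  let ?S = "{\<phi>\<in>test_fun \<Omega>. ?W \<phi> \<le> 1}"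
  \<comment> \<open>The zero function makes the index set of the supremum nonempty, for the upper
    estimate; with the bound E h on the set it also shows that the supremum is nonnegative.\<close>
  have zero: "(\<lambda>_. 0) \<in> ?S"
    by (simp add: zero_test_fun W1_norm_def Lp_norm_def)
  show ?thesis
  proof (rule tendsto_sandwich[OF _ _ tendsto_const E])
    show "\<forall>\<^sub>F h in sequentially. Wm1q_norm \<Omega> q (\<lambda>\<phi>. flux_div h \<phi> - T \<phi>) \<le> E h"
      unfolding Wm1q_norm_def r_def[symmetric]
      using zero main by (intro always_eventually allI cSUP_least) auto
    show "\<forall>\<^sub>F h in sequentially. 0 \<le> Wm1q_norm \<Omega> q (\<lambda>\<phi>. flux_div h \<phi> - T \<phi>)"
    proof (intro always_eventually allI)
      fix h
      have "bdd_above ((\<lambda>\<phi>. \<bar>flux_div h \<phi> - T \<phi>\<bar>) ` ?S)"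
        using main by (intro bdd_aboveI[of _ "E h"]) auto
      from cSUP_upper[OF zero this] show "0 \<le> Wm1q_norm \<Omega> q (\<lambda>\<phi>. flux_div h \<phi> - T \<phi>)"
        unfolding Wm1q_norm_def r_def[symmetric] by (rule order_trans[OF abs_ge_zero])
    qed
  qed
qed

end

section \<open>From the integrand j to the bounds on the flux and the reaction term\<close>

theorem theorem4p9:
  fixes \<Omega> :: "(real^'n) set"
    and j :: "real^'n \<Rightarrow> real \<Rightarrow> real^'n \<Rightarrow> real"
    and js :: "real^'n \<Rightarrow> real \<Rightarrow> real^'n \<Rightarrow> real"
    and jxi :: "real^'n \<Rightarrow> real \<Rightarrow> real^'n \<Rightarrow> real^'n"
    and \<alpha> \<beta> :: "real \<Rightarrow> real" and \<alpha>0 R :: real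
    and w :: "(real^'n \<Rightarrow> real) \<Rightarrow> real"
    and u :: "real^'n \<Rightarrow> real" and Du :: "real^'n \<Rightarrow> real^'n"
    and th dth :: "nat \<Rightarrow> real \<Rightarrow> real"
  assumes dim: "CARD('n) \<ge> 3"
    and \<Omega>_open: "open \<Omega>" and \<Omega>_bdd: "bounded \<Omega>"
    and j_meas: "\<And>s \<xi>. (\<lambda>x. j x s \<xi>) \<in> borel_measurable (lebesgue_on \<Omega>)"
    and j_deriv: "\<And>x s \<xi>. x \<in> \<Omega> \<Longrightarrow>
        ((\<lambda>(s', \<xi>'). j x s' \<xi>') has_derivative (\<lambda>(a, b). js x s \<xi> * a + jxi x s \<xi> \<bullet> b)) (at (s, \<xi>))"
    and js_cont: "\<And>x. x \<in> \<Omega> \<Longrightarrow> continuous_on UNIV (\<lambda>(s, \<xi>). js x s \<xi>)"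
    and jxi_cont: "\<And>x. x \<in> \<Omega> \<Longrightarrow> continuous_on UNIV (\<lambda>(s, \<xi>). jxi x s \<xi>)"
    and H1: "\<And>x s. x \<in> \<Omega> \<Longrightarrow> strictly_convex_fun (\<lambda>\<xi>. j x s \<xi>)"
    and \<alpha>0_pos: "\<alpha>0 > 0"
    and \<alpha>_pos: "\<And>t. t \<ge> 0 \<Longrightarrow> \<alpha> t > 0" and \<alpha>_mono: "mono_on {0..} \<alpha>"
    and \<alpha>_cont: "continuous_on {0..} \<alpha>"
    and H2: "\<And>x s \<xi>. x \<in> \<Omega> \<Longrightarrow> \<alpha>0 * (norm \<xi>)^2 \<le> j x s \<xi> \<and> j x s \<xi> \<le> \<alpha> \<bar>s\<bar> * (norm \<xi>)^2"
    and \<beta>_pos: "\<And>t. t \<ge> 0 \<Longrightarrow> \<beta> t > 0" and \<beta>_mono: "mono_on {0..} \<beta>"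
    and \<beta>_cont: "continuous_on {0..} \<beta>"
    and H3: "\<And>x s \<xi>. x \<in> \<Omega> \<Longrightarrow> \<bar>js x s \<xi>\<bar> \<le> \<beta> \<bar>s\<bar> * (norm \<xi>)^2"
    and R_pos: "R > 0"
    and H4: "\<And>x s \<xi>. x \<in> \<Omega> \<Longrightarrow> \<bar>s\<bar> \<ge> R \<Longrightarrow> js x s \<xi> * s \<ge> 0"
    and w_Hm1: "in_Hm1 \<Omega> w"
    and u_H01: "W01p \<Omega> 2 u Du"
    and eq: "\<And>z Dz. W01p \<Omega> 2 z Dz \<Longrightarrow>
               (\<exists>M. AE x in lebesgue_on \<Omega>. \<bar>z x\<bar> \<le> M) \<Longrightarrow>
               (\<exists>M. AE x in lebesgue_on \<Omega>. z x \<noteq> 0 \<longrightarrow> \<bar>u x\<bar> \<le> M) \<Longrightarrow>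
               (\<integral>x. jxi x (u x) (Du x) \<bullet> Dz x \<partial>lebesgue_on \<Omega>)
                 + (\<integral>x. js x (u x) (Du x) * z x \<partial>lebesgue_on \<Omega>) = w z"
    and L1: "integrable (lebesgue_on \<Omega>) (\<lambda>x. jxi x (u x) (Du x) \<bullet> Du x)"
    and th_deriv: "\<And>h s. (th h has_real_derivative dth h s) (at s)"
    and dth_cont: "\<And>h. continuous_on UNIV (dth h)"
    and th_supp: "\<And>h. compact (closure {s. th h s \<noteq> 0})"
    and th_bdd: "\<exists>C. \<forall>h s. \<bar>th h s\<bar> \<le> C"
    and dth_bdd: "\<exists>C. \<forall>h s. \<bar>dth h s\<bar> \<le> C"
    and th_lim: "\<And>s. (\<lambda>h. th h s) \<longlonglongrightarrow> 1"
    and dth_lim: "\<And>s. (\<lambda>h. dth h s) \<longlonglongrightarrow> 0"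
  shows "\<forall>q. 1 < q \<and> q < real CARD('n) / (real CARD('n) - 1) \<longrightarrow>
           (\<exists>T. in_Wm1q \<Omega> q T
              \<and> (\<forall>h. in_Wm1q \<Omega> q (div_dist \<Omega> (\<lambda>x. th h (u x) *\<^sub>R jxi x (u x) (Du x))))
              \<and> (\<lambda>h. Wm1q_norm \<Omega> q
                     (\<lambda>\<phi>. div_dist \<Omega> (\<lambda>x. th h (u x) *\<^sub>R jxi x (u x) (Du x)) \<phi> - T \<phi>)) \<longlonglongrightarrow> 0
              \<and> loc_int \<Omega> (\<lambda>x. js x (u x) (Du x))
              \<and> (\<forall>\<phi>\<in>test_fun \<Omega>.
                   - T \<phi> + (\<integral>x. js x (u x) (Du x) * \<phi> x \<partial>lebesgue_on \<Omega>) = w \<phi>))"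
proof (intro allI impI)
  fix q :: real assume q: "1 < q \<and> q < real CARD('n) / (real CARD('n) - 1)"
  let ?M = "lebesgue_on \<Omega>"
  let ?F = "\<lambda>x. jxi x (u x) (Du x)" and ?b = "\<lambda>x. js x (u x) (Du x)"
  note U = W1p_2D[OF \<Omega>_open conjunct1[OF u_H01[unfolded W01p_def]]]
  have Y: "(\<lambda>x. (u x, Du x)) \<in> borel_measurable ?M"
    using U(1,2) by (rule borel_measurable_Pair)
  \<comment> \<open>Measurability of the joint derivative along each fixed direction v; (1, 0)
    selects \<open>js\<close> and (0, axis i 1) selects the i-th component of
    \<open>jxi\<close>.\<close>
  have meas: "(\<lambda>x. (case (u x, Du x) of (s, \<xi>) \<Rightarrow> \<lambda>(a, c). js x s \<xi> * a + jxi x s \<xi> \<bullet> c) v) \<in> borel_measurable ?M" for v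
  proof (rule Caratheodory_derivative_measurable[OF _ _ Y,
        where g="\<lambda>x (s, \<xi>). j x s \<xi>" and g'="\<lambda>x (s, \<xi>) (a, c). js x s \<xi> * a + jxi x s \<xi> \<bullet> c"])
    show "(\<lambda>x. case y of (s, \<xi>) \<Rightarrow> j x s \<xi>) \<in> borel_measurable ?M" for y
      using j_meas by (cases y) simp
    show "((\<lambda>(s, \<xi>). j x s \<xi>) has_derivative (case y of (s, \<xi>) \<Rightarrow> \<lambda>(a, c). js x s \<xi> * a + jxi x s \<xi> \<bullet> c)) (at y)"
      if "x \<in> space ?M" for x y
      using j_deriv that by (cases y) simp
  qed
  have b_meas: "?b \<in> borel_measurable ?M" using meas[of "(1, 0)"] by simp
  have F_meas: "?F \<in> borel_measurable ?M"
    by (rule borel_measurable_cartI) (use meas[of "(0, axis _ 1)"] in \<open>simp add: inner_axis\<close>)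
  \<comment> \<open>Freezing s leaves a strictly convex function of \<open>\<xi>\<close> between 0
    and \<open>\<alpha> \<bar>s\<bar>\<close> times |\<open>\<xi>\<close>|^2, to which the slope
    bound applies.\<close>
  have jxi_bound: "norm (jxi x s \<xi>) \<le> 4 * \<alpha> \<bar>s\<bar> * norm \<xi>" if x: "x \<in> \<Omega>" for x s \<xi>
  proof (rule convex_quadratic_growth_derivative_bound[OF H1[OF x, of s]])
    have "((\<lambda>\<xi>'. (s, \<xi>')) has_derivative (\<lambda>c. (0, c))) (at \<xi>)"
      by (auto intro!: derivative_eq_intros)
    from has_derivative_compose[OF this j_deriv[OF x]]
    show "((\<lambda>\<xi>. j x s \<xi>) has_derivative (\<lambda>c. jxi x s \<xi> \<bullet> c)) (at \<xi>)" by simp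
    show "0 \<le> j x s \<eta>" for \<eta>
      using H2[OF x, of \<eta> s] \<alpha>0_pos by (meson mult_nonneg_nonneg less_imp_le order_trans zero_le_power2)
  qed (use \<alpha>_pos H2[OF x] in auto)
  obtain C1 C2 where C12: "\<And>h s. \<bar>th h s\<bar> \<le> C1" "\<And>h s. \<bar>dth h s\<bar> \<le> C2"
    using th_bdd dth_bdd by blast
  have "\<exists>r. \<forall>s. th h s \<noteq> 0 \<longrightarrow> \<bar>s\<bar> \<le> r" for h
  proof -
    obtain r where "\<And>s. s \<in> closure {s. th h s \<noteq> 0} \<Longrightarrow> \<bar>s\<bar> \<le> r"
      using compact_imp_bounded[OF th_supp[of h]] by (auto simp: bounded_iff)
    then show ?thesis using closure_subset[of "{s. th h s \<noteq> 0}"] by blast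
  qed
  then obtain k where k: "\<And>h s. th h s \<noteq> 0 \<Longrightarrow> \<bar>s\<bar> \<le> k h" by metis
  interpret truncated_weak_solution \<Omega> u Du ?F ?b "\<lambda>r. 4 * \<alpha> r" \<beta> R w th dth "max C1 C2" k
  proof unfold_locales
    show "norm (?F x) \<le> 4 * \<alpha> r * norm (Du x)" if "x \<in> \<Omega>" "\<bar>u x\<bar> \<le> r" for x r
    proof -
      have "\<alpha> \<bar>u x\<bar> \<le> \<alpha> r" using that by (intro mono_onD[OF \<alpha>_mono]) auto
      then have "4 * \<alpha> \<bar>u x\<bar> * norm (Du x) \<le> 4 * \<alpha> r * norm (Du x)" by (intro mult_right_mono) auto
      then show ?thesis using jxi_bound[OF that(1), of "u x" "Du x"] by linarith
    qed
    show "\<bar>?b x\<bar> \<le> \<beta> r * (norm (Du x))\<^sup>2" if "x \<in> \<Omega>" "\<bar>u x\<bar> \<le> r" for x r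
    proof -
      have "\<beta> \<bar>u x\<bar> \<le> \<beta> r" using that by (intro mono_onD[OF \<beta>_mono]) auto
      then have "\<beta> \<bar>u x\<bar> * (norm (Du x))\<^sup>2 \<le> \<beta> r * (norm (Du x))\<^sup>2" by (intro mult_right_mono) auto
      then show ?thesis using H3[OF that(1), of "u x" "Du x"] by linarith
    qed
    show "\<bar>th h s\<bar> \<le> max C1 C2" "\<bar>dth h s\<bar> \<le> max C1 C2" for h s
      using C12(1)[of h s] C12(2)[of h s] by linarith+
    show "4 * \<alpha> r \<ge> 0" "\<beta> r \<ge> 0" if "r \<ge> 0" for r
      using \<alpha>_pos[OF that] \<beta>_pos[OF that] by auto
  qed (fact \<Omega>_open \<Omega>_bdd F_meas b_meas R_pos H4 w_Hm1 u_H01 eq L1 th_deriv dth_cont k th_lim dth_lim)+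
  have N: "real CARD('n) \<ge> 3" using dim by simp
  \<comment> \<open>The bound q < N / (N - 1) is exactly q / (q - 1) > N, the threshold for Morrey's
    inequality.\<close>
  have p1: "conj_exp q > real CARD('n)"
  proof -
    have "q * (real CARD('n) - 1) < real CARD('n)" using q N by (simp add: pos_less_divide_eq)
    then have "real CARD('n) * (q - 1) < q" by (simp add: algebra_simps)
    then show ?thesis unfolding conj_exp_def using q by (simp add: pos_less_divide_eq)
  qed
  then have p2: "conj_exp q > 2" using N by linarith
  show "\<exists>T. in_Wm1q \<Omega> q T
              \<and> (\<forall>h. in_Wm1q \<Omega> q (div_dist \<Omega> (\<lambda>x. th h (u x) *\<^sub>R jxi x (u x) (Du x))))
              \<and> (\<lambda>h. Wm1q_norm \<Omega> q
                     (\<lambda>\<phi>. div_dist \<Omega> (\<lambda>x. th h (u x) *\<^sub>R jxi x (u x) (Du x)) \<phi> - T \<phi>)) \<longlonglongrightarrow> 0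
              \<and> loc_int \<Omega> (\<lambda>x. js x (u x) (Du x))
              \<and> (\<forall>\<phi>\<in>test_fun \<Omega>.
                   - T \<phi> + (\<integral>x. js x (u x) (Du x) * \<phi> x \<partial>lebesgue_on \<Omega>) = w \<phi>)"
  proof (intro exI[of _ T] conjI allI ballI)
    show "in_Wm1q \<Omega> q T" by (rule T_in_Wm1q[OF p2 p1])
    show "in_Wm1q \<Omega> q (div_dist \<Omega> (\<lambda>x. th h (u x) *\<^sub>R jxi x (u x) (Du x)))" for h
      using flux_div_in_Wm1q[OF p2, of h] by (simp add: flux_div_def)
    show "(\<lambda>h. Wm1q_norm \<Omega> q
        (\<lambda>\<phi>. div_dist \<Omega> (\<lambda>x. th h (u x) *\<^sub>R jxi x (u x) (Du x)) \<phi> - T \<phi>)) \<longlonglongrightarrow> 0"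
      using flux_div_tendsto[OF p2 p1] by (simp add: flux_div_def)
    show "loc_int \<Omega> (\<lambda>x. js x (u x) (Du x))"
      by (rule integrable_imp_loc_int[OF \<Omega>_open b_integrable])
    \<comment> \<open>The identity holds by the choice of \<open>T\<close>; its content lies in the
      convergence just shown.\<close>
    show "- T \<phi> + (\<integral>x. js x (u x) (Du x) * \<phi> x \<partial>lebesgue_on \<Omega>) = w \<phi>" for \<phi>
      by (simp add: T_def)
  qed
qed

end
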